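(* Let $(\xi(s))_{s\in\mathbb{Z}}$ be i.i.d. real random variables. Then, for every $\tau>0$, the point process of exceedances $$\Phi_n=\Big\{\frac in:\ \xi(S_i)>u_n^{(\tau)},\ 0\le i\le n\Big\}$$ converges in distribution, as $n\to\infty$, to a compound Poisson point process in $[0,1]$ with intensity $\theta\tau$, where $\theta=q$, and cluster size distribution $$\pi(j)=\frac{\mathbb{P}(N(0)=j)-\mathbb{P}(N(0)=j+1)}{\theta}=q(1-q)^{j-1},\qquad j\ge1.$$
   Context: Random walk: $S_0=0$, $S_n=X_1+\cdots+X_n$ for $n\ge1$, where $(X_i)_{i\ge1}$ are independent with $\mathbb{P}(X_i=1)=p$, $\mathbb{P}(X_i=-1)=1-p$, $p\in(0,1)\setminus\{1/2\}$. The sequence $(\xi(s))_{s\in\mathbb{Z}}$ is independent of $(X_i)_{i\ge1}$. Set $q=\mathbb{P}(S_i\ne0\ \forall i\ge1)$ (one has $q=|2p-1|$), and $N(0)=\#\{i\ge0:\ S_i=0\}$, the number of visits to $0$. Thresholds: it is assumed that for every $\tau>0$ there is a sequence $u_n=u_n^{(\tau)}$ with $n\,\mathbb{P}(\xi(0)>u_n)\to\tau$; these sequences are fixed. Compound Poisson point process in $[0,1]$ of intensity $\lambda>0$ and cluster size distribution $\pi$: a point process of the form $\{(x_j,n_j),\,j\ge1\}$ (a point at $x_j$ with multiplicity $n_j$), where $\{x_j\}$ is a stationary Poisson point process in $[0,1]$ of intensity $\lambda$ and $(n_j)$ are i.i.d. with distribution $\pi$, independent of the $x_j$'s. *)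

theory Defs
  imports "HOL-Probability.Probability"
begin

text \<open>\<open>prob_space.indep_var\<close> forces both random variables to have the same value
  type; this is independence of the generated sigma-algebras for arbitrary types.\<close>

definition indep_rv ::
  "'b measure \<Rightarrow> 'c measure \<Rightarrow> ('b \<Rightarrow> 'c) \<Rightarrow> 'd measure \<Rightarrow> ('b \<Rightarrow> 'd) \<Rightarrow> bool" where
  "indep_rv M A U B V \<longleftrightarrow>
     U \<in> M \<rightarrow>\<^sub>M A \<and> V \<in> M \<rightarrow>\<^sub>M B \<and>
     prob_space.indep_set M {U -` a \<inter> space M | a. a \<in> sets A} {V -` b \<inter> space M | b. b \<in> sets B}"


section \<open>Random walk\<close>

text \<open>The increments are the variables with index at least 1; \<open>X 0\<close> is never used.\<close>

definition walk :: "(nat \<Rightarrow> 'a \<Rightarrow> int) \<Rightarrow> nat \<Rightarrow> 'a \<Rightarrow> int" where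
  "walk X n \<omega> = (\<Sum>i = 1..n. X i \<omega>)"

definition escape_prob :: "'a measure \<Rightarrow> (nat \<Rightarrow> 'a \<Rightarrow> int) \<Rightarrow> real" where
  "escape_prob M X = \<P>(\<omega> in M. \<forall>i\<ge>1. walk X i \<omega> \<noteq> 0)"

text \<open>Time 0 always counts as a visit, so the junk value \<open>card A = 0\<close> for infinite \<open>A\<close>
  does not interfere with the events \<open>visits X \<omega> = j\<close>, \<open>j \<ge> 1\<close>.\<close>

definition visits :: "(nat \<Rightarrow> 'a \<Rightarrow> int) \<Rightarrow> 'a \<Rightarrow> nat" where
  "visits X \<omega> = card {i. walk X i \<omega> = 0}"


section \<open>Point processes in the unit interval\<close>

text \<open>Since \<open>[0,1]\<close> is compact, a locally finite point configuration (integer-valued Radon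
  measure) in \<open>[0,1]\<close> is a finite multiset. The integral of a function \<open>f\<close> against it is
  \<open>\<Sum>x\<in>#c. f x\<close>, and the vague topology is the coarsest topology that makes
  these integrals continuous in \<open>c\<close> for all continuous \<open>f\<close> on \<open>[0,1]\<close>.\<close>

definition configs :: "real multiset set" where
  "configs = {c. set_mset c \<subseteq> {0..1}}"

definition vague_topology :: "real multiset topology" where
  "vague_topology = topology_generated_by
     {{c \<in> configs. (\<Sum>x\<in>#c. f x) \<in> U} | (f :: real \<Rightarrow> real) U. continuous_on {0..1} f \<and> open U}"

definition vague_borel :: "real multiset measure" where
  "vague_borel = sigma configs {U. openin vague_topology U}"

definition point_process :: "'b measure \<Rightarrow> ('b \<Rightarrow> real multiset) \<Rightarrow> bool" where
  "point_process M N \<longleftrightarrow> prob_space M \<and> N \<in> M \<rightarrow>\<^sub>M vague_borel"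

definition converges_in_distribution ::
  "'a measure \<Rightarrow> (nat \<Rightarrow> 'a \<Rightarrow> real multiset) \<Rightarrow> 'b measure \<Rightarrow> ('b \<Rightarrow> real multiset) \<Rightarrow> bool" where
  "converges_in_distribution M \<Phi> Q \<Psi> \<longleftrightarrow>
     (\<forall>n. point_process M (\<Phi> n)) \<and> point_process Q \<Psi> \<and>
     (\<forall>F :: real multiset \<Rightarrow> real.
        continuous_map vague_topology euclideanreal F \<and> bounded (F ` configs) \<longrightarrow>
        (\<lambda>n. \<integral>\<omega>. F (\<Phi> n \<omega>) \<partial>M) \<longlonglongrightarrow> (\<integral>\<omega>. F (\<Psi> \<omega>) \<partial>Q))"


section \<open>Poisson and compound Poisson processes\<close>

text \<open>The Poisson probabilities are written out because \<open>poisson_pmf\<close> requires a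
  positive rate, whereas \<open>B\<close> may be a null set.\<close>

definition poisson_process :: "'b measure \<Rightarrow> real \<Rightarrow> ('b \<Rightarrow> real multiset) \<Rightarrow> bool" where
  "poisson_process M l N \<longleftrightarrow>
     point_process M N \<and>
     (\<forall>B k. B \<in> sets borel \<and> B \<subseteq> {0..1} \<longrightarrow>
        \<P>(\<omega> in M. size {#x \<in># N \<omega>. x \<in> B#} = k) =
          (l * measure lborel B) ^ k / fact k * exp (- (l * measure lborel B))) \<and>
     (\<forall>(I :: nat set) B. finite I \<and> disjoint_family_on B I \<and>
          (\<forall>i\<in>I. B i \<in> sets borel \<and> B i \<subseteq> {0..1}) \<longrightarrow>
        prob_space.indep_vars M (\<lambda>_. count_space UNIV)
          (\<lambda>i \<omega>. size {#x \<in># N \<omega>. x \<in> B i#}) I)"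

text \<open>The Poisson process in \<open>[0,1]\<close> has almost surely finitely many points; \<open>K\<close> is
  their random number and \<open>x 0, \<dots>, x (K - 1)\<close> enumerates them. The point \<open>x j\<close>
  receives multiplicity \<open>m j\<close>.\<close>

definition compound_poisson_process ::
  "'b measure \<Rightarrow> real \<Rightarrow> nat pmf \<Rightarrow> ('b \<Rightarrow> real multiset) \<Rightarrow> bool" where
  "compound_poisson_process M l \<pi> \<Psi> \<longleftrightarrow>
     prob_space M \<and>
     (\<exists>(K :: 'b \<Rightarrow> nat) (x :: nat \<Rightarrow> 'b \<Rightarrow> real) (m :: nat \<Rightarrow> 'b \<Rightarrow> nat).
        K \<in> M \<rightarrow>\<^sub>M count_space UNIV \<and>
        (\<forall>j. x j \<in> borel_measurable M) \<and>
        poisson_process M l (\<lambda>\<omega>. {#x j \<omega>. j \<in># mset_set {..<K \<omega>}#}) \<and>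
        prob_space.indep_vars M (\<lambda>_. count_space UNIV) m UNIV \<and>
        (\<forall>j. distr M (count_space UNIV) (m j) = measure_pmf \<pi>) \<and>
        indep_rv M
          (count_space UNIV \<Otimes>\<^sub>M (\<Pi>\<^sub>M j\<in>UNIV. borel)) (\<lambda>\<omega>. (K \<omega>, \<lambda>j. x j \<omega>))
          (\<Pi>\<^sub>M j\<in>UNIV. count_space UNIV) (\<lambda>\<omega> j. m j \<omega>) \<and>
        (\<forall>\<omega>\<in>space M. \<Psi> \<omega> = (\<Sum>j<K \<omega>. replicate_mset (m j \<omega>) (x j \<omega>))))"


section \<open>Exceedances\<close>

definition exceedances ::
  "(nat \<Rightarrow> 'a \<Rightarrow> int) \<Rightarrow> (int \<Rightarrow> 'a \<Rightarrow> real) \<Rightarrow> (nat \<Rightarrow> real) \<Rightarrow> nat \<Rightarrow> 'a \<Rightarrow> real multiset" where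
  "exceedances X \<xi> u n \<omega> =
     {#real i / real n. i \<in># mset_set {i \<in> {0..n}. \<xi> (walk X i \<omega>) \<omega> > u n}#}"

end

theory Submission
  imports Defs "HOL-Real_Asymp.Real_Asymp"
begin

text \<open>On configurations with \<open>k\<close> points the vague topology is a quotient of
  \<open>[0,1]\<^sup>k\<close>, so continuous functions are uniformly continuous there, and
  weak convergence reduces to the joint law of the numbers of points in the cells of a finite
  grid, hence to the generating functions \<open>E(\<Prod> z\<^sub>l ^ N\<^sub>l)\<close>.
  Given the walk, the sites carry independent exceedances of probability \<open>r \<sim> \<tau> / n\<close>, so
  this generating function is the expectation of a product over the visited sites \<open>s\<close> of
  \<open>1 - r (1 - \<Prod> z)\<close>, the inner product running over the visits to \<open>s\<close> up to time
  \<open>n\<close>; it is close to \<open>E(exp (- r B))\<close>, where \<open>B\<close> is the sum of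
  \<open>1 - \<Prod> z\<close> over the sites. Decomposing
  each term according to the visits to \<open>s\<close> turns \<open>B\<close> into a sum over times \<open>i\<close> of
  \<open>(1 - z) \<Prod> z\<close>, the product now running over the returns after \<open>i\<close>. By transience
  only returns within a bounded time \<open>T\<close> matter, and then a second moment bound for
  \<open>T\<close>-dependent variables shows that \<open>B / n\<close> is asymptotically constant. The number of returns is
  geometric, which identifies the constant with the exponent of the compound Poisson process.\<close>

section \<open>Convergence of point processes in the unit interval\<close>

text \<open>Test functions are continuous for a topology given only by a subbase. No metric on
  configurations is introduced: it suffices that the map from tuples of points to configurations is
  continuous, and compactness of the cube supplies the uniformity. The obstacle on the side of the
  walk is that the product over visited sites has a random index set, and that the factor of a site
  involves all visits to it, at times that may be far apart. Ordering the visits to a site and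
  telescoping produces summands indexed by the deterministic times \<open>0\<close> to
  \<open>n\<close>, each a function of the increments after its own time. The law of these
  increments does not depend on the time, so no information about the range of the walk or its local
  times has to be provided. The arguments \<open>z\<close> of generating functions are kept in
  \<open>(0, 1]\<close>: this range contains all powers of \<open>1/2\<close>, which suffice to
  recover probabilities from generating functions.\<close>

lemma topspace_vague_topology [simp]: "topspace vague_topology = configs"
proof -
  have "configs = {c \<in> configs. (\<Sum>x\<in>#c. (0::real)) \<in> UNIV}" by simp
  then have "configs \<in> {{c \<in> configs. (\<Sum>x\<in>#c. f x) \<in> U} | (f :: real \<Rightarrow> real) U. continuous_on {0..1} f \<and> open U}"
    using open_UNIV continuous_on_const by blast
  then show ?thesis
    unfolding vague_topology_def topology_generated_by_topspace by blast
qed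

lemma sets_vague_borel: "sets vague_borel = sigma_sets configs {U. openin vague_topology U}"
  and space_vague_borel [simp]: "space vague_borel = configs"
proof -
  have "{U. openin vague_topology U} \<subseteq> Pow configs"
    using openin_subset by fastforce
  then show "sets vague_borel = sigma_sets configs {U. openin vague_topology U}"
    "space vague_borel = configs"
    by (simp_all add: vague_borel_def)
qed

lemma measurable_vague_borel_of_continuous_map:
  fixes F :: "real multiset \<Rightarrow> 'a::topological_space"
  assumes "continuous_map vague_topology euclidean F"
  shows "F \<in> vague_borel \<rightarrow>\<^sub>M borel"
proof (rule borel_measurableI)
  fix S :: "'a set" assume "open S"
  then have "openin vague_topology {c \<in> configs. F c \<in> S}"
    using openin_continuous_map_preimage[OF assms, of S] by (simp add: Collect_conj_eq)
  moreover have "F -` S \<inter> space vague_borel = {c \<in> configs. F c \<in> S}" by auto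
  ultimately show "F -` S \<inter> space vague_borel \<in> sets vague_borel"
    by (auto simp: sets_vague_borel)
qed

text \<open>A retraction of the line onto the unit interval. It turns every element of
  \<open>nat \<Rightarrow> real\<close> into a sequence of admissible points, so that continuity can
  be stated on the whole product space.\<close>

definition clamp :: "real \<Rightarrow> real" where "clamp t = max 0 (min 1 t)"

lemma clamp_in [simp]: "clamp t \<in> {0..1}" "0 \<le> clamp t" "clamp t \<le> 1"
  by (auto simp: clamp_def)

lemma clamp_eq [simp]: "t \<in> {0..1} \<Longrightarrow> clamp t = t" by (auto simp: clamp_def)

lemma continuous_clamp [continuous_intros]: "continuous_on S clamp"
  unfolding clamp_def by (intro continuous_intros)

lemma measurable_clamp [measurable]: "clamp \<in> borel_measurable borel"
  by (intro borel_measurable_continuous_onI continuous_clamp)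

lemma sum_mset_sum_replicate:
  fixes f :: "'b \<Rightarrow> 'c::comm_semiring_1"
  shows "(\<Sum>y\<in>#(\<Sum>j\<in>A. replicate_mset (r j) (x j)). f y) = (\<Sum>j\<in>A. of_nat (r j) * f (x j))"
  by (induction A rule: infinite_finite_induct) auto

lemma sum_replicate_in_configs:
  "(\<And>j. j \<in> A \<Longrightarrow> x j \<in> {0..1}) \<Longrightarrow> (\<Sum>j\<in>A. replicate_mset (r j) (x j)) \<in> configs"
  unfolding configs_def by (induction A rule: infinite_finite_induct) auto

text \<open>Integrating a test function against the image gives a finite sum of continuous functions
  of single coordinates, so preimages of subbasic sets are open. The multiplicities \<open>r\<close>
  are discrete and stay fixed; only positions move. Uniform continuity and measurability below both
  rest on this map.\<close>

lemma continuous_map_sum_replicate: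
  "continuous_map euclidean vague_topology
     (\<lambda>x :: nat \<Rightarrow> real. \<Sum>j<k. replicate_mset (r j) (clamp (x j)))"
  unfolding vague_topology_def
proof (rule continuous_on_generated_topo)
  let ?N = "\<lambda>x :: nat \<Rightarrow> real. \<Sum>j<k. replicate_mset (r j) (clamp (x j))"
  have N: "?N x \<in> configs" for x by (intro sum_replicate_in_configs) auto
  show "openin euclidean (?N -` U \<inter> topspace euclidean)"
    if "U \<in> {{c \<in> configs. (\<Sum>x\<in>#c. f x) \<in> U} | (f :: real \<Rightarrow> real) U. continuous_on {0..1} f \<and> open U}"
    for U
  proof -
    obtain f :: "real \<Rightarrow> real" and V where U: "U = {c \<in> configs. (\<Sum>x\<in>#c. f x) \<in> V}"
      and f: "continuous_on {0..1} f" and V: "open V"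
      using \<open>U \<in> _\<close> by auto
    have "continuous_on UNIV (\<lambda>x :: nat \<Rightarrow> real. \<Sum>j<k. of_nat (r j) * f (clamp (x j)))"
    proof (intro continuous_intros)
      fix j
      have "continuous_on UNIV (\<lambda>x :: nat \<Rightarrow> real. clamp (x j))"
        using continuous_on_compose2[OF continuous_clamp[of UNIV] continuous_on_product_coordinates] by auto
      then show "continuous_on UNIV (\<lambda>x :: nat \<Rightarrow> real. f (clamp (x j)))"
        by (rule continuous_on_compose2[OF f]) auto
    qed
    then have "open ((\<lambda>x :: nat \<Rightarrow> real. \<Sum>j<k. of_nat (r j) * f (clamp (x j))) -` V)"
      using V by (rule open_vimage[rotated])
    moreover have "?N -` U \<inter> topspace euclidean =
       (\<lambda>x. \<Sum>j<k. of_nat (r j) * f (clamp (x j))) -` V"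
      using N by (auto simp: U sum_mset_sum_replicate)
    ultimately show ?thesis by simp
  qed
  show "?N ` topspace euclidean \<subseteq> \<Union> {{c \<in> configs. (\<Sum>x\<in>#c. f x) \<in> U} | (f :: real \<Rightarrow> real) U. continuous_on {0..1} f \<and> open U}"
    using N unfolding topology_generated_by_topspace[symmetric] vague_topology_def[symmetric]
      topspace_vague_topology by (rule image_subsetI)
qed

text \<open>\<open>vague_borel\<close> is generated by all open sets, not only by the subbasic ones,
  so preimages of arbitrary open sets are needed. Once the number of points and the multiplicities
  are fixed, the configuration depends continuously on the positions, and these discrete data take
  only countably many values.\<close>

lemma measurable_sum_replicate:
  assumes K [measurable]: "K \<in> M \<rightarrow>\<^sub>M count_space (UNIV :: nat set)"
    and m [measurable]: "\<And>j. m j \<in> M \<rightarrow>\<^sub>M count_space (UNIV :: nat set)"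
    and x [measurable]: "\<And>j. x j \<in> borel_measurable M"
    and x01: "\<And>j \<omega>. \<omega> \<in> space M \<Longrightarrow> x j \<omega> \<in> {0..1}"
  shows "(\<lambda>\<omega>. \<Sum>j<K \<omega>. replicate_mset (m j \<omega>) (x j \<omega>)) \<in> M \<rightarrow>\<^sub>M vague_borel"
proof -
  define N where "N r \<omega> = (\<Sum>j<length r. replicate_mset (r ! j) (clamp (x j \<omega>)))" for r \<omega>
  \<comment> \<open>A list records number and multiplicities at once and ranges over a countable
    type, which a whole sequence of multiplicities would not.\<close>
  define L where "L \<omega> = map (\<lambda>j. m j \<omega>) [0..<K \<omega>]" for \<omega>
  have L: "L \<in> M \<rightarrow>\<^sub>M count_space UNIV"
    unfolding measurable_count_space_eq2_countable
  proof (intro conjI ballI)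
    fix r :: "nat list"
    have "L -` {r} \<inter> space M = {\<omega> \<in> space M. K \<omega> = length r \<and> (\<forall>j\<in>{..<length r}. m j \<omega> = r ! j)}"
      unfolding L_def by (auto intro!: nth_equalityI)
    also have "\<dots> \<in> sets M" by measurable
    finally show "L -` {r} \<inter> space M \<in> sets M" .
  qed simp
  have "(\<lambda>\<omega> j. x j \<omega>) \<in> M \<rightarrow>\<^sub>M (\<Pi>\<^sub>M j\<in>UNIV. borel)"
    by (rule measurable_PiM_single') auto
  \<comment> \<open>The product sigma-algebra on \<open>nat \<Rightarrow> real\<close> consists of
    the Borel sets of the product topology, to which continuity refers.\<close>
  then have meas_x: "(\<lambda>\<omega> j. x j \<omega>) \<in> M \<rightarrow>\<^sub>M (borel :: (nat \<Rightarrow> real) measure)"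
    by (simp only: measurable_cong_sets[OF refl sets_PiM_equal_borel])
  have N: "N r \<in> M \<rightarrow>\<^sub>M vague_borel" for r
    unfolding vague_borel_def
  proof (rule measurable_measure_of)
    show "{U. openin vague_topology U} \<subseteq> Pow configs"
      using openin_subset by fastforce
    show "N r \<in> space M \<rightarrow> configs"
      unfolding N_def by (auto intro!: sum_replicate_in_configs)
    show "N r -` U \<inter> space M \<in> sets M" if "U \<in> {U. openin vague_topology U}" for U
    proof -
      let ?c = "\<lambda>x :: nat \<Rightarrow> real. \<Sum>j<length r. replicate_mset (r ! j) (clamp (x j))"
      have "openin euclidean {x \<in> topspace euclidean. ?c x \<in> U}"
        using openin_continuous_map_preimage[OF continuous_map_sum_replicate] that by blast
      then have "?c -` U \<in> sets borel" by (auto simp: vimage_def)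
      from measurable_sets[OF meas_x this] show ?thesis
        by (simp add: vimage_def N_def)
    qed
  qed
  have "(\<lambda>\<omega>. N (L \<omega>) \<omega>) \<in> M \<rightarrow>\<^sub>M vague_borel"
    by (rule measurable_compose_countable[OF N L])
  moreover have "N (L \<omega>) \<omega> = (\<Sum>j<K \<omega>. replicate_mset (m j \<omega>) (x j \<omega>))" if "\<omega> \<in> space M" for \<omega>
    using x01[OF that] by (simp add: N_def L_def)
  ultimately show ?thesis by (simp cong: measurable_cong)
qed

lemma config_eq_sum:
  obtains x where "c = (\<Sum>j<size c. {#x j#})" "\<And>j. j < size c \<Longrightarrow> x j \<in># c"
proof -
  obtain xs where xs: "c = mset xs" by (metis ex_mset)
  have "mset xs = (\<Sum>j<length xs. {#xs ! j#})"
  proof (induction xs rule: rev_induct)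
    case (snoc y ys)
    have "(\<Sum>j<length ys. {#(ys @ [y]) ! j#}) = (\<Sum>j<length ys. {#ys ! j#})"
      by (intro sum.cong) (simp_all add: nth_append)
    then show ?case by (simp add: snoc[symmetric])
  qed simp
  moreover have "xs ! j \<in># c" if "j < size c" for j using that nth_mem unfolding xs by simp
  ultimately show ?thesis by (intro that[of "\<lambda>j. xs ! j"]) (simp_all add: xs)
qed

text \<open>Pulled back to tuples, \<open>F\<close> lives on a compact cube and is uniformly
  continuous there. The modulus \<open>d\<close> depends on the number of points \<open>k\<close>,
  so this number has to be bounded before a mesh is chosen.\<close>

lemma continuous_map_uniformly_near:
  fixes F :: "real multiset \<Rightarrow> real"
  assumes F: "continuous_map vague_topology euclideanreal F" and "e > 0"
  obtains d where "d > 0"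
    "\<And>c g. c \<in> configs \<Longrightarrow> size c = k \<Longrightarrow> (\<And>t. t \<in> {0..1} \<Longrightarrow> g t \<in> {0..1} \<and> \<bar>g t - t\<bar> < d) \<Longrightarrow>
       \<bar>F (image_mset g c) - F c\<bar> < e"
proof -
  define S :: "(nat \<Rightarrow> real) set" where "S = PiE UNIV (\<lambda>_. {0..1})"
  define G where "G x = F (\<Sum>j<k. replicate_mset 1 (clamp (x j)))" for x :: "nat \<Rightarrow> real"
  have "continuous_map euclidean euclideanreal (F \<circ> (\<lambda>x. \<Sum>j<k. replicate_mset 1 (clamp (x j))))"
    by (rule continuous_map_compose[OF continuous_map_sum_replicate[where k = k and r = "\<lambda>_. 1"] F])
  then have "continuous_on S G"
    using continuous_on_subset[of UNIV] unfolding G_def comp_def by auto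
  moreover have "compact S" unfolding S_def
    using compactin_PiE[of "\<lambda>_::nat. euclideanreal" UNIV "\<lambda>_. {0..1}"]
    by (simp add: euclidean_product_topology)
  ultimately have "uniformly_continuous_on S G" by (rule compact_uniformly_continuous)
  then obtain d where d: "d > 0" "\<And>x y. x \<in> S \<Longrightarrow> y \<in> S \<Longrightarrow> dist y x < d \<Longrightarrow> dist (G y) (G x) < e"
    using \<open>e > 0\<close> unfolding uniformly_continuous_on_def by metis
  \<comment> \<open>The metric on \<open>nat \<Rightarrow> real\<close> is a series with weights
    \<open>(1/2)^n\<close>, whose total weight 2 gives the factor; displacements below
    \<open>d / 3\<close> then lead to a distance of at most \<open>2 * (d / 3) < d\<close>.\<close>
  have dist_le: "dist x y \<le> 2 * r" if "\<And>j. dist (x j) (y j) \<le> r" "r \<ge> 0" for x y :: "nat \<Rightarrow> real" and r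
  proof -
    have r: "(\<lambda>n. (1/2::real)^n * r) sums (2 * r)"
      using sums_mult2[OF geometric_sums[of "1/2::real"], of r] by simp
    have le: "(1/2)^n * min (dist (x (from_nat n)) (y (from_nat n))) 1 \<le> (1/2::real)^n * r" for n
      using that by (intro mult_left_mono) (auto intro: min.coboundedI1)
    have "summable (\<lambda>n. (1/2)^n * min (dist (x (from_nat n)) (y (from_nat n))) 1)"
    proof (rule summable_comparison_test'[OF sums_summable[OF r], of 0])
      show "norm ((1/2)^n * min (dist (x (from_nat n)) (y (from_nat n))) 1) \<le> (1/2)^n * r" for n
        using le[of n] by (subst real_norm_def, subst abs_of_nonneg) (auto simp del: power_one_over)
    qed
    then have "(\<Sum>n. (1/2)^n * min (dist (x (from_nat n)) (y (from_nat n))) 1) \<le> 2 * r"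
      using suminf_le[OF le _ sums_summable[OF r]] sums_unique[OF r] by simp
    then have "dist x y \<le> 2 * r" by (simp only: dist_fun_def)
    then show ?thesis .
  qed
  show ?thesis
  proof (rule that[of "d / 3"])
    show "d / 3 > 0" using d by simp
    fix c :: "real multiset" and g assume c: "c \<in> configs" "size c = k"
      and g: "\<And>t. t \<in> {0..1} \<Longrightarrow> g t \<in> {0..1} \<and> \<bar>g t - t\<bar> < d / 3"
    obtain x where x: "c = (\<Sum>j<k. {#x j#})" "\<And>j. j < k \<Longrightarrow> x j \<in># c"
      using config_eq_sum[of c] c(2) by metis
    have x01: "x j \<in> {0..1}" if "j < k" for j using x(2)[OF that] c by (auto simp: configs_def)
    \<comment> \<open>Coordinates from \<open>k\<close> on are set to 0 in both tuples: they stay in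
      the cube and contribute nothing to the distance.\<close>
    define x' where "x' j = (if j < k then x j else 0)" for j
    define y' where "y' j = (if j < k then g (x j) else 0)" for j
    have "x' \<in> S" "y' \<in> S" using x01 g by (auto simp: S_def x'_def y'_def)
    moreover have "dist y' x' \<le> 2 * (d / 3)"
      using g[OF x01] d(1) by (intro dist_le) (auto simp: x'_def y'_def dist_real_def less_imp_le)
    then have "dist y' x' < d" using d(1) by simp
    ultimately have "dist (G y') (G x') < e" using d(2) by blast
    moreover have "G x' = F c"
      unfolding G_def by (subst x(1)) (auto intro!: arg_cong[where f=F] sum.cong simp: x'_def clamp_eq[OF x01])
    moreover have "image_mset g c = (\<Sum>j<k. {#g (x j)#})"
    proof -
      have "image_mset g (\<Sum>j<l. {#x j#}) = (\<Sum>j<l. {#g (x j)#})" for l by (induction l) auto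
      then show ?thesis by (simp add: x(1))
    qed
    then have "G y' = F (image_mset g c)"
      unfolding G_def by (auto intro!: arg_cong[where f=F] sum.cong simp: y'_def clamp_eq[OF conjunct1[OF g[OF x01]]])
    ultimately show "\<bar>F (image_mset g c) - F c\<bar> < e" by (simp add: dist_real_def)
  qed
qed

section \<open>Reduction to the counts in the cells of a grid\<close>

definition grid_point :: "nat \<Rightarrow> real \<Rightarrow> nat" where
  "grid_point m t = nat \<lfloor>real m * t\<rfloor>"

text \<open>Indices run up to \<open>m\<close> inclusive: for \<open>m > 0\<close>, cell
  \<open>m\<close> contains only the point 1 of the unit interval. This extra cell is shown to be
  negligible for the limit process and for the time averages alike.\<close>

definition grid_count :: "nat \<Rightarrow> real multiset \<Rightarrow> nat \<Rightarrow> nat" where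
  "grid_count m c l = size {#t \<in># c. grid_point m t = l#}"

lemma grid_point_le: "t \<in> {0..1} \<Longrightarrow> grid_point m t \<le> m"
  unfolding grid_point_def by (simp add: floor_le_iff nat_le_iff mult_left_le)
    (smt (verit, best) mult_left_le of_nat_0_le_iff)

lemma grid_point_near:
  assumes "t \<in> {0..1}" "m > 0"
  shows "real (grid_point m t) / real m \<in> {0..1}" "\<bar>real (grid_point m t) / real m - t\<bar> \<le> 1 / real m"
proof -
  have eq: "real (grid_point m t) = of_int \<lfloor>real m * t\<rfloor>"
    using assms by (simp add: grid_point_def)
  have "real (grid_point m t) \<le> real m * t" "real m * t \<le> real (grid_point m t) + 1"
    unfolding eq by linarith+
  then have "real (grid_point m t) / real m \<le> t" "t \<le> (real (grid_point m t) + 1) / real m"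
    using assms(2) by (simp_all add: pos_divide_le_eq pos_le_divide_eq mult.commute)
  then show "\<bar>real (grid_point m t) / real m - t\<bar> \<le> 1 / real m"
    by (simp add: add_divide_distrib abs_le_iff)
  show "real (grid_point m t) / real m \<in> {0..1}"
    using grid_point_le[OF assms(1), of m] assms(2) by simp
qed

lemma size_eq_sum_grid_count:
  assumes "c \<in> configs"
  shows "size c = (\<Sum>l\<le>m. grid_count m c l)"
proof -
  have "set_mset c \<subseteq> {0..1}" using assms by (simp add: configs_def)
  then show ?thesis
  proof (induction c)
    case (add t c)
    then have "grid_point m t \<le> m" using grid_point_le by simp
    have "grid_count m (add_mset t c) l = (if grid_point m t = l then 1 else 0) + grid_count m c l" for l
      by (simp add: grid_count_def)
    then show ?case using add \<open>grid_point m t \<le> m\<close> by (simp add: sum.distrib)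
  qed (simp add: grid_count_def)
qed

text \<open>A configuration moved to grid points is determined by its cell counts; in this way a
  general test function becomes a function of finitely many integers.\<close>

lemma image_grid_point:
  assumes "c \<in> configs"
  shows "image_mset (\<lambda>t. f (grid_point m t)) c = (\<Sum>l\<le>m. replicate_mset (grid_count m c l) (f l))"
proof -
  have "set_mset c \<subseteq> {0..1}" using assms by (simp add: configs_def)
  then show ?thesis
  proof (induction c)
    case (add t c)
    then have "grid_point m t \<le> m" using grid_point_le by simp
    have "replicate_mset (grid_count m (add_mset t c) l) (f l) =
        (if grid_point m t = l then {#f l#} else {#}) + replicate_mset (grid_count m c l) (f l)" for l
      by (simp add: grid_count_def)
    then show ?case using add \<open>grid_point m t \<le> m\<close> by (simp add: sum.distrib)
  qed (simp add: grid_count_def)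
qed

definition grid_counts_eq :: "nat \<Rightarrow> (nat \<Rightarrow> nat) \<Rightarrow> real multiset \<Rightarrow> bool" where
  "grid_counts_eq m \<kappa> c \<longleftrightarrow> (\<forall>l\<in>{..m}. grid_count m c l = \<kappa> l)"

text \<open>Truncation at total size \<open>k\<close> leaves a finite set \<open>A\<close> of count
  vectors, so a function of the counts becomes a finite linear combination of indicators of events
  whose probabilities converge.\<close>

lemma sum_indicator_grid_counts:
  fixes H :: "(nat \<Rightarrow> nat) \<Rightarrow> real" and m k :: nat
  assumes "c \<in> configs"
  defines "A \<equiv> {\<kappa> \<in> PiE {..m} (\<lambda>_. {..k}). (\<Sum>l\<le>m. \<kappa> l) \<le> k}"
  shows "(\<Sum>\<kappa>\<in>A. H \<kappa> * of_bool (grid_counts_eq m \<kappa> c)) =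
    (if size c \<le> k then H (restrict (grid_count m c) {..m}) else 0)"
proof -
  let ?\<kappa> = "restrict (grid_count m c) {..m}"
  have sz: "size c = (\<Sum>l\<le>m. grid_count m c l)" using assms by (intro size_eq_sum_grid_count)
  have eq: "\<kappa> \<in> A \<and> grid_counts_eq m \<kappa> c \<longleftrightarrow> size c \<le> k \<and> \<kappa> = ?\<kappa>" for \<kappa>
  proof
    assume *: "\<kappa> \<in> A \<and> grid_counts_eq m \<kappa> c"
    then have "\<kappa> = ?\<kappa>"
      unfolding A_def grid_counts_eq_def by (intro ext) (auto simp: PiE_def extensional_def)
    moreover have "(\<Sum>l\<le>m. \<kappa> l) = size c"
      using * unfolding sz grid_counts_eq_def by (intro sum.cong) auto
    ultimately show "size c \<le> k \<and> \<kappa> = ?\<kappa>" using * by (auto simp: A_def)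
  next
    assume *: "size c \<le> k \<and> \<kappa> = ?\<kappa>"
    have "grid_count m c l \<le> k" if "l \<le> m" for l
    proof -
      have "grid_count m c l \<le> (\<Sum>l\<le>m. grid_count m c l)"
        using that by (intro member_le_sum) auto
      then show ?thesis using * sz by simp
    qed
    then show "\<kappa> \<in> A \<and> grid_counts_eq m \<kappa> c"
      using * sz by (auto simp: A_def grid_counts_eq_def)
  qed
  have "finite A" unfolding A_def by (rule finite_subset[OF _ finite_PiE[of "{..m}" "\<lambda>_. {..k}"]]) auto
  then have "(\<Sum>\<kappa>\<in>A. H \<kappa> * of_bool (grid_counts_eq m \<kappa> c)) =
      (\<Sum>\<kappa>\<in>{\<kappa> \<in> A. grid_counts_eq m \<kappa> c}. H \<kappa>)"
    by (intro sum.mono_neutral_cong_right) auto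
  also have "{\<kappa> \<in> A. grid_counts_eq m \<kappa> c} = (if size c \<le> k then {?\<kappa>} else {})"
    using eq by (simp add: set_eq_iff)
  finally show ?thesis by (cases "size c \<le> k") (simp_all only: if_True if_False sum.insert sum.empty finite.emptyI empty_iff not_False_eq_True add_0_right)
qed

lemma measurable_grid_counts_eq:
  assumes "\<And>m l. (\<lambda>\<omega>. grid_count m (N \<omega>) l) \<in> P \<rightarrow>\<^sub>M count_space UNIV"
  shows "{\<omega> \<in> space P. grid_counts_eq m \<kappa> (N \<omega>)} \<in> sets P"
proof -
  note assms[measurable]
  show ?thesis unfolding grid_counts_eq_def by measurable
qed

text \<open>Configurations with at most \<open>k\<close> points cost \<open>e\<close> for the move
  to the grid; on the others the sum vanishes and \<open>F\<close> is bounded by \<open>C\<close>.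
  The process is arbitrary so that the estimate covers \<open>\<Phi> n\<close> and the
  limit.\<close>

lemma expectation_grid_approximation:
  fixes F :: "real multiset \<Rightarrow> real" and m k :: nat
  assumes P: "point_process P N"
    and N: "\<And>m l. (\<lambda>\<omega>. grid_count m (N \<omega>) l) \<in> P \<rightarrow>\<^sub>M count_space UNIV"
    and F: "continuous_map vague_topology euclideanreal F"
    and bound: "\<And>c. c \<in> configs \<Longrightarrow> \<bar>F c\<bar> \<le> C"
    and near: "\<And>c. c \<in> configs \<Longrightarrow> size c \<le> k \<Longrightarrow>
      \<bar>F (image_mset (\<lambda>t. real (grid_point m t) / real m) c) - F c\<bar> \<le> e"
    and "e \<ge> 0"
  defines "A \<equiv> {\<kappa> \<in> PiE {..m} (\<lambda>_. {..k}). (\<Sum>l\<le>m. \<kappa> l) \<le> k}"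
  defines "p \<equiv> \<lambda>\<kappa>. \<P>(\<omega> in P. grid_counts_eq m \<kappa> (N \<omega>))"
  shows "\<bar>(\<integral>\<omega>. F (N \<omega>) \<partial>P) - (\<Sum>\<kappa>\<in>A. F (\<Sum>l\<le>m. replicate_mset (\<kappa> l) (real l / real m)) * p \<kappa>)\<bar>
      \<le> e + C * (1 - (\<Sum>\<kappa>\<in>A. p \<kappa>))" (is "?L \<le> ?R")
    and "(\<Sum>\<kappa>\<in>A. p \<kappa>) = \<P>(\<omega> in P. size (N \<omega>) \<le> k)"
proof -
  interpret prob_space P using P by (simp add: point_process_def)
  have N_meas [measurable]: "N \<in> P \<rightarrow>\<^sub>M vague_borel" using P by (simp add: point_process_def)
  have conf: "\<omega> \<in> space P \<Longrightarrow> N \<omega> \<in> configs" for \<omega>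
    using measurable_space[OF N_meas] by simp
  have [measurable]: "F \<in> vague_borel \<rightarrow>\<^sub>M borel" by (rule measurable_vague_borel_of_continuous_map[OF F])
  have FN: "integrable P (\<lambda>\<omega>. F (N \<omega>))"
    using bound conf by (intro integrable_const_bound[of _ C]) auto
  let ?H = "\<lambda>\<kappa>. F (\<Sum>l\<le>m. replicate_mset (\<kappa> l) (real l / real m))"
  let ?I = "\<lambda>\<kappa> \<omega>. of_bool (grid_counts_eq m \<kappa> (N \<omega>)) :: real"
  have I: "integrable P (?I \<kappa>)" "(\<integral>\<omega>. ?I \<kappa> \<omega> \<partial>P) = p \<kappa>" for \<kappa>
  proof -
    let ?E = "{\<omega> \<in> space P. grid_counts_eq m \<kappa> (N \<omega>)}"
    have E: "?E \<in> sets P" by (rule measurable_grid_counts_eq[OF N])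
    have eq: "?I \<kappa> \<omega> = indicator ?E \<omega>" if "\<omega> \<in> space P" for \<omega> using that by simp
    show "integrable P (?I \<kappa>)"
      using E by (subst Bochner_Integration.integrable_cong[OF refl eq])
        (auto intro!: integrable_real_indicator simp: emeasure_eq_measure)
    have "(\<integral>\<omega>. ?I \<kappa> \<omega> \<partial>P) = (\<integral>\<omega>. indicator ?E \<omega> \<partial>P)"
      by (rule Bochner_Integration.integral_cong[OF refl eq])
    then show "(\<integral>\<omega>. ?I \<kappa> \<omega> \<partial>P) = p \<kappa>" using E by (simp add: p_def)
  qed
  have sum: "(\<Sum>\<kappa>\<in>A. H \<kappa> * ?I \<kappa> \<omega>) = (if size (N \<omega>) \<le> k then H (restrict (grid_count m (N \<omega>)) {..m}) else 0)"
    if "\<omega> \<in> space P" for \<omega> and H :: "(nat \<Rightarrow> nat) \<Rightarrow> real"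
    unfolding A_def by (rule sum_indicator_grid_counts[OF conf[OF that]])
  have sum1: "(\<Sum>\<kappa>\<in>A. ?I \<kappa> \<omega>) = of_bool (size (N \<omega>) \<le> k)" if "\<omega> \<in> space P" for \<omega>
    using sum[OF that, of "\<lambda>_. 1"] by simp
  have sz: "{\<omega> \<in> space P. size (N \<omega>) \<le> k} \<in> sets P"
  proof -
    note N[measurable]
    have "{\<omega> \<in> space P. size (N \<omega>) \<le> k} = {\<omega> \<in> space P. (\<Sum>l\<le>m. grid_count m (N \<omega>) l) \<le> k}"
      using size_eq_sum_grid_count[OF conf, of _ m] by auto
    also have "\<dots> \<in> sets P" by measurable
    finally show ?thesis .
  qed
  have "(\<Sum>\<kappa>\<in>A. p \<kappa>) = (\<integral>\<omega>. (\<Sum>\<kappa>\<in>A. ?I \<kappa> \<omega>) \<partial>P)"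
    using I by (simp add: Bochner_Integration.integral_sum)
  also have "\<dots> = (\<integral>\<omega>. indicator {\<omega> \<in> space P. size (N \<omega>) \<le> k} \<omega> \<partial>P)"
    using sum1 by (intro Bochner_Integration.integral_cong) auto
  finally show "(\<Sum>\<kappa>\<in>A. p \<kappa>) = \<P>(\<omega> in P. size (N \<omega>) \<le> k)" using sz by simp
  have "(\<integral>\<omega>. F (N \<omega>) \<partial>P) - (\<Sum>\<kappa>\<in>A. ?H \<kappa> * p \<kappa>) = (\<integral>\<omega>. F (N \<omega>) - (\<Sum>\<kappa>\<in>A. ?H \<kappa> * ?I \<kappa> \<omega>) \<partial>P)"
    using I FN by (simp add: Bochner_Integration.integral_sum Bochner_Integration.integral_diff)
  also have "\<bar>\<dots>\<bar> \<le> (\<integral>\<omega>. \<bar>F (N \<omega>) - (\<Sum>\<kappa>\<in>A. ?H \<kappa> * ?I \<kappa> \<omega>)\<bar> \<partial>P)"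
    by (rule integral_abs_bound)
  also have "\<dots> \<le> (\<integral>\<omega>. e + C * (1 - (\<Sum>\<kappa>\<in>A. ?I \<kappa> \<omega>)) \<partial>P)"
  proof (intro integral_mono)
    fix \<omega> assume \<omega>: "\<omega> \<in> space P"
    show "\<bar>F (N \<omega>) - (\<Sum>\<kappa>\<in>A. ?H \<kappa> * ?I \<kappa> \<omega>)\<bar> \<le> e + C * (1 - (\<Sum>\<kappa>\<in>A. ?I \<kappa> \<omega>))"
    proof (cases "size (N \<omega>) \<le> k")
      case True
      have "?H (restrict (grid_count m (N \<omega>)) {..m}) = F (image_mset (\<lambda>t. real (grid_point m t) / real m) (N \<omega>))"
        unfolding image_grid_point[OF conf[OF \<omega>], of "\<lambda>l. real l / real m"]
        by (intro arg_cong[where f=F] sum.cong) auto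
      then have "\<bar>F (N \<omega>) - ?H (restrict (grid_count m (N \<omega>)) {..m})\<bar> \<le> e"
        using near[OF conf[OF \<omega>] True] by (simp add: abs_minus_commute)
      then show ?thesis unfolding sum[OF \<omega>] sum1[OF \<omega>] using True by simp
    next
      case False
      then show ?thesis unfolding sum[OF \<omega>] sum1[OF \<omega>] using bound[OF conf[OF \<omega>]] \<open>e \<ge> 0\<close> by simp
    qed
  qed (use FN I in auto)
  also have "\<dots> = ?R" using I by (simp add: prob_space)
  finally show "?L \<le> ?R" .
qed

text \<open>Tightness comes from the limit: \<open>k\<close> is chosen such that
  \<open>\<Psi>\<close> rarely has more than \<open>k\<close> points, and convergence of the
  finitely many probabilities over \<open>A\<close> passes this on to \<open>\<Phi> n\<close> for
  large \<open>n\<close>. The mesh is chosen after \<open>k\<close>, since the modulus of continuity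
  depends on \<open>k\<close>.\<close>

lemma converges_in_distribution_of_grid_counts:
  assumes M: "\<And>n. point_process M (\<Phi> n)" and Q: "point_process Q \<Psi>"
    and \<Phi>: "\<And>n m l. (\<lambda>\<omega>. grid_count m (\<Phi> n \<omega>) l) \<in> M \<rightarrow>\<^sub>M count_space UNIV"
    and \<Psi>: "\<And>m l. (\<lambda>\<omega>. grid_count m (\<Psi> \<omega>) l) \<in> Q \<rightarrow>\<^sub>M count_space UNIV"
    and conv: "\<And>m \<kappa>. m > 0 \<Longrightarrow> (\<lambda>n. \<P>(\<omega> in M. grid_counts_eq m \<kappa> (\<Phi> n \<omega>))) \<longlonglongrightarrow>
       \<P>(\<omega> in Q. grid_counts_eq m \<kappa> (\<Psi> \<omega>))"
  shows "converges_in_distribution M \<Phi> Q \<Psi>"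
  unfolding converges_in_distribution_def
proof (intro conjI allI impI M Q)
  fix F :: "real multiset \<Rightarrow> real"
  assume *: "continuous_map vague_topology euclideanreal F \<and> bounded (F ` configs)"
  then have F: "continuous_map vague_topology euclideanreal F" by simp
  from * obtain C0 where C0: "\<And>c. c \<in> configs \<Longrightarrow> \<bar>F c\<bar> \<le> C0"
    unfolding bounded_iff by auto
  define C where "C = max 1 C0"
  have C: "C > 0" "\<And>c. c \<in> configs \<Longrightarrow> \<bar>F c\<bar> \<le> C" using C0 unfolding C_def by force+
  interpret Q: prob_space Q using Q by (simp add: point_process_def)
  have conf: "\<omega> \<in> space Q \<Longrightarrow> \<Psi> \<omega> \<in> configs" for \<omega>
    using measurable_space[of \<Psi> Q vague_borel] Q by (simp add: point_process_def)
  have "(\<lambda>k. \<P>(\<omega> in Q. size (\<Psi> \<omega>) \<le> k)) \<longlonglongrightarrow> measure Q (\<Union>k. {\<omega> \<in> space Q. size (\<Psi> \<omega>) \<le> k})"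
  proof (rule Q.finite_Lim_measure_incseq)
    note \<Psi>[measurable]
    have "{\<omega> \<in> space Q. size (\<Psi> \<omega>) \<le> k} = {\<omega> \<in> space Q. (\<Sum>l\<le>1. grid_count 1 (\<Psi> \<omega>) l) \<le> k}" for k
      using size_eq_sum_grid_count[OF conf, of _ 1] by auto
    also have "\<dots> k \<in> sets Q" for k by measurable
    finally show "range (\<lambda>k. {\<omega> \<in> space Q. size (\<Psi> \<omega>) \<le> k}) \<subseteq> sets Q" by blast
    show "incseq (\<lambda>k. {\<omega> \<in> space Q. size (\<Psi> \<omega>) \<le> k})" by (auto simp: incseq_def)
  qed
  also have "(\<Union>k. {\<omega> \<in> space Q. size (\<Psi> \<omega>) \<le> k}) = space Q" by auto
  finally have tight: "(\<lambda>k. \<P>(\<omega> in Q. size (\<Psi> \<omega>) \<le> k)) \<longlonglongrightarrow> 1" by (simp add: Q.prob_space)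
  show "(\<lambda>n. \<integral>\<omega>. F (\<Phi> n \<omega>) \<partial>M) \<longlonglongrightarrow> (\<integral>\<omega>. F (\<Psi> \<omega>) \<partial>Q)"
    unfolding tendsto_iff
  proof (intro allI impI)
    fix e :: real assume "e > 0"
    \<comment> \<open>The two grid approximations cost at most \<open>2 * e'\<close> each and the
      comparison of the sums less than \<open>e'\<close>, in total less than
      \<open>5 * e' < e\<close>.\<close>
    define e' where "e' = e / 8"
    have e': "e' > 0" using \<open>e > 0\<close> by (simp add: e'_def)
    have "eventually (\<lambda>k. \<P>(\<omega> in Q. size (\<Psi> \<omega>) \<le> k) > 1 - e' / C) sequentially"
      using tight e' C by (intro order_tendstoD(1)) auto
    then obtain k where k: "\<P>(\<omega> in Q. size (\<Psi> \<omega>) \<le> k) > 1 - e' / C"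
      using eventually_happens'[OF sequentially_bot] by blast
    have "\<exists>d>0. \<forall>c g. c \<in> configs \<longrightarrow> size c = i \<longrightarrow> (\<forall>t\<in>{0..1}. g t \<in> {0..1} \<and> \<bar>g t - t\<bar> < d) \<longrightarrow>
       \<bar>F (image_mset g c) - F c\<bar> < e'" for i
      using continuous_map_uniformly_near[OF F e', of i] by metis
    then obtain d where d: "\<And>i. d i > 0" "\<And>i c g. c \<in> configs \<Longrightarrow> size c = i \<Longrightarrow>
        (\<forall>t\<in>{0..1}. g t \<in> {0..1} \<and> \<bar>g t - t\<bar> < d i) \<Longrightarrow> \<bar>F (image_mset g c) - F c\<bar> < e'"
      by metis
    define d0 where "d0 = Min (d ` {..k})"
    have d0: "d0 > 0" "\<And>i. i \<le> k \<Longrightarrow> d0 \<le> d i" using d(1) by (auto simp: d0_def)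
    obtain m where m: "m > 0" "1 / real m < d0"
      using reals_Archimedean[OF d0(1)] by (metis inverse_eq_divide zero_less_Suc)
    have near: "\<bar>F (image_mset (\<lambda>t. real (grid_point m t) / real m) c) - F c\<bar> \<le> e'"
      if "c \<in> configs" "size c \<le> k" for c
    proof (rule less_imp_le, rule d(2)[OF that(1) refl], intro ballI conjI)
      fix t :: real assume t: "t \<in> {0..1}"
      show "real (grid_point m t) / real m \<in> {0..1}" by (rule grid_point_near[OF t m(1)])
      show "\<bar>real (grid_point m t) / real m - t\<bar> < d (size c)"
        using grid_point_near(2)[OF t m(1)] m(2) d0(2)[OF that(2)] by linarith
    qed
    define A where "A = {\<kappa> \<in> PiE {..m} (\<lambda>_. {..k}). (\<Sum>l\<le>m. \<kappa> l) \<le> k}"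
    define H where "H \<kappa> = F (\<Sum>l\<le>m. replicate_mset (\<kappa> l) (real l / real m))" for \<kappa>
    define p where "p n \<kappa> = \<P>(\<omega> in M. grid_counts_eq m \<kappa> (\<Phi> n \<omega>))" for n \<kappa>
    define q where "q \<kappa> = \<P>(\<omega> in Q. grid_counts_eq m \<kappa> (\<Psi> \<omega>))" for \<kappa>
    have 1: "\<bar>(\<integral>\<omega>. F (\<Phi> n \<omega>) \<partial>M) - (\<Sum>\<kappa>\<in>A. H \<kappa> * p n \<kappa>)\<bar> \<le> e' + C * (1 - (\<Sum>\<kappa>\<in>A. p n \<kappa>))" for n
      unfolding A_def H_def p_def
      by (rule expectation_grid_approximation(1)[OF M \<Phi> F C(2) near]) (use e' in auto)
    have 2: "\<bar>(\<integral>\<omega>. F (\<Psi> \<omega>) \<partial>Q) - (\<Sum>\<kappa>\<in>A. H \<kappa> * q \<kappa>)\<bar> \<le> e' + C * (1 - (\<Sum>\<kappa>\<in>A. q \<kappa>))"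
      unfolding A_def H_def q_def
      by (rule expectation_grid_approximation(1)[OF Q \<Psi> F C(2) near]) (use e' in auto)
    have "(\<Sum>\<kappa>\<in>A. q \<kappa>) = \<P>(\<omega> in Q. size (\<Psi> \<omega>) \<le> k)"
      unfolding A_def q_def
      by (rule expectation_grid_approximation(2)[OF Q \<Psi> F C(2) near]) (use e' in auto)
    then have q: "(\<Sum>\<kappa>\<in>A. q \<kappa>) > 1 - e' / C" using k by simp
    have pq: "(\<lambda>n. p n \<kappa>) \<longlonglongrightarrow> q \<kappa>" for \<kappa> unfolding p_def q_def by (rule conv[OF m(1)])
    have "(\<lambda>n. \<Sum>\<kappa>\<in>A. p n \<kappa>) \<longlonglongrightarrow> (\<Sum>\<kappa>\<in>A. q \<kappa>)" by (intro tendsto_sum pq)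
    then have "eventually (\<lambda>n. (\<Sum>\<kappa>\<in>A. p n \<kappa>) > 1 - e' / C) sequentially"
      using q by (rule order_tendstoD(1))
    moreover have "(\<lambda>n. \<Sum>\<kappa>\<in>A. H \<kappa> * p n \<kappa>) \<longlonglongrightarrow> (\<Sum>\<kappa>\<in>A. H \<kappa> * q \<kappa>)" by (intro tendsto_intros pq)
    then have "eventually (\<lambda>n. dist (\<Sum>\<kappa>\<in>A. H \<kappa> * p n \<kappa>) (\<Sum>\<kappa>\<in>A. H \<kappa> * q \<kappa>) < e') sequentially"
      using e' by (simp add: tendsto_iff)
    ultimately show "eventually (\<lambda>n. dist (\<integral>\<omega>. F (\<Phi> n \<omega>) \<partial>M) (\<integral>\<omega>. F (\<Psi> \<omega>) \<partial>Q) < e) sequentially"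
    proof eventually_elim
      case (elim n)
      have small: "C * (1 - s) \<le> e'" if "s > 1 - e' / C" for s
      proof -
        have "C * (1 - s) \<le> C * (e' / C)" using that C(1) by (intro mult_left_mono) auto
        then show ?thesis using C(1) by simp
      qed
      show ?case
        using 1[of n] 2 small[OF q] small[OF elim(1)] elim(2) e' unfolding dist_real_def e'_def by linarith
    qed
  qed
qed

section \<open>Convergence of probability generating functions\<close>

lemma LIMSEQ_approx:
  fixes a :: "nat \<Rightarrow> real"
  assumes "\<And>e. e > 0 \<Longrightarrow> \<exists>b b'. b \<longlonglongrightarrow> b' \<and> (\<forall>n. \<bar>a n - b n\<bar> \<le> e) \<and> \<bar>a' - b'\<bar> \<le> e"
  shows "a \<longlonglongrightarrow> a'"
  unfolding tendsto_iff
proof (intro allI impI)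
  fix e :: real assume "e > 0"
  then obtain b b' where b: "b \<longlonglongrightarrow> b'" "\<And>n. \<bar>a n - b n\<bar> \<le> e / 3" "\<bar>a' - b'\<bar> \<le> e / 3"
    using assms[of "e / 3"] by auto
  have "eventually (\<lambda>n. dist (b n) b' < e / 3) sequentially"
    using b(1) \<open>e > 0\<close> unfolding tendsto_iff by (metis divide_pos_pos zero_less_numeral)
  then show "eventually (\<lambda>n. dist (a n) a' < e) sequentially"
  proof eventually_elim
    case (elim n)
    then show ?case using b(2)[of n] b(3) unfolding dist_real_def by linarith
  qed
qed

text \<open>The map \<open>k \<mapsto> (1/2)^k\<close> embeds the naturals in the unit interval as
  isolated points, so the indicator of \<open>k0\<close> extends to a continuous function and
  Weierstrass applies. The monomial \<open>x ^ r\<close> at \<open>x = (1/2)^k\<close> is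
  \<open>z ^ k\<close> with \<open>z = (1/2)^r\<close>, hence a term of a generating
  function.\<close>

lemma of_bool_eq_polynomial_approx:
  fixes e :: real
  assumes "e > 0"
  obtains a :: "nat \<Rightarrow> real" and d :: nat
  where "\<And>k. \<bar>of_bool (k = k0) - (\<Sum>r\<le>d. a r * ((1/2)^r)^k)\<bar> \<le> e"
proof -
  \<comment> \<open>A tent centered at \<open>(1/2)^k0\<close>: every other power is at distance at
    least \<open>(1/2)^(k0+1)\<close>, where the slope \<open>2^(k0+2)\<close> has brought it down
    to \<open>1 - 2 < 0\<close>.\<close>
  define f where "f x = max 0 (1 - 2^(k0+2) * \<bar>x - (1/2)^k0\<bar>)" for x :: real
  have f: "f ((1/2)^k) = of_bool (k = k0)" for k :: nat
  proof (cases "k = k0")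
    case False
    have "(1/2)^(k0+1) \<le> \<bar>(1/2)^k - (1/2::real)^k0\<bar>"
    proof (cases "k < k0")
      case True
      then have "(1/2)^k \<ge> (1/2::real)^(k0 - 1)" by (intro power_decreasing) auto
      moreover have "(1/2::real)^(k0-1) = 2 * (1/2)^k0" using True by (cases k0) auto
      moreover have "(1/2::real)^k0 > 0" by simp
      moreover have "(1/2::real)^(k0+1) = (1/2)^k0 / 2" by simp
      ultimately show ?thesis by linarith
    next
      case False
      with \<open>k \<noteq> k0\<close> have "(1/2)^k \<le> (1/2::real)^(k0 + 1)" by (intro power_decreasing) auto
      moreover have "(1/2::real)^(k0+1) = (1/2)^k0 / 2" by simp
      ultimately show ?thesis by linarith
    qed
    then have "2^(k0+2) * (1/2)^(k0+1) \<le> 2^(k0+2) * \<bar>(1/2)^k - (1/2::real)^k0\<bar>"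
      by (intro mult_left_mono) auto
    moreover have "2^(k0+2) * (1/2::real)^(k0+1) = 2" by (simp add: power_one_over)
    ultimately have "1 - 2^(k0+2) * \<bar>(1/2)^k - (1/2::real)^k0\<bar> \<le> 0" by linarith
    then show ?thesis using False unfolding f_def by (simp only: max_absorb1 of_bool_eq)
  qed (simp add: f_def)
  have "continuous_on {0..1} f" unfolding f_def by (intro continuous_intros)
  then obtain g where g: "real_polynomial_function g" "\<And>x. x \<in> {0..1} \<Longrightarrow> \<bar>f x - g x\<bar> < e"
    using Stone_Weierstrass_real_polynomial_function[of "{0..1::real}" f e] assms by auto
  then obtain a d where gs: "g = (\<lambda>x. \<Sum>r\<le>d. a r * x ^ r)"
    unfolding real_polynomial_function_iff_sum by auto
  show ?thesis
  proof (rule that)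
    fix k :: nat
    have "(1/2::real)^k \<in> {0..1}" by (simp add: power_le_one)
    from g(2)[OF this] show "\<bar>of_bool (k = k0) - (\<Sum>r\<le>d. a r * ((1/2)^r)^k)\<bar> \<le> e"
      by (simp add: f gs power_mult[symmetric] mult.commute)
  qed
qed

lemma expectation_mult_approx:
  fixes f g h :: "'a \<Rightarrow> real"
  assumes "prob_space P" and [measurable]: "f \<in> borel_measurable P" "g \<in> borel_measurable P" "h \<in> borel_measurable P"
    and h: "\<And>\<omega>. \<bar>h \<omega>\<bar> \<le> 1" and f: "\<And>\<omega>. \<bar>f \<omega>\<bar> \<le> 1" and fg: "\<And>\<omega>. \<bar>f \<omega> - g \<omega>\<bar> \<le> e"
  shows "\<bar>(\<integral>\<omega>. f \<omega> * h \<omega> \<partial>P) - (\<integral>\<omega>. g \<omega> * h \<omega> \<partial>P)\<bar> \<le> e"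
proof -
  interpret prob_space P by fact
  have "\<bar>g \<omega>\<bar> \<le> 1 + e" for \<omega> using f[of \<omega>] fg[of \<omega>] by linarith
  then have "\<bar>g \<omega> * h \<omega>\<bar> \<le> 1 + e" for \<omega>
    using mult_mono'[of "\<bar>g \<omega>\<bar>" "1 + e" "\<bar>h \<omega>\<bar>" 1] h[of \<omega>] by (simp add: abs_mult)
  then have [simp]: "integrable P (\<lambda>\<omega>. g \<omega> * h \<omega>)"
    by (intro integrable_const_bound[of _ "1 + e"]) auto
  have [simp]: "integrable P (\<lambda>\<omega>. f \<omega> * h \<omega>)"
    using h f by (intro integrable_const_bound[of _ 1]) (auto simp: abs_mult intro!: mult_le_one)
  have "\<bar>(\<integral>\<omega>. f \<omega> * h \<omega> \<partial>P) - (\<integral>\<omega>. g \<omega> * h \<omega> \<partial>P)\<bar> = \<bar>\<integral>\<omega>. (f \<omega> - g \<omega>) * h \<omega> \<partial>P\<bar>"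
    by (simp add: Bochner_Integration.integral_diff left_diff_distrib)
  also have "\<dots> \<le> (\<integral>\<omega>. \<bar>(f \<omega> - g \<omega>) * h \<omega>\<bar> \<partial>P)" by (rule integral_abs_bound)
  also have "\<dots> \<le> (\<integral>\<omega>. e \<partial>P)"
  proof (rule integral_mono)
    show "integrable P (\<lambda>\<omega>. \<bar>(f \<omega> - g \<omega>) * h \<omega>\<bar>)" by (simp add: left_diff_distrib)
    fix \<omega>
    show "\<bar>(f \<omega> - g \<omega>) * h \<omega>\<bar> \<le> e"
      using mult_mono'[of "\<bar>f \<omega> - g \<omega>\<bar>" e "\<bar>h \<omega>\<bar>" 1] h[of \<omega>] fg[of \<omega>] by (simp add: abs_mult)
  qed simp
  finally show ?thesis by (simp add: prob_space)
qed

lemma abs_prod_le_one: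
  fixes f :: "'i \<Rightarrow> real"
  assumes "\<And>i. i \<in> I \<Longrightarrow> \<bar>f i\<bar> \<le> 1"
  shows "\<bar>\<Prod>i\<in>I. f i\<bar> \<le> 1"
  unfolding abs_prod using assms by (intro prod_le_1) auto

text \<open>Factors \<open>z i ^ N n \<omega> i\<close> are exchanged for indicators one coordinate
  at a time, so polynomial approximation in one variable is enough. That approximation is uniform
  over all naturals, hence no tightness enters.\<close>

lemma pgf_continuity:
  fixes N :: "nat \<Rightarrow> 'a \<Rightarrow> 'i \<Rightarrow> nat" and L :: "'b \<Rightarrow> 'i \<Rightarrow> nat"
  assumes I: "finite I" and M: "prob_space M" and Q: "prob_space Q"
    and N: "\<And>n i. i \<in> I \<Longrightarrow> (\<lambda>\<omega>. N n \<omega> i) \<in> M \<rightarrow>\<^sub>M count_space UNIV"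
    and L: "\<And>i. i \<in> I \<Longrightarrow> (\<lambda>\<omega>. L \<omega> i) \<in> Q \<rightarrow>\<^sub>M count_space UNIV"
    and conv: "\<And>z :: 'i \<Rightarrow> real. (\<And>i. 0 < z i \<and> z i \<le> 1) \<Longrightarrow>
      (\<lambda>n. \<integral>\<omega>. (\<Prod>i\<in>I. z i ^ N n \<omega> i) \<partial>M) \<longlonglongrightarrow> (\<integral>\<omega>. (\<Prod>i\<in>I. z i ^ L \<omega> i) \<partial>Q)"
  shows "(\<lambda>n. \<P>(\<omega> in M. \<forall>i\<in>I. N n \<omega> i = \<kappa> i)) \<longlonglongrightarrow> \<P>(\<omega> in Q. \<forall>i\<in>I. L \<omega> i = \<kappa> i)"
proof -
  interpret M: prob_space M by fact
  interpret Q: prob_space Q by fact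
  \<comment> \<open>\<open>W\<close> interpolates between the integrand of the generating function
    (\<open>J\<close> empty) and the indicator of the event (\<open>J = I\<close>).\<close>
  define W :: "'i set \<Rightarrow> ('i \<Rightarrow> real) \<Rightarrow> ('i \<Rightarrow> nat) \<Rightarrow> real" where
    "W J z k = (\<Prod>i\<in>J. of_bool (k i = \<kappa> i)) * (\<Prod>i\<in>I-J. z i ^ k i)" for J z k
  have pw: "\<bar>z ^ k\<bar> \<le> 1" if "0 < z \<and> z \<le> 1" for z :: real and k :: nat
    using that by (simp add: power_le_one)
  have W_meas: "(\<lambda>\<omega>. W J z (K \<omega>)) \<in> borel_measurable P"
    if "J \<subseteq> I" "\<And>i. i \<in> I \<Longrightarrow> (\<lambda>\<omega>. K \<omega> i) \<in> P \<rightarrow>\<^sub>M count_space UNIV" for J z K and P :: "'c measure"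
    unfolding W_def
  proof (intro borel_measurable_times borel_measurable_prod)
    fix i assume "i \<in> J"
    then have [measurable]: "(\<lambda>\<omega>. K \<omega> i) \<in> P \<rightarrow>\<^sub>M count_space UNIV" using that by auto
    show "(\<lambda>\<omega>. of_bool (K \<omega> i = \<kappa> i) :: real) \<in> borel_measurable P" by measurable
  next
    fix i assume "i \<in> I - J"
    then have [measurable]: "(\<lambda>\<omega>. K \<omega> i) \<in> P \<rightarrow>\<^sub>M count_space UNIV" using that by auto
    show "(\<lambda>\<omega>. z i ^ K \<omega> i) \<in> borel_measurable P" by measurable
  qed
  have W_bound: "\<bar>W J z k\<bar> \<le> 1" if "\<And>i. 0 < z i \<and> z i \<le> 1" for J z k
  proof -
    have "\<bar>\<Prod>i\<in>J. of_bool (k i = \<kappa> i) :: real\<bar> \<le> 1" by (intro abs_prod_le_one) auto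
    moreover have "\<bar>\<Prod>i\<in>I-J. z i ^ k i\<bar> \<le> 1" using pw[OF that] by (intro abs_prod_le_one) auto
    ultimately show ?thesis unfolding W_def abs_mult by (intro mult_le_one) auto
  qed
  have "(\<lambda>n. \<integral>\<omega>. W J z (N n \<omega>) \<partial>M) \<longlonglongrightarrow> (\<integral>\<omega>. W J z (L \<omega>) \<partial>Q)"
    if "J \<subseteq> I" "\<And>i. 0 < z i \<and> z i \<le> 1" for J z
    using finite_subset[OF that(1) I] that
  proof (induction J arbitrary: z rule: finite_induct)
    case empty
    then show ?case using conv by (simp add: W_def)
  next
    case (insert j J)
    then have j: "j \<in> I" "J \<subseteq> I" by auto
    define V where "V k = (\<Prod>i\<in>J. of_bool (k i = \<kappa> i)) * (\<Prod>i\<in>I-insert j J. z i ^ k i)" for k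
    have W1: "W (insert j J) z k = of_bool (k j = \<kappa> j) * V k" for k
      using insert(1,2) by (simp add: W_def V_def mult.assoc)
    have W2: "W J (z(j := x)) k = x ^ k j * V k" for x k
    proof -
      have "(\<Prod>i\<in>I-J. (z(j := x)) i ^ k i) = x ^ k j * (\<Prod>i\<in>I-J-{j}. (z(j := x)) i ^ k i)"
        using I j insert(2) by (subst prod.remove[of _ j]) auto
      also have "(\<Prod>i\<in>I-J-{j}. (z(j := x)) i ^ k i) = (\<Prod>i\<in>I-insert j J. z i ^ k i)"
        by (intro prod.cong) auto
      finally show ?thesis by (simp add: W_def V_def mult_ac)
    qed
    \<comment> \<open>The argument 1 deletes coordinate \<open>j\<close>, so \<open>V\<close>
      inherits measurability and bound from \<open>W\<close>.\<close>
    have V: "V k = W J (z(j := 1)) k" for k by (simp add: W2)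
    have V_bound: "\<bar>V k\<bar> \<le> 1" for k
      unfolding V using insert.prems(2) by (intro W_bound) auto
    note V_meas = W_meas[OF j(2), of _ _ "z(j := 1)", folded V]
    show ?case
    proof (rule LIMSEQ_approx)
      fix e :: real assume "e > 0"
      then obtain a d where ad: "\<And>k. \<bar>of_bool (k = \<kappa> j) - (\<Sum>r\<le>d. a r * ((1/2)^r)^k)\<bar> \<le> e"
        using of_bool_eq_polynomial_approx by metis
      let ?z = "\<lambda>r::nat. z(j := (1/2)^r)"
      have z: "0 < ?z r i \<and> ?z r i \<le> 1" for r i
        using insert.prems(2)[of i] by (auto simp: power_le_one)
      have approx: "\<bar>(\<integral>\<omega>. W (insert j J) z (K \<omega>) \<partial>P) - (\<Sum>r\<le>d. a r * (\<integral>\<omega>. W J (?z r) (K \<omega>) \<partial>P))\<bar> \<le> e"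
        if P: "prob_space P" and K: "\<And>i. i \<in> I \<Longrightarrow> (\<lambda>\<omega>. K \<omega> i) \<in> P \<rightarrow>\<^sub>M count_space UNIV"
        for P :: "'c measure" and K
      proof -
        interpret P: prob_space P by fact
        note [measurable] = K[OF j(1)] V_meas[OF K]
        have int: "integrable P (\<lambda>\<omega>. W J (?z r) (K \<omega>))" for r
          by (intro P.integrable_const_bound[of _ 1] AE_I2 W_meas[OF j(2)] K)
            (simp_all only: real_norm_def W_bound[OF z])
        have "(\<Sum>r\<le>d. a r * (\<integral>\<omega>. W J (?z r) (K \<omega>) \<partial>P)) = (\<integral>\<omega>. (\<Sum>r\<le>d. a r * W J (?z r) (K \<omega>)) \<partial>P)"
          using int by (simp add: Bochner_Integration.integral_sum)
        also have "\<dots> = (\<integral>\<omega>. (\<Sum>r\<le>d. a r * ((1/2)^r)^(K \<omega> j)) * V (K \<omega>) \<partial>P)"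
          by (simp add: W2 sum_distrib_right mult.assoc)
        finally show ?thesis
          unfolding W1 using ad V_bound
          by (simp only:) (intro expectation_mult_approx P, auto)
      qed
      have lim: "(\<lambda>n. \<Sum>r\<le>d. a r * (\<integral>\<omega>. W J (?z r) (N n \<omega>) \<partial>M)) \<longlonglongrightarrow>
          (\<Sum>r\<le>d. a r * (\<integral>\<omega>. W J (?z r) (L \<omega>) \<partial>Q))"
        using z by (intro tendsto_sum tendsto_mult tendsto_const insert.IH[OF j(2)]) blast
      show "\<exists>b b'. b \<longlonglongrightarrow> b' \<and> (\<forall>n. \<bar>(\<integral>\<omega>. W (insert j J) z (N n \<omega>) \<partial>M) - b n\<bar> \<le> e) \<and>
          \<bar>(\<integral>\<omega>. W (insert j J) z (L \<omega>) \<partial>Q) - b'\<bar> \<le> e"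
        using lim approx[OF Q, of L, OF L] approx[OF M, of "N n" for n, OF N] by blast
    qed
  qed
  from this[of I "\<lambda>_. 1"]
  have lim: "(\<lambda>n. \<integral>\<omega>. W I (\<lambda>_. 1) (N n \<omega>) \<partial>M) \<longlonglongrightarrow> (\<integral>\<omega>. W I (\<lambda>_. 1) (L \<omega>) \<partial>Q)" by simp
  have eq: "(\<integral>\<omega>. W I (\<lambda>_. 1) (K \<omega>) \<partial>P) = \<P>(\<omega> in P. \<forall>i\<in>I. K \<omega> i = \<kappa> i)"
    if P: "prob_space P" and K: "\<And>i. i \<in> I \<Longrightarrow> (\<lambda>\<omega>. K \<omega> i) \<in> P \<rightarrow>\<^sub>M count_space UNIV"
    for P :: "'c measure" and K
  proof -
    interpret P: prob_space P by fact
    have "{\<omega> \<in> space P. \<forall>i\<in>I. K \<omega> i = \<kappa> i} \<in> sets P"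
    proof (rule sets.sets_Collect_finite_All[OF _ I])
      fix i assume "i \<in> I"
      note K[OF this, measurable]
      show "{\<omega> \<in> space P. K \<omega> i = \<kappa> i} \<in> sets P" by measurable
    qed
    moreover have "W I (\<lambda>_. 1) k = of_bool (\<forall>i\<in>I. k i = \<kappa> i)" for k
    proof (cases "\<forall>i\<in>I. k i = \<kappa> i")
      case False
      then have "(\<Prod>i\<in>I. of_bool (k i = \<kappa> i) :: real) = 0" using I by (subst prod_zero_iff) auto
      then show ?thesis using False by (simp add: W_def)
    qed (simp add: W_def)
    then have "(\<integral>\<omega>. W I (\<lambda>_. 1) (K \<omega>) \<partial>P) = (\<integral>\<omega>. indicator {\<omega> \<in> space P. \<forall>i\<in>I. K \<omega> i = \<kappa> i} \<omega> \<partial>P)"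
      by (intro Bochner_Integration.integral_cong) auto
    ultimately show ?thesis by simp
  qed
  show ?thesis
    using lim eq[OF M, of "N n" for n, OF N] eq[OF Q, of L, OF L] by simp
qed

section \<open>The compound Poisson process\<close>

text \<open>The index set \<open>I\<close> may be infinite; the integrand sees only
  \<open>J\<close>, so the integral is taken over the finite marginal, where the product formula
  holds.\<close>

lemma integral_prod_coordinates:
  fixes g :: "'i \<Rightarrow> 'b \<Rightarrow> real"
  assumes "prob_space D" "finite J" "J \<subseteq> I"
    and g: "\<And>j. j \<in> J \<Longrightarrow> integrable D (g j)"
  shows "(\<integral>\<omega>. (\<Prod>j\<in>J. g j (\<omega> j)) \<partial>PiM I (\<lambda>_. D)) = (\<Prod>j\<in>J. \<integral>x. g j x \<partial>D)"
proof -
  interpret D: prob_space D by fact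
  interpret P: product_prob_space "\<lambda>_. D" I by unfold_locales
  have "(\<integral>\<omega>. (\<Prod>j\<in>J. g j (\<omega> j)) \<partial>PiM I (\<lambda>_. D)) =
      (\<integral>\<omega>. (\<Prod>j\<in>J. g j (\<omega> j)) \<partial>distr (PiM I (\<lambda>_. D)) (PiM J (\<lambda>_. D)) (\<lambda>x. restrict x J))"
    using assms(3) borel_measurable_integrable[OF g]
    by (subst integral_distr) (auto intro!: borel_measurable_prod measurable_restrict_subset)
  also have "\<dots> = (\<integral>\<omega>. (\<Prod>j\<in>J. g j (\<omega> j)) \<partial>PiM J (\<lambda>_. D))"
    using assms by (simp add: P.distr_PiM_restrict_finite)
  also have "\<dots> = (\<Prod>j\<in>J. \<integral>x. g j x \<partial>D)"
    by (rule P.product_integral_prod[OF assms(2) g])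
  finally show ?thesis .
qed

lemma integral_pmf_nat:
  fixes f :: "nat \<Rightarrow> real"
  assumes "summable (\<lambda>k. norm (pmf P k *\<^sub>R f k))"
  shows "(\<integral>k. f k \<partial>measure_pmf P) = (\<Sum>k. pmf P k *\<^sub>R f k)"
proof -
  have "integrable (count_space UNIV) (\<lambda>k. pmf P k *\<^sub>R f k)"
    using assms by (simp add: integrable_count_space_nat_iff)
  from integral_count_space_nat[OF this] show ?thesis
    by (subst measure_pmf_eq_density, subst integral_density) simp_all
qed

lemma poisson_pgf:
  assumes "l > 0"
  shows "(\<integral>k. g ^ k \<partial>measure_pmf (poisson_pmf l)) = exp (l * (g - 1))"
proof -
  have s: "(\<lambda>k. pmf (poisson_pmf l) k *\<^sub>R g ^ k) sums (exp (- l) * exp (l * g))"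
  proof -
    have "(\<lambda>k. (l * g)^k /\<^sub>R fact k) sums exp (l * g)" by (rule exp_converges)
    from sums_mult[OF this, of "exp (- l)"] show ?thesis
      using assms by (simp add: pmf_poisson power_mult_distrib field_simps)
  qed
  have "summable (\<lambda>k. norm (pmf (poisson_pmf l) k *\<^sub>R g ^ k))"
  proof -
    have "summable (\<lambda>k. norm ((l * g)^k /\<^sub>R fact k))" by (rule summable_norm_exp)
    from summable_mult[OF this, of "exp (- l)"] show ?thesis
      using assms by (simp add: pmf_poisson power_mult_distrib abs_mult power_abs field_simps)
  qed
  from integral_pmf_nat[OF this] sums_unique[OF s]
  show "(\<integral>k. g ^ k \<partial>measure_pmf (poisson_pmf l)) = exp (l * (g - 1))"
    by (simp add: exp_add[symmetric] algebra_simps)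
qed

text \<open>Rate 0 is included: since \<open>0 ^ 0 = 1\<close>, it gives the point mass at 0. Null
  sets in the definition of a Poisson process lead to this case.\<close>

definition poisson_prob :: "real \<Rightarrow> nat \<Rightarrow> real" where
  "poisson_prob a k = a ^ k / fact k * exp (- a)"

lemma pmf_with_poisson_prob:
  assumes "a \<ge> 0"
  obtains P where "pmf P = poisson_prob a"
    "\<And>z. (\<integral>k. z ^ k \<partial>measure_pmf P) = exp (a * (z - 1))"
proof (cases "a = 0")
  case True
  show ?thesis
    by (rule that[of "return_pmf 0"]) (auto simp: True fun_eq_iff poisson_prob_def power_0_left pmf_return)
next
  case False
  with assms have "a > 0" by simp
  then show ?thesis
    by (intro that[of "poisson_pmf a"]) (auto simp: fun_eq_iff poisson_prob_def poisson_pgf)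
qed

text \<open>Uniqueness is drawn from continuity: \<open>pgf_continuity\<close> is applied to a
  constant sequence, with a finite product of Poisson laws as the limit.\<close>

lemma (in prob_space) joint_poisson_of_pgf:
  fixes N :: "'a \<Rightarrow> 'i \<Rightarrow> nat"
  assumes I: "finite I" and N: "\<And>i. i \<in> I \<Longrightarrow> (\<lambda>\<omega>. N \<omega> i) \<in> M \<rightarrow>\<^sub>M count_space UNIV"
    and a: "\<And>i. a i \<ge> 0"
    and pgf: "\<And>z :: 'i \<Rightarrow> real. (\<And>i. 0 < z i \<and> z i \<le> 1) \<Longrightarrow>
      (\<integral>\<omega>. (\<Prod>i\<in>I. z i ^ N \<omega> i) \<partial>M) = exp (\<Sum>i\<in>I. a i * (z i - 1))"
  shows "\<P>(\<omega> in M. \<forall>i\<in>I. N \<omega> i = \<kappa> i) = (\<Prod>i\<in>I. poisson_prob (a i) (\<kappa> i))"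
proof -
  have "\<exists>P. pmf P = poisson_prob (a i) \<and> (\<forall>z. (\<integral>k. z ^ k \<partial>measure_pmf P) = exp (a i * (z - 1)))" for i
    using pmf_with_poisson_prob[OF a] by metis
  then obtain P where P: "\<And>i. pmf (P i) = poisson_prob (a i)"
    "\<And>i z. (\<integral>k. z ^ k \<partial>measure_pmf (P i)) = exp (a i * (z - 1))" by metis
  define Q where "Q = measure_pmf (Pi_pmf I 0 P)"
  have "(\<lambda>n::nat. \<P>(\<omega> in M. \<forall>i\<in>I. N \<omega> i = \<kappa> i)) \<longlonglongrightarrow> \<P>(\<omega> in Q. \<forall>i\<in>I. \<omega> i = \<kappa> i)"
  proof (rule pgf_continuity[OF I prob_space_axioms])
    fix z :: "'i \<Rightarrow> real" assume z: "\<And>i. 0 < z i \<and> z i \<le> 1"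
    have "(\<integral>\<omega>. (\<Prod>i\<in>I. z i ^ \<omega> i) \<partial>Q) = (\<Prod>i\<in>I. \<integral>k. z i ^ k \<partial>measure_pmf (P i))"
      unfolding Q_def
    proof (rule expectation_prod_Pi_pmf[OF I])
      show "integrable (measure_pmf (P i)) (\<lambda>k. z i ^ k)" for i
        using z[of i] by (intro measure_pmf.integrable_const_bound[of _ 1]) (auto simp: power_le_one)
      show "z i ^ k \<ge> 0" for i k using z[of i] by simp
    qed
    also have "\<dots> = exp (\<Sum>i\<in>I. a i * (z i - 1))" by (simp add: P(2) exp_sum[OF I])
    finally show "(\<lambda>n. \<integral>\<omega>. (\<Prod>i\<in>I. z i ^ N \<omega> i) \<partial>M) \<longlonglongrightarrow> (\<integral>\<omega>. (\<Prod>i\<in>I. z i ^ \<omega> i) \<partial>Q)"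
      using pgf[OF z] by simp
  qed (auto simp: Q_def N prob_space_measure_pmf)
  then have "\<P>(\<omega> in M. \<forall>i\<in>I. N \<omega> i = \<kappa> i) = \<P>(\<omega> in Q. \<forall>i\<in>I. \<omega> i = \<kappa> i)"
    by (simp add: LIMSEQ_const_iff)
  also have "{\<omega> \<in> space Q. \<forall>i\<in>I. \<omega> i = \<kappa> i} = Pi I (\<lambda>i. {\<kappa> i})" by (auto simp: Q_def)
  also have "measure Q \<dots> = (\<Prod>i\<in>I. poisson_prob (a i) (\<kappa> i))"
    unfolding Q_def using I by (simp add: measure_Pi_pmf_Pi measure_pmf_single P(1))
  finally show ?thesis .
qed

lemma (in prob_space) indep_vars_count_spaceI:
  fixes N :: "'i \<Rightarrow> 'a \<Rightarrow> 'b::countable"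
  assumes N: "\<And>i. i \<in> I \<Longrightarrow> N i \<in> M \<rightarrow>\<^sub>M count_space UNIV"
    and joint: "\<And>J \<kappa>. finite J \<Longrightarrow> J \<subseteq> I \<Longrightarrow> J \<noteq> {} \<Longrightarrow>
      \<P>(\<omega> in M. \<forall>i\<in>J. N i \<omega> = \<kappa> i) = (\<Prod>i\<in>J. \<P>(\<omega> in M. N i \<omega> = \<kappa> i))"
  shows "indep_vars (\<lambda>_. count_space UNIV) N I"
  unfolding indep_vars_def2
proof (intro conjI ballI N)
  \<comment> \<open>With the empty set added, the preimages of points are closed under intersection,
    and over a countable type they generate all preimages.\<close>
  define E where "E i = insert {} {N i -` {k} \<inter> space M | k. True}" for i
  have "indep_sets E I"
  proof (rule indep_setsI)
    show "E i \<subseteq> events" if "i \<in> I" for i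
      using measurable_sets[OF N[OF that]] by (auto simp: E_def)
    fix A J assume J: "J \<noteq> {}" "J \<subseteq> I" "finite J" and A: "\<forall>j\<in>J. A j \<in> E j"
    show "prob (\<Inter>j\<in>J. A j) = (\<Prod>j\<in>J. prob (A j))"
    proof (cases "\<exists>j\<in>J. A j = {}")
      case True
      then obtain j where "j \<in> J" "A j = {}" by auto
      then have "(\<Inter>j\<in>J. A j) = {}" "(\<Prod>j\<in>J. prob (A j)) = 0" using J(3) by (auto intro!: prod_zero bexI[of _ j])
      then show ?thesis by simp
    next
      case False
      then have "\<forall>j\<in>J. \<exists>k. A j = N j -` {k} \<inter> space M" using A by (auto simp: E_def)
      then obtain \<kappa> where \<kappa>: "\<And>j. j \<in> J \<Longrightarrow> A j = N j -` {\<kappa> j} \<inter> space M" by metis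
      have "(\<Inter>j\<in>J. A j) = {\<omega> \<in> space M. \<forall>i\<in>J. N i \<omega> = \<kappa> i}" using \<kappa> J(1) by auto
      moreover have "A j = {\<omega> \<in> space M. N j \<omega> = \<kappa> j}" if "j \<in> J" for j using \<kappa>[OF that] by auto
      ultimately show ?thesis using joint[OF J(3,2,1), of \<kappa>] by simp
    qed
  qed
  moreover have "Int_stable (E i)" for i
    unfolding Int_stable_def E_def by auto
  ultimately have "indep_sets (\<lambda>i. sigma_sets (space M) (E i)) I"
    by (rule indep_sets_sigma)
  then show "indep_sets (\<lambda>i. {N i -` A \<inter> space M | A. A \<in> sets (count_space UNIV)}) I"
  proof (rule indep_sets_mono_sets)
    fix i assume "i \<in> I"
    have "N i -` A \<inter> space M \<in> sigma_sets (space M) (E i)" for A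
    proof -
      have "(\<Union>k\<in>A. N i -` {k} \<inter> space M) \<in> sigma_sets (space M) (E i)"
        by (intro sigma_sets_UNION countable_image uncountable_infinite) (auto simp: E_def)
      also have "(\<Union>k\<in>A. N i -` {k} \<inter> space M) = N i -` A \<inter> space M" by auto
      finally show ?thesis .
    qed
    then show "{N i -` A \<inter> space M | A. A \<in> sets (count_space UNIV)} \<subseteq> sigma_sets (space M) (E i)" by auto
  qed
qed

lemma size_filter_sum_replicate:
  "size {#t \<in># (\<Sum>j\<in>A. replicate_mset (r j) (x j)). P t#} = (\<Sum>j\<in>A. r j * of_bool (P (x j)))"
proof (induction A rule: infinite_finite_induct)
  case (insert j A)
  have "size {#t \<in># replicate_mset n y. P t#} = n * of_bool (P y)" for n y
    by (induction n) auto
  then show ?case using insert by simp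
qed auto

lemma measurable_sum_random_index:
  fixes f :: "nat \<Rightarrow> 'a \<Rightarrow> nat"
  assumes K: "K \<in> M \<rightarrow>\<^sub>M count_space UNIV" and f [measurable]: "\<And>j. f j \<in> M \<rightarrow>\<^sub>M count_space UNIV"
  shows "(\<lambda>\<omega>. \<Sum>j<K \<omega>. f j \<omega>) \<in> M \<rightarrow>\<^sub>M count_space UNIV"
  by (rule measurable_compose_countable[where f = "\<lambda>k \<omega>. \<Sum>j<k. f j \<omega>", OF _ K]) measurable

section \<open>A Poisson number of independent marked uniform points\<close>

locale compound_poisson_construction =
  fixes l :: real and \<pi> :: "nat pmf"
  assumes l_pos: "l > 0"
begin

definition unif :: "real measure" where "unif = uniform_measure lborel {0..1}"

text \<open>The mixed binomial construction: for a Poisson number of independent uniform points, the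
  counts in disjoint sets are independent Poisson variables. Independence of the marks from number
  and positions is built into the product.\<close>

definition Q :: "(nat \<times> (nat \<Rightarrow> real) \<times> (nat \<Rightarrow> nat)) measure" where
  "Q = measure_pmf (poisson_pmf l) \<Otimes>\<^sub>M (PiM UNIV (\<lambda>_. unif) \<Otimes>\<^sub>M PiM UNIV (\<lambda>_. measure_pmf \<pi>))"

definition K :: "nat \<times> (nat \<Rightarrow> real) \<times> (nat \<Rightarrow> nat) \<Rightarrow> nat" where "K \<omega> = fst \<omega>"

text \<open>The coordinates are uniform on the unit interval only almost surely, hence the clamping.\<close>

definition x :: "nat \<Rightarrow> nat \<times> (nat \<Rightarrow> real) \<times> (nat \<Rightarrow> nat) \<Rightarrow> real" where
  "x j \<omega> = clamp (fst (snd \<omega>) j)"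

definition m :: "nat \<Rightarrow> nat \<times> (nat \<Rightarrow> real) \<times> (nat \<Rightarrow> nat) \<Rightarrow> nat" where
  "m j \<omega> = snd (snd \<omega>) j"

definition \<Psi> :: "nat \<times> (nat \<Rightarrow> real) \<times> (nat \<Rightarrow> nat) \<Rightarrow> real multiset" where
  "\<Psi> \<omega> = (\<Sum>j<K \<omega>. replicate_mset (m j \<omega>) (x j \<omega>))"

lemma sets_unif [measurable_cong]: "sets unif = sets borel" and space_unif [simp]: "space unif = UNIV"
  by (auto simp: unif_def)

sublocale U: prob_space unif
  unfolding unif_def by (rule prob_space_uniform_measure) auto

sublocale V: product_prob_space "\<lambda>_. unif" "UNIV :: nat set" by unfold_locales

sublocale W: product_prob_space "\<lambda>_. measure_pmf \<pi>" "UNIV :: nat set" by unfold_locales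

sublocale VW: pair_prob_space "PiM (UNIV :: nat set) (\<lambda>_. unif)" "PiM (UNIV :: nat set) (\<lambda>_. measure_pmf \<pi>)" ..

sublocale KVW: pair_prob_space "measure_pmf (poisson_pmf l)"
  "PiM (UNIV :: nat set) (\<lambda>_. unif) \<Otimes>\<^sub>M PiM (UNIV :: nat set) (\<lambda>_. measure_pmf \<pi>)" ..

sublocale Q: prob_space Q
  unfolding Q_def by (rule KVW.P.prob_space_axioms)

lemma measurable_K [measurable]: "K \<in> Q \<rightarrow>\<^sub>M count_space UNIV"
  unfolding K_def Q_def
  by (rule measurable_fst'') (auto simp: measurable_cong_sets[OF sets_measure_pmf_count_space refl])

lemma measurable_x [measurable]: "x j \<in> borel_measurable Q"
  unfolding x_def Q_def by measurable

lemma measurable_m [measurable]: "m j \<in> Q \<rightarrow>\<^sub>M count_space UNIV"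
  unfolding m_def Q_def by measurable

lemma x_in: "x j \<omega> \<in> {0..1}"
  unfolding x_def by simp

lemma integral_Q:
  fixes f :: "nat \<times> (nat \<Rightarrow> real) \<times> (nat \<Rightarrow> nat) \<Rightarrow> real"
  assumes f: "f \<in> borel_measurable Q" and bound: "\<And>\<omega>. \<bar>f \<omega>\<bar> \<le> 1"
  shows "(\<integral>\<omega>. f \<omega> \<partial>Q) = (\<integral>k. \<integral>v. \<integral>\<mu>. f (k, v, \<mu>) \<partial>PiM UNIV (\<lambda>_. measure_pmf \<pi>) \<partial>PiM UNIV (\<lambda>_. unif) \<partial>measure_pmf (poisson_pmf l))"
proof -
  note f' [measurable] = f[unfolded Q_def]
  have "(\<integral>\<omega>. f \<omega> \<partial>Q) = (\<integral>k. \<integral>w. f (k, w) \<partial>(PiM UNIV (\<lambda>_. unif) \<Otimes>\<^sub>M PiM UNIV (\<lambda>_. measure_pmf \<pi>)) \<partial>measure_pmf (poisson_pmf l))"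
    unfolding Q_def
    by (rule KVW.integral_fst'[symmetric]) (intro KVW.P.integrable_const_bound[of _ 1] AE_I2, auto simp: bound)
  also have "\<dots> = (\<integral>k. \<integral>v. \<integral>\<mu>. f (k, v, \<mu>) \<partial>PiM UNIV (\<lambda>_. measure_pmf \<pi>) \<partial>PiM UNIV (\<lambda>_. unif) \<partial>measure_pmf (poisson_pmf l))"
    by (intro Bochner_Integration.integral_cong refl VW.integral_fst'[symmetric])
      (intro VW.P.integrable_const_bound[of _ 1] AE_I2, auto simp: bound)
  finally show ?thesis .
qed

text \<open>Given \<open>K = k\<close> the factors are independent with the same mean, so the
  Poisson generating function is evaluated at this mean. It is used with \<open>h\<close> depending
  on the position only, for the Poisson property, and with powers of the multiplicity, for the cell
  counts of \<open>\<Psi>\<close>.\<close>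

lemma expectation_prod:
  fixes h :: "real \<Rightarrow> nat \<Rightarrow> real"
  assumes h: "\<And>k. (\<lambda>t. h t k) \<in> borel_measurable borel" and bound: "\<And>t k. \<bar>h t k\<bar> \<le> 1"
  shows "(\<integral>\<omega>. (\<Prod>j<K \<omega>. h (x j \<omega>) (m j \<omega>)) \<partial>Q) =
    exp (l * ((\<integral>t. \<integral>k. h (clamp t) k \<partial>measure_pmf \<pi> \<partial>unif) - 1))"
proof -
  define g where "g = (\<integral>t. \<integral>k. h (clamp t) k \<partial>measure_pmf \<pi> \<partial>unif)"
  have "(\<lambda>p. h (clamp (fst p)) (snd p)) \<in> borel_measurable (borel \<Otimes>\<^sub>M count_space UNIV)"
    by (rule measurable_compose_countable[where f = "\<lambda>k p. h (clamp (fst p)) k", OF _ measurable_snd])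
      (rule measurable_compose[OF _ h], measurable)
  then have hc: "(\<lambda>(t, k). h (clamp t) k) \<in> borel_measurable (borel \<Otimes>\<^sub>M measure_pmf \<pi>)"
    by (simp add: case_prod_beta cong: measurable_cong_sets)
  have h_meas: "(\<lambda>\<omega>. h (x j \<omega>) (m j \<omega>)) \<in> borel_measurable Q" for j
    by (rule measurable_compose_countable[where f = "\<lambda>k \<omega>. h (x j \<omega>) k", OF _ measurable_m])
      (rule measurable_compose[OF measurable_x h])
  have "(\<lambda>\<omega>. \<Prod>j<K \<omega>. h (x j \<omega>) (m j \<omega>)) \<in> borel_measurable Q"
    by (rule measurable_compose_countable[where f = "\<lambda>k \<omega>. \<Prod>j<k. h (x j \<omega>) (m j \<omega>)", OF _ measurable_K])
      (intro borel_measurable_prod h_meas)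
  then have "(\<integral>\<omega>. (\<Prod>j<K \<omega>. h (x j \<omega>) (m j \<omega>)) \<partial>Q) =
     (\<integral>k. \<integral>v. \<integral>\<mu>. (\<Prod>j<k. h (clamp (v j)) (\<mu> j)) \<partial>PiM UNIV (\<lambda>_. measure_pmf \<pi>) \<partial>PiM UNIV (\<lambda>_. unif) \<partial>measure_pmf (poisson_pmf l))"
    by (subst integral_Q) (auto intro!: abs_prod_le_one bound simp: K_def x_def m_def)
  also have "\<dots> = (\<integral>k. \<integral>v. (\<Prod>j<k. \<integral>i. h (clamp (v j)) i \<partial>measure_pmf \<pi>) \<partial>PiM UNIV (\<lambda>_. unif) \<partial>measure_pmf (poisson_pmf l))"
    by (intro Bochner_Integration.integral_cong refl integral_prod_coordinates prob_space_measure_pmf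
       measure_pmf.integrable_const_bound[of _ 1]) (auto simp: bound)
  also have "\<dots> = (\<integral>k. (\<Prod>j<k. g) \<partial>measure_pmf (poisson_pmf l))"
    unfolding g_def
  proof (intro Bochner_Integration.integral_cong refl integral_prod_coordinates U.prob_space_axioms
       U.integrable_const_bound[of _ 1] AE_I2)
    fix t :: real
    have "\<bar>\<integral>k. h (clamp t) k \<partial>measure_pmf \<pi>\<bar> \<le> (\<integral>k. \<bar>h (clamp t) k\<bar> \<partial>measure_pmf \<pi>)"
      by (rule integral_abs_bound)
    also have "\<dots> \<le> (\<integral>k. 1 \<partial>measure_pmf \<pi>)"
      by (intro integral_mono measure_pmf.integrable_const_bound[of _ 1]) (auto simp: bound)
    finally show "norm (\<integral>k. h (clamp t) k \<partial>measure_pmf \<pi>) \<le> 1" by simp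
  next
    have "(\<lambda>t. \<integral>k. h (clamp t) k \<partial>measure_pmf \<pi>) \<in> borel_measurable borel"
      by (rule measure_pmf.borel_measurable_lebesgue_integral[OF hc])
    then show "(\<lambda>t. \<integral>k. h (clamp t) k \<partial>measure_pmf \<pi>) \<in> borel_measurable unif"
      by (simp cong: measurable_cong_sets add: sets_unif)
  qed auto
  also have "\<dots> = exp (l * (g - 1))" using poisson_pgf[OF l_pos, of g] by simp
  finally show ?thesis unfolding g_def .
qed

lemma measure_unif: "A \<in> sets borel \<Longrightarrow> A \<subseteq> {0..1} \<Longrightarrow> measure unif {t. clamp t \<in> A} = measure lborel A"
proof -
  assume A: "A \<in> sets borel" "A \<subseteq> {0..1}"
  have c: "clamp -` A \<in> sets borel" using measurable_sets[OF measurable_clamp A(1)] by simp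
  have "emeasure unif (clamp -` A) = emeasure lborel ({0..1} \<inter> clamp -` A)"
    unfolding unif_def using c by (subst emeasure_uniform_measure) (auto simp: divide_ennreal_def)
  also have "{0..1} \<inter> clamp -` A = A" using A(2) by (auto simp: subset_iff)
  finally show ?thesis by (simp add: measure_def vimage_def)
qed

text \<open>The joint generating function is that of independent Poisson variables, its exponent
  being a sum over the sets. This one formula gives both the single laws and the
  independence.\<close>

lemma joint_counts:
  fixes I :: "'i set" and B :: "'i \<Rightarrow> real set"
  assumes I: "finite I" and disj: "disjoint_family_on B I"
    and B: "\<And>i. i \<in> I \<Longrightarrow> B i \<in> sets borel \<and> B i \<subseteq> {0..1}"
  shows "\<P>(\<omega> in Q. \<forall>i\<in>I. size {#t \<in># {#x j \<omega>. j \<in># mset_set {..<K \<omega>}#}. t \<in> B i#} = \<kappa> i) =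
    (\<Prod>i\<in>I. poisson_prob (l * measure lborel (B i)) (\<kappa> i))"
proof -
  define N where "N \<omega> i = (\<Sum>j<K \<omega>. of_bool (x j \<omega> \<in> B i) :: nat)" for \<omega> i
  have N: "size {#t \<in># {#x j \<omega>. j \<in># mset_set {..<K \<omega>}#}. t \<in> B i#} = N \<omega> i" for \<omega> i
  proof -
    have "{#x j \<omega>. j \<in># mset_set {..<K \<omega>}#} = (\<Sum>j<K \<omega>. replicate_mset 1 (x j \<omega>))"
      by (simp add: sum_unfold_sum_mset)
    then show ?thesis by (simp only: size_filter_sum_replicate N_def mult_1)
  qed
  show ?thesis
    unfolding N
  proof (rule Q.joint_poisson_of_pgf[OF I])
    fix i assume "i \<in> I"
    then have [measurable]: "B i \<in> sets borel" using B by auto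
    have "(\<lambda>\<omega>. of_bool (x j \<omega> \<in> B i) :: nat) \<in> Q \<rightarrow>\<^sub>M count_space UNIV" for j
      by measurable
    then show "(\<lambda>\<omega>. N \<omega> i) \<in> Q \<rightarrow>\<^sub>M count_space UNIV"
      unfolding N_def by (rule measurable_sum_random_index[OF measurable_K])
  next
    fix z :: "'i \<Rightarrow> real" assume z: "\<And>i. 0 < z i \<and> z i \<le> 1"
    define h where "h t = (\<Prod>i\<in>I. z i ^ of_bool (t \<in> B i))" for t
    have hN: "(\<Prod>i\<in>I. z i ^ N \<omega> i) = (\<Prod>j<K \<omega>. h (x j \<omega>))" for \<omega>
      unfolding h_def N_def power_sum by (rule prod.swap)
    have [measurable]: "h \<in> borel_measurable borel" unfolding h_def
    proof (intro borel_measurable_prod)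
      fix i assume "i \<in> I"
      then have [measurable]: "B i \<in> sets borel" using B by auto
      show "(\<lambda>t. z i ^ of_bool (t \<in> B i)) \<in> borel_measurable borel" by measurable
    qed
    have h1: "\<bar>h t\<bar> \<le> 1" for t
      unfolding h_def using z by (intro abs_prod_le_one) (auto simp: less_imp_le)
    \<comment> \<open>A point lies in at most one of the disjoint sets \<open>B i\<close>, so the
      product has at most one factor other than 1 and becomes linear in the indicators.\<close>
    have h_eq: "h t = 1 + (\<Sum>i\<in>I. (z i - 1) * of_bool (t \<in> B i))" for t
    proof (cases "\<exists>i\<in>I. t \<in> B i")
      case True
      then obtain i where i: "i \<in> I" "t \<in> B i" by auto
      then have other: "t \<notin> B j" if "j \<in> I - {i}" for j
        using disj that unfolding disjoint_family_on_def by auto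
      have "h t = z i" unfolding h_def using i other I
        by (subst prod.remove[OF I i(1)]) (simp add: prod.neutral)
      moreover have "(\<Sum>i\<in>I. (z i - 1) * of_bool (t \<in> B i)) = z i - 1" using i other I
        by (subst sum.remove[OF I i(1)]) (simp add: sum.neutral)
      ultimately show ?thesis by simp
    qed (simp add: h_def)
    have "(\<integral>t. h (clamp t) \<partial>unif) = 1 + (\<Sum>i\<in>I. (z i - 1) * measure lborel (B i))"
    proof -
      have int: "integrable unif (\<lambda>t. of_bool (clamp t \<in> B i) :: real)"
        and eq: "(\<integral>t. of_bool (clamp t \<in> B i) \<partial>unif) = measure lborel (B i)" if "i \<in> I" for i
      proof -
        have [measurable]: "B i \<in> sets borel" using B that by auto
        have "{t. clamp t \<in> B i} \<in> sets unif"
          using measurable_sets[OF measurable_clamp, of "B i"] by (simp add: sets_unif vimage_def)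
        moreover have "(\<lambda>t. of_bool (clamp t \<in> B i) :: real) = indicator {t. clamp t \<in> B i}"
          by (auto simp: fun_eq_iff)
        ultimately show "integrable unif (\<lambda>t. of_bool (clamp t \<in> B i) :: real)"
          "(\<integral>t. of_bool (clamp t \<in> B i) \<partial>unif) = measure lborel (B i)"
          using B[OF that] measure_unif[of "B i"]
          by (simp_all add: integrable_real_indicator U.emeasure_eq_measure)
      qed
      show ?thesis unfolding h_eq using int eq by (simp add: U.prob_space[unfolded space_unif])
    qed
    then show "(\<integral>\<omega>. (\<Prod>i\<in>I. z i ^ N \<omega> i) \<partial>Q) = exp (\<Sum>i\<in>I. l * measure lborel (B i) * (z i - 1))"
      unfolding hN using expectation_prod[of "\<lambda>t _. h t"] h1
      by (simp add: sum_distrib_left mult_ac)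
  qed (use l_pos in auto)
qed

lemma compound_poisson_process: "compound_poisson_process Q l \<pi> \<Psi>"
proof -
  let ?X = "\<lambda>\<omega>. {#x j \<omega>. j \<in># mset_set {..<K \<omega>}#}"
  have "(\<lambda>\<omega>. \<Sum>j<K \<omega>. replicate_mset 1 (x j \<omega>)) \<in> Q \<rightarrow>\<^sub>M vague_borel"
    by (intro measurable_sum_replicate measurable_K measurable_x measurable_const x_in) auto
  then have X: "?X \<in> Q \<rightarrow>\<^sub>M vague_borel" by (simp add: sum_unfold_sum_mset)
  have cnt_meas: "(\<lambda>\<omega>. size {#t \<in># ?X \<omega>. t \<in> B#}) \<in> Q \<rightarrow>\<^sub>M count_space UNIV" if [measurable]: "B \<in> sets borel" for B
  proof -
    have "size {#t \<in># ?X \<omega>. t \<in> B#} = (\<Sum>j<K \<omega>. of_bool (x j \<omega> \<in> B))" for \<omega>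
      using size_filter_sum_replicate[of "\<lambda>t. t \<in> B" "\<lambda>_. 1" "\<lambda>j. x j \<omega>" "{..<K \<omega>}"]
      by (simp add: sum_unfold_sum_mset)
    moreover have "(\<lambda>\<omega>. of_bool (x j \<omega> \<in> B) :: nat) \<in> Q \<rightarrow>\<^sub>M count_space UNIV" for j
      by measurable
    ultimately show ?thesis
      by (simp only: measurable_sum_random_index[OF measurable_K])
  qed
  have single: "\<P>(\<omega> in Q. size {#t \<in># ?X \<omega>. t \<in> B#} = k) = poisson_prob (l * measure lborel B) k"
    if "B \<in> sets borel" "B \<subseteq> {0..1}" for B k
    using joint_counts[of "{0::nat}" "\<lambda>_. B" "\<lambda>_. k"] that by (simp add: disjoint_family_on_def)
  have poisson: "poisson_process Q l ?X"
    unfolding poisson_process_def point_process_def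
  proof (intro conjI allI impI Q.prob_space_axioms X)
    fix B k assume "B \<in> sets borel \<and> B \<subseteq> {0..1::real}"
    then show "\<P>(\<omega> in Q. size {#t \<in># ?X \<omega>. t \<in> B#} = k) =
        (l * measure lborel B) ^ k / fact k * exp (- (l * measure lborel B))"
      using single[of B k] by (simp add: poisson_prob_def)
  next
    fix I :: "nat set" and B assume *: "finite I \<and> disjoint_family_on B I \<and> (\<forall>i\<in>I. B i \<in> sets borel \<and> B i \<subseteq> {0..1::real})"
    show "Q.indep_vars (\<lambda>_. count_space UNIV) (\<lambda>i \<omega>. size {#t \<in># ?X \<omega>. t \<in> B i#}) I"
    proof (rule Q.indep_vars_count_spaceI)
      fix J :: "nat set" and \<kappa> assume J: "finite J" "J \<subseteq> I"
      have "disjoint_family_on B J" using * J(2) by (meson disjoint_family_on_mono)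
      then have "\<P>(\<omega> in Q. \<forall>i\<in>J. size {#t \<in># ?X \<omega>. t \<in> B i#} = \<kappa> i) =
        (\<Prod>i\<in>J. poisson_prob (l * measure lborel (B i)) (\<kappa> i))"
        using * J by (intro joint_counts) auto
      also have "\<dots> = (\<Prod>i\<in>J. \<P>(\<omega> in Q. size {#t \<in># ?X \<omega>. t \<in> B i#} = \<kappa> i))"
        using * J by (intro prod.cong refl single[symmetric]) auto
      finally show "\<P>(\<omega> in Q. \<forall>i\<in>J. size {#t \<in># ?X \<omega>. t \<in> B i#} = \<kappa> i) =
        (\<Prod>i\<in>J. \<P>(\<omega> in Q. size {#t \<in># ?X \<omega>. t \<in> B i#} = \<kappa> i))" .
    qed (use * cnt_meas in auto)
  qed
  \<comment> \<open>The last coordinate of a product of probability measures has the last factor as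
    its law; this yields the distribution of each \<open>m j\<close> as well as their
    independence.\<close>
  have "distr Q (PiM UNIV (\<lambda>_. measure_pmf \<pi>)) (\<lambda>\<omega>. snd (snd \<omega>)) = PiM UNIV (\<lambda>_. measure_pmf \<pi>)"
  proof (rule measure_eqI)
    fix A assume "A \<in> sets (distr Q (PiM UNIV (\<lambda>_. measure_pmf \<pi>)) (\<lambda>\<omega>. snd (snd \<omega>)))"
    then have A: "A \<in> sets (PiM UNIV (\<lambda>_. measure_pmf \<pi>))" by simp
    have "emeasure (distr Q (PiM UNIV (\<lambda>_. measure_pmf \<pi>)) (\<lambda>\<omega>. snd (snd \<omega>))) A
      = emeasure Q (space (measure_pmf (poisson_pmf l)) \<times> (space (PiM UNIV (\<lambda>_. unif)) \<times> A))"
      using A sets.sets_into_space[OF A] unfolding Q_def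
      by (subst emeasure_distr) (auto simp: space_pair_measure intro!: arg_cong2[where f=emeasure])
    also have "\<dots> = emeasure (PiM UNIV (\<lambda>_. measure_pmf \<pi>)) A"
      unfolding Q_def using A
      by (subst sigma_finite_measure.emeasure_pair_measure_Times[OF prob_space_imp_sigma_finite[OF VW.P.prob_space_axioms]], simp, simp,
            subst sigma_finite_measure.emeasure_pair_measure_Times[OF prob_space_imp_sigma_finite[OF W.P.prob_space_axioms]])
        (auto simp: prob_space.emeasure_space_1[OF V.P.prob_space_axioms] measure_pmf.emeasure_space_1[simplified])
    finally show "emeasure (distr Q (PiM UNIV (\<lambda>_. measure_pmf \<pi>)) (\<lambda>\<omega>. snd (snd \<omega>))) A = emeasure (PiM UNIV (\<lambda>_. measure_pmf \<pi>)) A" .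
  qed simp
  moreover have "distr Q (PiM UNIV (\<lambda>_. count_space UNIV)) (\<lambda>\<omega>. snd (snd \<omega>)) =
      distr Q (PiM UNIV (\<lambda>_. measure_pmf \<pi>)) (\<lambda>\<omega>. snd (snd \<omega>))"
    by (intro distr_cong refl sets_PiM_cong) simp
  ultimately have m_distr: "distr Q (PiM UNIV (\<lambda>_. count_space UNIV)) (\<lambda>\<omega> j. m j \<omega>) = PiM UNIV (\<lambda>_. measure_pmf \<pi>)"
    unfolding m_def by simp
  have m_single: "distr Q (count_space UNIV) (m j) = measure_pmf \<pi>" for j
  proof -
    have "distr Q (count_space UNIV) (m j) = distr (distr Q (PiM UNIV (\<lambda>_. count_space UNIV)) (\<lambda>\<omega> j. m j \<omega>)) (count_space UNIV) (\<lambda>\<mu>. \<mu> j)"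
      by (subst distr_distr) (auto simp: comp_def intro!: measurable_PiM_single')
    also have "\<dots> = distr (PiM UNIV (\<lambda>_. measure_pmf \<pi>)) (measure_pmf \<pi>) (\<lambda>\<mu>. \<mu> j)"
      unfolding m_distr by (intro distr_cong) auto
    also have "\<dots> = measure_pmf \<pi>" by (rule W.PiM_component) simp
    finally show ?thesis .
  qed
  have "Q.indep_vars (\<lambda>_. count_space UNIV) m UNIV"
    by (subst Q.indep_vars_iff_distr_eq_PiM') (auto simp: m_single m_distr restrict_UNIV)
  moreover have "indep_rv Q
          (count_space UNIV \<Otimes>\<^sub>M (\<Pi>\<^sub>M j\<in>UNIV. borel)) (\<lambda>\<omega>. (K \<omega>, \<lambda>j. x j \<omega>))
          (\<Pi>\<^sub>M j\<in>UNIV. count_space UNIV) (\<lambda>\<omega> j. m j \<omega>)"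
    unfolding indep_rv_def
  proof (intro conjI)
    show KX: "(\<lambda>\<omega>. (K \<omega>, \<lambda>j. x j \<omega>)) \<in> Q \<rightarrow>\<^sub>M count_space UNIV \<Otimes>\<^sub>M (\<Pi>\<^sub>M j\<in>UNIV. borel)"
      by (intro measurable_Pair measurable_PiM_single') auto
    show m: "(\<lambda>\<omega> j. m j \<omega>) \<in> Q \<rightarrow>\<^sub>M (\<Pi>\<^sub>M j\<in>UNIV. count_space UNIV)"
      by (intro measurable_PiM_single') auto
    let ?c = "\<lambda>(k :: nat, v :: nat \<Rightarrow> real). (k, \<lambda>j. clamp (v j))"
    show "Q.indep_set {(\<lambda>\<omega>. (K \<omega>, \<lambda>j. x j \<omega>)) -` a \<inter> space Q | a. a \<in> sets (count_space UNIV \<Otimes>\<^sub>M (\<Pi>\<^sub>M j\<in>UNIV. borel))}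
        {(\<lambda>\<omega> j. m j \<omega>) -` b \<inter> space Q | b. b \<in> sets (\<Pi>\<^sub>M j\<in>UNIV. count_space UNIV)}"
      unfolding Q.indep_sets2_eq
    proof (intro conjI ballI)
      fix a b assume "a \<in> {(\<lambda>\<omega>. (K \<omega>, \<lambda>j. x j \<omega>)) -` a \<inter> space Q | a. a \<in> sets (count_space UNIV \<Otimes>\<^sub>M (\<Pi>\<^sub>M j\<in>UNIV. borel))}"
        "b \<in> {(\<lambda>\<omega> j. m j \<omega>) -` b \<inter> space Q | b. b \<in> sets (\<Pi>\<^sub>M j\<in>UNIV. count_space UNIV)}"
      then obtain a' b' where a: "a = (\<lambda>\<omega>. (K \<omega>, \<lambda>j. x j \<omega>)) -` a' \<inter> space Q" "a' \<in> sets (count_space UNIV \<Otimes>\<^sub>M (\<Pi>\<^sub>M j\<in>UNIV. borel))"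
        and b: "b = (\<lambda>\<omega> j. m j \<omega>) -` b' \<inter> space Q" "b' \<in> sets (\<Pi>\<^sub>M j\<in>UNIV. count_space UNIV)" by blast
      \<comment> \<open>Written as functions of \<open>(k, v)\<close> and of \<open>\<mu>\<close>
        alone, the two indicators let the iterated integral split into a product.\<close>
      define f :: "nat \<Rightarrow> (nat \<Rightarrow> real) \<Rightarrow> real" where "f k v = indicator a' (k, \<lambda>j. clamp (v j))" for k v
      define g :: "(nat \<Rightarrow> nat) \<Rightarrow> real" where "g \<mu> = indicator b' \<mu>" for \<mu>
      have [measurable]: "a \<in> sets Q" "b \<in> sets Q" using a b measurable_sets[OF KX] measurable_sets[OF m] by auto
      have fa: "indicator a \<omega> = f (fst \<omega>) (fst (snd \<omega>))" and gb: "indicator b \<omega> = g (snd (snd \<omega>))" if "\<omega> \<in> space Q" for \<omega>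
        using that by (auto simp: a b f_def g_def K_def x_def m_def indicator_def)
      have f_meas: "(\<lambda>\<omega>. f (fst \<omega>) (fst (snd \<omega>))) \<in> borel_measurable Q"
        using fa by (subst measurable_cong[OF fa[symmetric]]) auto
      have g_meas: "(\<lambda>\<omega>. g (snd (snd \<omega>))) \<in> borel_measurable Q"
        using gb by (subst measurable_cong[OF gb[symmetric]]) auto
      have ind: "measure Q c = (\<integral>\<omega>. indicator c \<omega> \<partial>Q)" if "c \<in> sets Q" for c using that by simp
      let ?W = "PiM UNIV (\<lambda>_. measure_pmf \<pi>)" and ?V = "PiM UNIV (\<lambda>_. unif)" and ?K = "measure_pmf (poisson_pmf l)"
      have "measure Q (a \<inter> b) = (\<integral>\<omega>. f (fst \<omega>) (fst (snd \<omega>)) * g (snd (snd \<omega>)) \<partial>Q)"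
        unfolding ind[OF sets.Int[OF \<open>a \<in> sets Q\<close> \<open>b \<in> sets Q\<close>]]
        by (intro Bochner_Integration.integral_cong refl) (simp only: indicator_inter_arith fa gb)
      also have "\<dots> = (\<integral>k. \<integral>v. \<integral>\<mu>. f k v * g \<mu> \<partial>?W \<partial>?V \<partial>?K)"
        using f_meas g_meas by (subst integral_Q) (auto simp: f_def g_def indicator_def)
      also have "\<dots> = (\<integral>k. \<integral>v. f k v \<partial>?V \<partial>?K) * (\<integral>\<mu>. g \<mu> \<partial>?W)" by simp
      also have "(\<integral>k. \<integral>v. f k v \<partial>?V \<partial>?K) = measure Q a"
      proof -
        have "measure Q a = (\<integral>\<omega>. f (fst \<omega>) (fst (snd \<omega>)) \<partial>Q)"
          unfolding ind[OF \<open>a \<in> sets Q\<close>] by (intro Bochner_Integration.integral_cong refl fa)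
        also have "\<dots> = (\<integral>k. \<integral>v. \<integral>\<mu>. f (fst (k, v, \<mu> :: nat \<Rightarrow> nat)) (fst (snd (k, v, \<mu>))) \<partial>?W \<partial>?V \<partial>?K)"
          by (rule integral_Q[OF f_meas]) (simp add: f_def indicator_def)
        finally show ?thesis by (simp add: prob_space.prob_space[OF W.P.prob_space_axioms])
      qed
      also have "(\<integral>\<mu>. g \<mu> \<partial>?W) = measure Q b"
      proof -
        have "measure Q b = (\<integral>\<omega>. g (snd (snd \<omega>)) \<partial>Q)"
          unfolding ind[OF \<open>b \<in> sets Q\<close>] by (intro Bochner_Integration.integral_cong refl gb)
        also have "\<dots> = (\<integral>k. \<integral>v. \<integral>\<mu>. g (snd (snd (k :: nat, v :: nat \<Rightarrow> real, \<mu>))) \<partial>?W \<partial>?V \<partial>?K)"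
          by (rule integral_Q[OF g_meas]) (simp add: g_def indicator_def)
        finally show ?thesis by (simp add: prob_space.prob_space[OF V.P.prob_space_axioms])
      qed
      finally show "measure Q (a \<inter> b) = measure Q a * measure Q b" .
    qed (use measurable_sets[OF KX] measurable_sets[OF m] in auto)
  qed
  ultimately show ?thesis
    unfolding compound_poisson_process_def
    using Q.prob_space_axioms poisson m_single
    by (intro conjI exI[of _ K] exI[of _ x] exI[of _ m]) (auto simp: \<Psi>_def)
qed

lemma point_process_\<Psi>: "point_process Q \<Psi>"
  unfolding point_process_def \<Psi>_def
  by (intro conjI Q.prob_space_axioms measurable_sum_replicate measurable_K measurable_m measurable_x x_in)

lemma grid_count_\<Psi>: "grid_count n (\<Psi> \<omega>) i = (\<Sum>j<K \<omega>. m j \<omega> * of_bool (grid_point n (x j \<omega>) = i))"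
  unfolding grid_count_def \<Psi>_def by (rule size_filter_sum_replicate)

lemma measurable_grid_point [measurable]: "grid_point n \<in> borel \<rightarrow>\<^sub>M count_space UNIV"
  unfolding grid_point_def by measurable

lemma measurable_grid_count_\<Psi>: "(\<lambda>\<omega>. grid_count n (\<Psi> \<omega>) i) \<in> Q \<rightarrow>\<^sub>M count_space UNIV"
  unfolding grid_count_\<Psi> by (rule measurable_sum_random_index[OF measurable_K]) measurable

lemma measure_grid_cell:
  assumes "n > 0" "i < n"
  shows "measure unif {t. grid_point n (clamp t) = i} = 1 / real n"
proof -
  let ?A = "{real i / real n ..< real (i + 1) / real n}"
  have "?A \<subseteq> {0..1}"
  proof
    fix t assume "t \<in> ?A"
    then have "0 \<le> t" "t < real (i + 1) / real n" by (auto intro: order_trans[of _ "real i / real n"])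
    moreover have "real (i + 1) / real n \<le> 1" using assms by simp
    ultimately show "t \<in> {0..1}" by simp
  qed
  have "grid_point n t = i \<longleftrightarrow> t \<in> ?A" if "t \<in> {0..1}" for t
  proof -
    have "grid_point n t = i \<longleftrightarrow> \<lfloor>real n * t\<rfloor> = int i"
      using that by (auto simp: grid_point_def)
    also have "\<dots> \<longleftrightarrow> t \<in> ?A"
      using assms by (simp add: floor_eq_iff pos_divide_le_eq pos_less_divide_eq mult.commute add.commute)
    finally show ?thesis .
  qed
  then have "{t. grid_point n (clamp t) = i} = {t. clamp t \<in> ?A}" by auto
  then have "measure unif {t. grid_point n (clamp t) = i} = measure lborel ?A"
    using measure_unif[of ?A] \<open>?A \<subseteq> {0..1}\<close> by simp
  also have "\<dots> = 1 / real n"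
    using assms by (simp add: divide_right_mono diff_divide_distrib[symmetric])
  finally show ?thesis .
qed

text \<open>Regrouped by points instead of cells, the product has one factor \<open>z ^ m\<close>
  for each point of the Poisson process, so \<open>expectation_prod\<close> applies.\<close>

lemma pgf_grid_count_\<Psi>:
  assumes n: "n > 0" and z: "\<And>i. 0 < z i \<and> z i \<le> (1::real)"
  shows "(\<integral>\<omega>. (\<Prod>i\<le>n. z i ^ grid_count n (\<Psi> \<omega>) i) \<partial>Q) =
    exp (- l * (\<Sum>i<n. 1 - (\<integral>k. z i ^ k \<partial>measure_pmf \<pi>)) / real n)"
proof -
  define G where "G i = (\<integral>k. z i ^ k \<partial>measure_pmf \<pi>)" for i
  have "(\<Prod>i\<le>n. z i ^ grid_count n (\<Psi> \<omega>) i) = (\<Prod>j<K \<omega>. z (grid_point n (x j \<omega>)) ^ m j \<omega>)" for \<omega>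
  proof -
    have "(\<Prod>i\<le>n. z i ^ grid_count n (\<Psi> \<omega>) i) = (\<Prod>j<K \<omega>. \<Prod>i\<le>n. z i ^ (m j \<omega> * of_bool (grid_point n (x j \<omega>) = i)))"
      unfolding grid_count_\<Psi> power_sum by (rule prod.swap)
    also have "\<dots> = (\<Prod>j<K \<omega>. z (grid_point n (x j \<omega>)) ^ m j \<omega>)"
    proof (rule prod.cong[OF refl])
      fix j
      have "grid_point n (x j \<omega>) \<in> {..n}" using grid_point_le[OF x_in] by simp
      then show "(\<Prod>i\<le>n. z i ^ (m j \<omega> * of_bool (grid_point n (x j \<omega>) = i))) = z (grid_point n (x j \<omega>)) ^ m j \<omega>"
        by (subst prod.remove[of _ "grid_point n (x j \<omega>)"]) (auto intro!: prod.neutral)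
    qed
    finally show ?thesis .
  qed
  then have "(\<integral>\<omega>. (\<Prod>i\<le>n. z i ^ grid_count n (\<Psi> \<omega>) i) \<partial>Q) =
      exp (l * ((\<integral>t. \<integral>k. z (grid_point n (clamp t)) ^ k \<partial>measure_pmf \<pi> \<partial>unif) - 1))"
    using z by (simp only:) (intro expectation_prod, measurable, simp add: power_le_one less_imp_le)
  also have "(\<integral>t. \<integral>k. z (grid_point n (clamp t)) ^ k \<partial>measure_pmf \<pi> \<partial>unif) = (\<integral>t. (\<Sum>i\<le>n. G i * of_bool (grid_point n (clamp t) = i)) \<partial>unif)"
  proof (intro Bochner_Integration.integral_cong refl)
    fix t
    have "grid_point n (clamp t) \<in> {..n}" using grid_point_le[OF clamp_in(1)] by simp
    then show "(\<integral>k. z (grid_point n (clamp t)) ^ k \<partial>measure_pmf \<pi>) = (\<Sum>i\<le>n. G i * of_bool (grid_point n (clamp t) = i))"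
      by (subst sum.remove[of _ "grid_point n (clamp t)"]) (auto intro!: sum.neutral simp: G_def)
  qed
  also have "\<dots> = (\<Sum>i\<le>n. G i * measure unif {t. grid_point n (clamp t) = i})"
  proof -
    have S: "{t. grid_point n (clamp t) = i} \<in> sets unif" for i by measurable
    have ind: "(\<lambda>t. of_bool (grid_point n (clamp t) = i) :: real) = indicator {t. grid_point n (clamp t) = i}" for i
      by (auto simp: fun_eq_iff)
    have int: "integrable unif (\<lambda>t. of_bool (grid_point n (clamp t) = i) :: real)" for i
      unfolding ind using S by (simp add: integrable_real_indicator U.emeasure_eq_measure)
    have eq: "(\<integral>t. of_bool (grid_point n (clamp t) = i) \<partial>unif) = measure unif {t. grid_point n (clamp t) = i}" for i
      unfolding ind using S by simp
    show ?thesis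
      by (subst Bochner_Integration.integral_sum) (intro integrable_mult_right int, simp only: integral_mult_right_zero eq)
  qed
  also have "\<dots> = (\<Sum>i<n. G i) / real n"
  proof -
    \<comment> \<open>The cells \<open>i < n\<close> have mass \<open>1 / n\<close> each and all
      masses add up to 1, so nothing is left for cell \<open>n\<close>. This is why the exponent is
      a sum over \<open>i < n\<close> only.\<close>
    have "(\<Sum>i\<le>n. measure unif {t. grid_point n (clamp t) = i}) = 1"
    proof -
      have "(\<Sum>i\<le>n. measure unif {t. grid_point n (clamp t) = i}) = measure unif (\<Union>i\<le>n. {t. grid_point n (clamp t) = i})"
        by (intro U.finite_measure_finite_Union[symmetric]) (auto simp: disjoint_family_on_def)
      also have "(\<Union>i\<le>n. {t. grid_point n (clamp t) = i}) = space unif" using grid_point_le[OF clamp_in(1)] by auto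
      finally show ?thesis by (simp only: U.prob_space)
    qed
    then have "measure unif {t. grid_point n (clamp t) = n} = 0"
      using measure_grid_cell[OF n] n by (simp add: lessThan_Suc_atMost[symmetric])
    then show ?thesis using measure_grid_cell[OF n]
      by (simp add: lessThan_Suc_atMost[symmetric] sum_divide_distrib)
  qed
  finally show ?thesis using n by (simp add: G_def sum_subtractf field_simps)
qed

end

section \<open>Returns of a biased random walk\<close>

definition path_space :: "(nat \<Rightarrow> int) measure" where
  "path_space = PiM {1..} (\<lambda>_. count_space UNIV)"

definition pos :: "(nat \<Rightarrow> int) \<Rightarrow> nat \<Rightarrow> int" where
  "pos w n = (\<Sum>k = 1..n. w k)"

text \<open>The index set \<open>I\<close> is left open because partial sums are needed on the full
  path space and on finite blocks of increments.\<close>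

lemma measurable_pos_PiM:
  assumes "{1..n} \<subseteq> I"
  shows "(\<lambda>w. pos w n) \<in> PiM I (\<lambda>_. count_space UNIV) \<rightarrow>\<^sub>M count_space UNIV"
proof -
  have comp: "(\<lambda>w. w k) \<in> PiM I (\<lambda>_. count_space (UNIV :: int set)) \<rightarrow>\<^sub>M count_space UNIV" if "k \<in> I" for k
    using that by (rule measurable_component_singleton)
  have "(\<lambda>w. \<Sum>k \<in> {1..n}. w k) \<in> PiM I (\<lambda>_. count_space (UNIV :: int set)) \<rightarrow>\<^sub>M count_space UNIV"
    using assms
  proof (induction n)
    case (Suc n)
    have *: "(\<lambda>w. a + w (Suc n)) \<in> PiM I (\<lambda>_. count_space UNIV) \<rightarrow>\<^sub>M count_space UNIV" for a :: int
      using Suc.prems by (intro measurable_compose[where f = "\<lambda>w. w (Suc n)" and g = "\<lambda>x. a + x", OF comp]) auto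
    have "(\<lambda>w. (\<Sum>k \<in> {1..n}. w k) + w (Suc n)) \<in> PiM I (\<lambda>_. count_space (UNIV :: int set)) \<rightarrow>\<^sub>M count_space UNIV"
    proof (rule measurable_compose_countable[where f = "\<lambda>a w. a + w (Suc n)", OF *])
      show "(\<lambda>w. \<Sum>k \<in> {1..n}. w k) \<in> PiM I (\<lambda>_. count_space (UNIV :: int set)) \<rightarrow>\<^sub>M count_space UNIV"
        using Suc.prems by (intro Suc.IH) auto
    qed
    then show ?case by simp
  qed simp
  then show ?thesis by (simp add: pos_def)
qed

lemma measurable_pos [measurable]: "(\<lambda>w. pos w n) \<in> path_space \<rightarrow>\<^sub>M count_space UNIV"
  unfolding path_space_def by (rule measurable_pos_PiM) auto

lemma (in prob_space) indep_vars_reindex_inj: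
  assumes ind: "indep_vars (\<lambda>_. N) X (f ` I)" and inj: "inj_on f I"
  shows "indep_vars (\<lambda>_. N) (\<lambda>k. X (f k)) I"
  unfolding indep_vars_def2
proof (intro conjI ballI indep_setsI)
  let ?F = "\<lambda>i. {X i -` A \<inter> space M | A. A \<in> sets N}"
  have F: "indep_sets ?F (f ` I)" using ind by (simp add: indep_vars_def2)
  show "?F (f k) \<subseteq> events" if "k \<in> I" for k
    using F that by (auto simp: indep_sets_def)
  fix A J assume J: "J \<noteq> {}" "J \<subseteq> I" "finite J" and A: "\<forall>j\<in>J. A j \<in> ?F (f j)"
  have injJ: "inj_on f J" using inj J(2) by (rule inj_on_subset)
  define A' where "A' = A \<circ> the_inv_into J f"
  have A': "A' (f j) = A j" if "j \<in> J" for j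
    using that injJ by (simp add: A'_def the_inv_into_f_f)
  have "prob (\<Inter>j\<in>f ` J. A' j) = (\<Prod>j\<in>f ` J. prob (A' j))"
    using A A' J by (intro indep_setsD[OF F]) auto
  then show "prob (\<Inter>j\<in>J. A j) = (\<Prod>j\<in>J. prob (A j))"
    using A' by (simp add: prod.reindex[OF injJ])
qed (use ind in \<open>auto simp: indep_vars_def2\<close>)

locale biased_walk = prob_space M for M :: "'a measure" +
  fixes X :: "nat \<Rightarrow> 'a \<Rightarrow> int" and p :: real
  assumes p: "0 < p" "p < 1" "p \<noteq> 1 / 2"
    and X_indep: "indep_vars (\<lambda>_. count_space UNIV) X {1..}"
    and X_up: "\<And>i. i \<ge> 1 \<Longrightarrow> \<P>(\<omega> in M. X i \<omega> = 1) = p"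
    and X_down: "\<And>i. i \<ge> 1 \<Longrightarrow> \<P>(\<omega> in M. X i \<omega> = -1) = 1 - p"
begin

text \<open>Indexing the increments after time \<open>i\<close> from 1 again gives all
  \<open>future i\<close> the same law on \<open>path_space\<close>.\<close>

definition future :: "nat \<Rightarrow> 'a \<Rightarrow> nat \<Rightarrow> int" where
  "future i \<omega> = (\<lambda>k\<in>{1..}. X (i + k) \<omega>)"

lemma measurable_X: "i \<ge> 1 \<Longrightarrow> X i \<in> M \<rightarrow>\<^sub>M count_space UNIV"
  using X_indep by (auto simp: indep_vars_def2)

lemma measurable_future [measurable]: "future i \<in> M \<rightarrow>\<^sub>M path_space"
  unfolding future_def path_space_def by (intro measurable_restrict measurable_X) simp

lemma pos_future: "pos (future i \<omega>) j = walk X (i + j) \<omega> - walk X i \<omega>"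
proof -
  have "walk X (i + j) \<omega> = walk X i \<omega> + (\<Sum>k = 1..j. X (i + k) \<omega>)"
    by (induction j) (auto simp: walk_def)
  then show ?thesis by (simp add: pos_def future_def)
qed

lemma walk_eq_pos: "walk X j \<omega> = pos (future 0 \<omega>) j"
  using pos_future[of 0 \<omega> j] by (simp add: walk_def)

lemma measurable_walk [measurable]: "walk X j \<in> M \<rightarrow>\<^sub>M count_space UNIV"
proof -
  have "(\<lambda>\<omega>. pos (future 0 \<omega>) j) \<in> M \<rightarrow>\<^sub>M count_space UNIV" by measurable
  then show ?thesis by (simp add: walk_eq_pos[symmetric])
qed

lemma AE_step: "AE \<omega> in M. \<forall>i\<ge>1. X i \<omega> = 1 \<or> X i \<omega> = -1"
proof -
  have "AE \<omega> in M. i \<ge> 1 \<longrightarrow> X i \<omega> = 1 \<or> X i \<omega> = -1" for i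
  proof (cases "i \<ge> 1")
    case True
    note [measurable] = measurable_X[OF True]
    have "prob ({\<omega> \<in> space M. X i \<omega> = 1} \<union> {\<omega> \<in> space M. X i \<omega> = -1}) = p + (1 - p)"
      using X_up[OF True] X_down[OF True] by (subst finite_measure_Union) auto
    then have "prob {\<omega> \<in> space M. X i \<omega> = 1 \<or> X i \<omega> = -1} = 1"
      by (simp add: Collect_disj_eq[symmetric] conj_disj_distribL[symmetric])
    then have "AE \<omega> in M. X i \<omega> = 1 \<or> X i \<omega> = -1"
      by (subst (asm) prob_Collect_eq_1) auto
    then show ?thesis by simp
  qed simp
  then show ?thesis by (simp add: AE_all_countable)
qed

definition step_law :: "int measure" where
  "step_law = distr M (count_space UNIV) (X 1)"

lemma distr_X: "i \<ge> 1 \<Longrightarrow> distr M (count_space UNIV) (X i) = step_law"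
proof -
  have e: "emeasure (distr M (count_space UNIV) (X i)) {a} =
      ennreal (if a = 1 then p else if a = -1 then 1 - p else 0)" if i: "i \<ge> 1" for i a
  proof -
    note [measurable] = measurable_X[OF i]
    have "emeasure (distr M (count_space UNIV) (X i)) {a} = prob {\<omega> \<in> space M. X i \<omega> = a}"
      by (subst emeasure_distr) (auto simp: emeasure_eq_measure intro!: arg_cong[where f=prob])
    moreover have "prob {\<omega> \<in> space M. X i \<omega> = a} = 0" if "a \<noteq> 1" "a \<noteq> -1"
    proof -
      have "AE \<omega> in M. X i \<omega> \<noteq> a" using AE_step i that by (auto elim!: eventually_mono)
      then show ?thesis by (subst prob_Collect_eq_0) auto
    qed
    ultimately show ?thesis using X_up[OF i] X_down[OF i] by auto
  qed
  show "i \<ge> 1 \<Longrightarrow> distr M (count_space UNIV) (X i) = step_law"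
    unfolding step_law_def by (rule measure_eqI_countable[of _ UNIV]) (auto simp: e)
qed

lemma distr_future: "distr M path_space (future i) = PiM {1..} (\<lambda>_. step_law)"
proof -
  have "indep_vars (\<lambda>_. count_space UNIV) (\<lambda>k. X (i + k)) {1..}"
  proof -
    have "indep_vars (\<lambda>_. count_space UNIV) X ((\<lambda>k. i + k) ` {1..})"
      by (rule indep_vars_subset[OF X_indep]) auto
    then show ?thesis by (rule indep_vars_reindex_inj) simp
  qed
  then have "distr M (PiM {1..} (\<lambda>_. count_space UNIV)) (\<lambda>\<omega>. \<lambda>k\<in>{1..}. X (i + k) \<omega>) =
      PiM {1..} (\<lambda>k. distr M (count_space UNIV) (X (i + k)))"
    by (subst (asm) indep_vars_iff_distr_eq_PiM') (auto simp: measurable_X)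
  also have "\<dots> = PiM {1..} (\<lambda>_. step_law)"
    by (intro PiM_cong refl distr_X) auto
  finally show ?thesis by (simp add: future_def[abs_def] path_space_def)
qed

lemma expectation_future:
  fixes f :: "(nat \<Rightarrow> int) \<Rightarrow> real"
  assumes "f \<in> borel_measurable path_space"
  shows "expectation (\<lambda>\<omega>. f (future i \<omega>)) = expectation (\<lambda>\<omega>. f (future 0 \<omega>))"
  using assms by (simp add: integral_distr[OF measurable_future, symmetric] distr_future)

lemma prob_future:
  assumes "A \<in> sets path_space"
  shows "prob {\<omega> \<in> space M. future i \<omega> \<in> A} = prob {\<omega> \<in> space M. future 0 \<omega> \<in> A}"
proof -
  have "prob {\<omega> \<in> space M. future i \<omega> \<in> A} = measure (PiM {1..} (\<lambda>_. step_law)) A" for i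
    using assms by (subst distr_future[of i, symmetric], subst measure_distr)
      (auto intro!: arg_cong[where f=prob])
  then show ?thesis by simp
qed

text \<open>The Markov property at a deterministic time: the events depend on disjoint sets of
  increments, and reindexing the later ones produces \<open>future i\<close>.\<close>

lemma indep_past_future:
  assumes A: "A \<in> sets (PiM {1..i} (\<lambda>_. count_space UNIV))" and B: "B \<in> sets path_space"
  shows "prob {\<omega> \<in> space M. (\<lambda>k\<in>{1..i}. X k \<omega>) \<in> A \<and> future i \<omega> \<in> B} =
    prob {\<omega> \<in> space M. (\<lambda>k\<in>{1..i}. X k \<omega>) \<in> A} * prob {\<omega> \<in> space M. future i \<omega> \<in> B}"
proof -
  have ind: "indep_var (PiM {1..i} (\<lambda>_. count_space UNIV)) (\<lambda>\<omega>. restrict (\<lambda>k. X k \<omega>) {1..i})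
      (PiM {i<..} (\<lambda>_. count_space UNIV)) (\<lambda>\<omega>. restrict (\<lambda>k. X k \<omega>) {i<..})"
    by (rule indep_var_restrict[OF X_indep]) auto
  define s where "s v = (\<lambda>k\<in>{1..}. v (i + k))" for v :: "nat \<Rightarrow> int"
  have s: "s \<in> PiM {i<..} (\<lambda>_. count_space UNIV) \<rightarrow>\<^sub>M path_space"
    unfolding s_def path_space_def
    by (intro measurable_restrict measurable_component_singleton) auto
  have fut: "future i \<omega> = s (restrict (\<lambda>k. X k \<omega>) {i<..})" for \<omega>
    unfolding future_def s_def by auto
  have "s -` B \<inter> space (PiM {i<..} (\<lambda>_. count_space UNIV)) \<in> sets (PiM {i<..} (\<lambda>_. count_space UNIV))"
    by (rule measurable_sets[OF s B])
  from indep_varD[OF ind A this]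
  show ?thesis
    by (simp add: fut vimage_def Int_def space_PiM conj_ac PiE_def)
qed

end

section \<open>Transience and the number of visits to the origin\<close>

context biased_walk begin

text \<open>A Chernoff bound: where the walk is at 0, \<open>exp (b * walk)\<close> equals 1, so the
  probability is at most the exponential moment, which factorizes over the steps.\<close>

lemma prob_walk_eq_0: "prob {\<omega> \<in> space M. walk X n \<omega> = 0} \<le> (1 / 2 + 2 * p * (1 - p)) ^ n"
proof -
  \<comment> \<open>With \<open>exp b = 1 / (2 * p)\<close> the exponential moment of a step is
    \<open>1 / 2 + 2 * p * (1 - p)\<close>. The optimal exponent would give
    \<open>2 * sqrt (p * (1 - p))\<close>; the present choice avoids the square root.\<close>
  define b where "b = ln (1 / (2 * p))"
  have b: "exp b = 1 / (2 * p)" "exp (- b) = 2 * p" using p by (simp_all add: b_def exp_minus)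
  define Y where "Y i \<omega> = exp (b * real_of_int (X i \<omega>))" for i \<omega>
  have Y_meas: "Y i \<in> borel_measurable M" if "i \<ge> 1" for i
    unfolding Y_def by (rule measurable_compose[OF measurable_X[OF that]]) simp
  have Y_eq: "AE \<omega> in M. Y i \<omega> = exp b * indicator {\<omega> \<in> space M. X i \<omega> = 1} \<omega> + exp (- b) * indicator {\<omega> \<in> space M. X i \<omega> = -1} \<omega>"
    if "i \<ge> 1" for i
    using AE_step AE_space by eventually_elim (use that in \<open>auto simp: Y_def indicator_def\<close>)
  have Y: "integrable M (Y i) \<and> expectation (Y i) = 1 / 2 + 2 * p * (1 - p)" if i: "i \<ge> 1" for i
  proof -
    note [measurable] = measurable_X[OF i] Y_meas[OF i]
    let ?R = "\<lambda>\<omega>. exp b * indicator {\<omega> \<in> space M. X i \<omega> = 1} \<omega> + exp (- b) * indicator {\<omega> \<in> space M. X i \<omega> = -1} \<omega> :: real"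
    have "integrable M ?R" by (intro Bochner_Integration.integrable_add integrable_mult_right integrable_real_indicator) (auto simp: emeasure_eq_measure)
    moreover have "expectation ?R = exp b * p + exp (- b) * (1 - p)"
      using X_up[OF i] X_down[OF i]
      by (subst Bochner_Integration.integral_add) (auto intro!: integrable_mult_right integrable_real_indicator simp: emeasure_eq_measure)
    moreover have "integrable M (Y i) \<longleftrightarrow> integrable M ?R" using Y_eq[OF i] by (intro integrable_cong_AE) auto
    moreover have "expectation (Y i) = expectation ?R" using Y_eq[OF i] by (intro integral_cong_AE) auto
    ultimately show ?thesis using p by (simp add: b)
  qed
  have ind: "indep_vars (\<lambda>_. borel) Y {1..n}"
    unfolding Y_def by (rule indep_vars_compose2[OF indep_vars_subset[OF X_indep]]) auto
  have prod_eq: "(\<Prod>i\<in>{1..n}. Y i \<omega>) = exp (b * real_of_int (walk X n \<omega>))" for \<omega>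
    by (simp add: Y_def walk_def exp_sum[symmetric] sum_distrib_left)
  have int: "integrable M (\<lambda>\<omega>. \<Prod>i\<in>{1..n}. Y i \<omega>)"
    by (rule indep_vars_integrable[OF _ ind]) (auto simp: Y)
  have "prob {\<omega> \<in> space M. walk X n \<omega> = 0} = expectation (indicator {\<omega> \<in> space M. walk X n \<omega> = 0})" by simp
  also have "\<dots> \<le> expectation (\<lambda>\<omega>. \<Prod>i\<in>{1..n}. Y i \<omega>)"
    by (rule integral_mono[OF _ int])
      (simp_all only: prod_eq, auto simp: indicator_def emeasure_eq_measure intro!: integrable_real_indicator)
  also have "\<dots> = (\<Prod>i\<in>{1..n}. expectation (Y i))"
    by (rule indep_vars_lebesgue_integral[OF _ ind]) (auto simp: Y)
  also have "\<dots> = (1 / 2 + 2 * p * (1 - p)) ^ n" by (simp add: Y)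
  finally show ?thesis .
qed

definition late_return :: "nat \<Rightarrow> real" where
  "late_return T = prob {\<omega> \<in> space M. \<exists>j>T. walk X j \<omega> = 0}"

text \<open>A union bound over a geometric series. The bias enters here:
  \<open>1 - r = (1 - 2 * p)\<^sup>2 / 2\<close> is positive because
  \<open>p \<noteq> 1 / 2\<close>.\<close>

lemma late_return_tendsto_0: "late_return \<longlonglongrightarrow> 0"
proof -
  define r where "r = 1 / 2 + 2 * p * (1 - p)"
  have "(1 - 2 * p)\<^sup>2 > 0" using p by simp
  then have "r < 1" using p by (auto simp: r_def power2_eq_square algebra_simps)
  moreover have "p * (1 - p) \<ge> 0" using p by simp
  then have "0 \<le> r" unfolding r_def by simp
  ultimately have r: "0 \<le> r" "r < 1" by simp_all
  have le: "late_return T \<le> r ^ Suc T * (1 / (1 - r))" for T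
  proof -
    let ?A = "\<lambda>j. {\<omega> \<in> space M. walk X (Suc T + j) \<omega> = 0}"
    have s: "(\<lambda>j. r ^ (Suc T + j)) sums (r ^ Suc T * (1 / (1 - r)))"
      using sums_mult[OF geometric_sums[of r], of "r ^ Suc T"] r by (simp add: power_add mult.assoc)
    have A: "prob (?A j) \<le> r ^ (Suc T + j)" for j
      unfolding r_def by (rule prob_walk_eq_0)
    have sm: "summable (\<lambda>j. prob (?A j))"
      by (rule summable_comparison_test'[OF sums_summable[OF s], of 0]) (use A in simp)
    have "{\<omega> \<in> space M. \<exists>j>T. walk X j \<omega> = 0} = (\<Union>j. ?A j)"
      by (auto simp: less_iff_Suc_add) 
    then have "late_return T = prob (\<Union>j. ?A j)" by (simp add: late_return_def)
    also have "\<dots> \<le> (\<Sum>j. prob (?A j))"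
      by (rule finite_measure_subadditive_countably[OF _ sm]) auto
    also have "\<dots> \<le> r ^ Suc T * (1 / (1 - r))"
      using suminf_le[OF A sm sums_summable[OF s]] sums_unique[OF s] by simp
    finally show ?thesis .
  qed
  have "(\<lambda>T. r ^ Suc T * (1 / (1 - r))) \<longlonglongrightarrow> 0 * (1 / (1 - r))"
    using r by (intro tendsto_mult tendsto_const LIMSEQ_Suc LIMSEQ_power_zero) auto
  then have lim: "(\<lambda>T. r ^ Suc T * (1 / (1 - r))) \<longlonglongrightarrow> 0" by simp
  show ?thesis
    by (rule tendsto_sandwich[OF _ _ tendsto_const lim]) (use le in \<open>auto simp: late_return_def\<close>)
qed

abbreviation q :: real where "q \<equiv> escape_prob M X"

abbreviation geo_pgf :: "real \<Rightarrow> real" where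
  "geo_pgf z \<equiv> \<integral>k. z ^ k \<partial>measure_pmf (geometric_pmf q)"

text \<open>Both events concern only the increments after \<open>t\<close>, so their probabilities
  are those for \<open>t = 0\<close>.\<close>

lemma prob_future_no_return: "prob {\<omega> \<in> space M. \<forall>s>t. walk X s \<omega> \<noteq> walk X t \<omega>} = q"
  and prob_future_late_return: "prob {\<omega> \<in> space M. \<exists>s>t+T. walk X s \<omega> = walk X t \<omega>} = late_return T"
proof -
  have *: "(\<exists>s>t+T. walk X s \<omega> = walk X t \<omega>) \<longleftrightarrow> (\<exists>j>T. pos (future t \<omega>) j = 0)" for \<omega> t T
    unfolding pos_future by (auto simp: less_iff_Suc_add add.assoc)
  have sets: "{w \<in> space path_space. \<exists>j>T. pos w j = 0} \<in> sets path_space"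
    "{w \<in> space path_space. \<not> (\<exists>j>T. pos w j = 0)} \<in> sets path_space" for T by measurable
  have sp: "future t \<omega> \<in> space path_space" if "\<omega> \<in> space M" for t \<omega>
    using measurable_space[OF measurable_future that] .
  have eq: "{\<omega> \<in> space M. \<exists>s>t+T. walk X s \<omega> = walk X t \<omega>} = {\<omega> \<in> space M. future t \<omega> \<in> {w \<in> space path_space. \<exists>j>T. pos w j = 0}}"
    "{\<omega> \<in> space M. \<not> (\<exists>s>t+T. walk X s \<omega> = walk X t \<omega>)} = {\<omega> \<in> space M. future t \<omega> \<in> {w \<in> space path_space. \<not> (\<exists>j>T. pos w j = 0)}}" for t T
    using sp * by auto
  have 0: "walk X 0 \<omega> = 0" for \<omega> by (simp add: walk_def)
  show "prob {\<omega> \<in> space M. \<exists>s>t+T. walk X s \<omega> = walk X t \<omega>} = late_return T"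
    using eq(1)[of t T] eq(1)[of 0 T] prob_future[OF sets(1), of t T] by (simp add: late_return_def 0)
  have "prob {\<omega> \<in> space M. \<not> (\<exists>s>t+0. walk X s \<omega> = walk X t \<omega>)} = prob {\<omega> \<in> space M. \<not> (\<exists>s>0+0. walk X s \<omega> = walk X 0 \<omega>)}"
    using prob_future[OF sets(2), of t 0] unfolding eq(2)[of t 0] eq(2)[of 0 0] .
  then show "prob {\<omega> \<in> space M. \<forall>s>t. walk X s \<omega> \<noteq> walk X t \<omega>} = q"
    by (simp add: escape_prob_def 0 Suc_le_eq neq0_conv[symmetric] disj_not1[symmetric] del: disj_not1 neq0_conv)
qed

text \<open>Visits are numbered from 0, so \<open>nth_visit 0 0\<close> is the whole space. The visit number
  \<open>j\<close> is the last one with probability \<open>q\<close>, which makes the number of visits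
  geometric without a strong Markov property.\<close>

definition nth_visit :: "nat \<Rightarrow> nat \<Rightarrow> 'a set" where
  "nth_visit j t = {\<omega> \<in> space M. walk X t \<omega> = 0 \<and> card {s \<in> {..<t}. walk X s \<omega> = 0} = j}"

lemma measurable_card_zeros:
  assumes "finite A" "\<And>s. s \<in> A \<Longrightarrow> f s \<in> N \<rightarrow>\<^sub>M count_space (UNIV :: int set)"
  shows "(\<lambda>\<omega>. card {s \<in> A. f s \<omega> = 0}) \<in> N \<rightarrow>\<^sub>M count_space UNIV"
proof -
  have "card {s \<in> A. f s \<omega> = 0} = (\<Sum>s\<in>A. of_bool (f s \<omega> = 0))" for \<omega>
    using assms(1) by (simp add: Collect_conj_eq)
  moreover have "(\<lambda>\<omega>. \<Sum>s\<in>A. of_bool (f s \<omega> = 0) :: nat) \<in> N \<rightarrow>\<^sub>M count_space UNIV"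
    using assms(2) by measurable
  ultimately show ?thesis by simp
qed

lemma nth_visit_sets [measurable]: "nth_visit j t \<in> events"
proof -
  have [measurable]: "(\<lambda>\<omega>. card {s \<in> {..<t}. walk X s \<omega> = 0}) \<in> M \<rightarrow>\<^sub>M count_space UNIV"
    by (rule measurable_card_zeros) auto
  show ?thesis unfolding nth_visit_def by measurable
qed

text \<open>At a fixed time \<open>t\<close> the first event depends on the increments up to
  \<open>t\<close> and the second on the later ones.\<close>

lemma nth_visit_no_return:
  "prob (nth_visit j t \<inter> {\<omega> \<in> space M. \<forall>s>t. walk X s \<omega> \<noteq> walk X t \<omega>}) = prob (nth_visit j t) * q"
proof -
  let ?P = "PiM {1..t} (\<lambda>_. count_space (UNIV :: int set))"
  define A where "A = {v \<in> space ?P. pos v t = 0 \<and> card {s \<in> {..<t}. pos v s = 0} = j}"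
  define B where "B = {w \<in> space path_space. \<not> (\<exists>j>0. pos w j = 0)}"
  have [measurable]: "(\<lambda>v. card {s \<in> {..<t}. pos v s = 0}) \<in> ?P \<rightarrow>\<^sub>M count_space UNIV"
    by (rule measurable_card_zeros) (auto intro: measurable_pos_PiM)
  have [measurable]: "(\<lambda>v. pos v t) \<in> ?P \<rightarrow>\<^sub>M count_space UNIV" by (rule measurable_pos_PiM) simp
  have A: "A \<in> sets ?P" unfolding A_def by measurable
  have B: "B \<in> sets path_space" unfolding B_def by measurable
  have sp: "future t \<omega> \<in> space path_space" if "\<omega> \<in> space M" for \<omega>
    using measurable_space[OF measurable_future that] .
  have restr: "pos (\<lambda>k\<in>{1..t}. X k \<omega>) s = walk X s \<omega>" if "s \<le> t" for s \<omega>
    unfolding pos_def walk_def using that by (intro sum.cong) auto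
  have "(\<forall>s>t. walk X s \<omega> \<noteq> walk X t \<omega>) \<longleftrightarrow> \<not> (\<exists>j>0. pos (future t \<omega>) j = 0)" for \<omega>
    unfolding pos_future by (auto simp: less_iff_Suc_add)
  then have 2: "{\<omega> \<in> space M. \<forall>s>t. walk X s \<omega> \<noteq> walk X t \<omega>} = {\<omega> \<in> space M. future t \<omega> \<in> B}"
    using sp by (auto simp: B_def)
  have "{s \<in> {..<t}. pos (\<lambda>k\<in>{1..t}. X k \<omega>) s = 0} = {s \<in> {..<t}. walk X s \<omega> = 0}" for \<omega>
    using restr by auto
  then have 1: "nth_visit j t = {\<omega> \<in> space M. (\<lambda>k\<in>{1..t}. X k \<omega>) \<in> A}"
    unfolding nth_visit_def A_def mem_Collect_eq restr[OF order_refl] by (auto simp: space_PiM)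
  have "prob (nth_visit j t \<inter> {\<omega> \<in> space M. \<forall>s>t. walk X s \<omega> \<noteq> walk X t \<omega>}) =
      prob {\<omega> \<in> space M. (\<lambda>k\<in>{1..t}. X k \<omega>) \<in> A \<and> future t \<omega> \<in> B}"
    unfolding 1 2 by (intro arg_cong[where f = prob]) auto
  also have "\<dots> = prob (nth_visit j t) * q"
    unfolding indep_past_future[OF A B] 1 2[symmetric] prob_future_no_return ..
  finally show ?thesis .
qed

text \<open>Pathwise facts behind the geometric law. The first expresses the number of visits
  through events at fixed times, to which independence applies; the second supplies the recursion in
  \<open>j\<close>. As \<open>card\<close> is 0 on infinite sets, paths with infinitely many zeros
  are treated correctly in both.\<close>

lemma exists_visit_Suc_iff:
  fixes W :: "nat \<Rightarrow> int"
  defines "V \<equiv> \<lambda>j t. W t = 0 \<and> card {s \<in> {..<t}. W s = 0} = j"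
  shows "card {i. W i = 0} = Suc j \<longleftrightarrow> (\<exists>t. V j t \<and> (\<forall>s>t. W s \<noteq> W t))"
    and "(\<exists>t. V (Suc j) t) \<longleftrightarrow> (\<exists>t. V j t) \<and> card {i. W i = 0} \<noteq> Suc j"
proof -
  have last: "{i. W i = 0} = insert t {s \<in> {..<t}. W s = 0}" if "W t = 0" "\<forall>s>t. W s \<noteq> W t" for t
    using that by (auto simp: not_less) (metis linorder_neqE_nat)
  have step: "V j t" if "V (Suc j) t'" "t = Max {s \<in> {..<t'}. W s = 0}" for t t' j
  proof -
    let ?A = "{s \<in> {..<t'}. W s = 0}"
    have "card ?A = Suc j" using that(1) by (simp add: V_def)
    then have "?A \<noteq> {}" by (metis card.empty nat.distinct(1))
    then have fin: "finite ?A" "?A \<noteq> {}" by simp_all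
    then have t: "t \<in> ?A" "\<And>s. s \<in> ?A \<Longrightarrow> s \<le> t" using that(2) Max_in[OF fin] by auto
    have "?A = insert t {s \<in> {..<t}. W s = 0}"
    proof (intro set_eqI iffI)
      fix s assume "s \<in> ?A"
      with t(2)[of s] show "s \<in> insert t {s \<in> {..<t}. W s = 0}" by auto
    qed (use t(1) in auto)
    then have "card ?A = Suc (card {s \<in> {..<t}. W s = 0})" by simp
    then show ?thesis using that(1) t(1) by (simp add: V_def)
  qed
  show 1: "card {i. W i = 0} = Suc j \<longleftrightarrow> (\<exists>t. V j t \<and> (\<forall>s>t. W s \<noteq> W t))"
  proof
    assume c: "card {i. W i = 0} = Suc j"
    define t where "t = Max {i. W i = 0}"
    \<comment> \<open>A nonzero \<open>card\<close> forces finiteness, so there is a last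
      visit.\<close>
    have fin: "finite {i. W i = 0}" "{i. W i = 0} \<noteq> {}"
      using c card_gt_0_iff[of "{i. W i = 0}"] by simp_all
    have t: "W t = 0" "\<And>s. W s = 0 \<Longrightarrow> s \<le> t" using Max_in[OF fin] Max_ge[OF fin(1)] by (auto simp: t_def)
    then have nt: "\<forall>s>t. W s \<noteq> W t" by (metis leD)
    show "\<exists>t. V j t \<and> (\<forall>s>t. W s \<noteq> W t)"
      using c t nt last[OF t(1) nt] by (intro exI[of _ t]) (simp add: V_def)
  next
    assume "\<exists>t. V j t \<and> (\<forall>s>t. W s \<noteq> W t)"
    then obtain t where t: "V j t" "\<forall>s>t. W s \<noteq> W t" by auto
    then show "card {i. W i = 0} = Suc j" using last[of t] by (simp add: V_def)
  qed
  show "(\<exists>t. V (Suc j) t) \<longleftrightarrow> (\<exists>t. V j t) \<and> card {i. W i = 0} \<noteq> Suc j"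
  proof
    assume "\<exists>t. V (Suc j) t"
    then obtain t where t: "V (Suc j) t" by auto
    have "card {i. W i = 0} \<noteq> Suc j"
    proof
      assume c: "card {i. W i = 0} = Suc j"
      have "insert t {s \<in> {..<t}. W s = 0} \<subseteq> {i. W i = 0}" using t by (auto simp: V_def)
      moreover have "finite {i. W i = 0}" using c by (auto intro: card_ge_0_finite)
      ultimately have "card (insert t {s \<in> {..<t}. W s = 0}) \<le> Suc j" using c by (metis card_mono)
      then show False using t by (simp add: V_def)
    qed
    then show "(\<exists>t. V j t) \<and> card {i. W i = 0} \<noteq> Suc j" using step[OF t] by blast
  next
    assume *: "(\<exists>t. V j t) \<and> card {i. W i = 0} \<noteq> Suc j"
    then obtain t where t: "V j t" by auto
    with * 1 have "\<exists>s>t. W s = 0" by (auto simp: V_def)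
    \<comment> \<open>The next zero after \<open>t\<close>; by minimality \<open>t\<close> itself is
      the only zero that joins the earlier ones.\<close>
    define s where "s = (LEAST s. s > t \<and> W s = 0)"
    have s: "s > t" "W s = 0" using LeastI_ex[OF \<open>\<exists>s>t. W s = 0\<close>[simplified]] by (auto simp: s_def)
    have least: "\<not> (r > t \<and> W r = 0)" if "r < s" for r using not_less_Least[OF that[unfolded s_def]] .
    have "{r \<in> {..<s}. W r = 0} = insert t {r \<in> {..<t}. W r = 0}"
      using s t least by (auto simp: V_def) (metis linorder_neqE_nat)
    then show "\<exists>t. V (Suc j) t" using s t by (intro exI[of _ s]) (simp add: V_def)
  qed
qed

text \<open>If \<open>a j\<close> denotes the probability that visit number \<open>j\<close> occurs,
  that visit is the last one with probability \<open>a j * q\<close>, whence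
  \<open>a (j + 1) = a j - a j * q\<close>. The positivity of \<open>q\<close> is not presupposed
  but deduced from this formula afterwards.\<close>

lemma prob_nth_visit: "prob (\<Union>t. nth_visit j t) = (1 - q) ^ j"
  and prob_visits: "prob {\<omega> \<in> space M. visits X \<omega> = Suc j} = q * (1 - q) ^ j"
  and visits_event: "{\<omega> \<in> space M. visits X \<omega> = Suc j} \<in> events"
proof -
  let ?N = "\<lambda>t. {\<omega> \<in> space M. \<forall>s>t. walk X s \<omega> \<noteq> walk X t \<omega>}"
  have N [measurable]: "?N t \<in> events" for t by measurable
  have U: "{\<omega> \<in> space M. visits X \<omega> = Suc j} = (\<Union>t. nth_visit j t \<inter> ?N t)" for j
    unfolding visits_def exists_visit_Suc_iff(1)[of "\<lambda>i. walk X i _"] by (auto simp: nth_visit_def)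
  show ev: "{\<omega> \<in> space M. visits X \<omega> = Suc j} \<in> events" for j unfolding U by measurable
  have disj: "disjoint_family (nth_visit j)" for j
  proof -
    have False if "t < t'" "\<omega> \<in> nth_visit j t" "\<omega> \<in> nth_visit j t'" for t t' \<omega>
    proof -
      have "insert t {s \<in> {..<t}. walk X s \<omega> = 0} \<subseteq> {s \<in> {..<t'}. walk X s \<omega> = 0}"
        using that by (auto simp: nth_visit_def)
      from card_mono[OF _ this] show False using that by (simp add: nth_visit_def)
    qed
    then show ?thesis unfolding disjoint_family_on_def by (metis disjoint_iff linorder_neqE_nat)
  qed
  have vis: "prob {\<omega> \<in> space M. visits X \<omega> = Suc j} = prob (\<Union>t. nth_visit j t) * q" for j
  proof -
    have "(\<lambda>t. prob (nth_visit j t)) sums prob (\<Union>t. nth_visit j t)"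
      using disj by (intro finite_measure_UNION) auto
    then have s1: "(\<lambda>t. prob (nth_visit j t) * q) sums (prob (\<Union>t. nth_visit j t) * q)" by (rule sums_mult2)
    have s2: "(\<lambda>t. prob (nth_visit j t \<inter> ?N t)) sums prob (\<Union>t. nth_visit j t \<inter> ?N t)"
    proof (intro finite_measure_UNION)
      show "disjoint_family (\<lambda>t. nth_visit j t \<inter> ?N t)"
        using disj[of j] unfolding disjoint_family_on_def by blast
    qed auto
    show ?thesis unfolding U by (rule sums_unique2[OF s2[unfolded nth_visit_no_return] s1])
  qed
  have Suc: "prob (\<Union>t. nth_visit (Suc j) t) = prob (\<Union>t. nth_visit j t) - prob {\<omega> \<in> space M. visits X \<omega> = Suc j}" for j
  proof -
    have eq: "(\<Union>t. nth_visit (Suc j) t) = (\<Union>t. nth_visit j t) - {\<omega> \<in> space M. visits X \<omega> = Suc j}"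
    proof (intro set_eqI)
      fix \<omega>
      show "\<omega> \<in> (\<Union>t. nth_visit (Suc j) t) \<longleftrightarrow> \<omega> \<in> (\<Union>t. nth_visit j t) - {\<omega> \<in> space M. visits X \<omega> = Suc j}"
        using exists_visit_Suc_iff(2)[of "\<lambda>i. walk X i \<omega>" j] by (auto simp: nth_visit_def visits_def)
    qed
    show ?thesis unfolding eq by (rule finite_measure_Diff) (use ev in \<open>auto simp: U\<close>)
  qed
  show nth: "prob (\<Union>t. nth_visit j t) = (1 - q) ^ j" for j
  proof (induction j)
    case 0
    have "\<omega> \<in> nth_visit 0 0" if "\<omega> \<in> space M" for \<omega> using that by (simp add: nth_visit_def walk_def)
    then have "(\<Union>t. nth_visit 0 t) = space M" by (auto simp: nth_visit_def)
    then show ?case by (simp add: prob_space)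
  next
    case (Suc j)
    then show ?case by (simp add: \<open>\<And>j. prob (\<Union>t. nth_visit (Suc j) t) = _\<close> vis algebra_simps)
  qed
  show "prob {\<omega> \<in> space M. visits X \<omega> = Suc j} = q * (1 - q) ^ j" by (simp add: vis nth)
qed

text \<open>If \<open>q\<close> were 0, visits of every number would occur almost surely. But visit
  number \<open>T + 2\<close> is preceded by \<open>T + 2\<close> others and so happens after time
  \<open>T\<close>, which is unlikely for large \<open>T\<close>.\<close>

lemma q_bounds: "0 < q" "q \<le> 1"
proof -
  show "q \<le> 1" by (simp add: escape_prob_def)
  have "q \<ge> 0" by (simp add: escape_prob_def)
  have "(1 - q) ^ (T + 2) \<le> late_return T" for T
  proof -
    have "(\<Union>t. nth_visit (T + 2) t) \<subseteq> {\<omega> \<in> space M. \<exists>j>T. walk X j \<omega> = 0}"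
    proof
      fix \<omega> assume "\<omega> \<in> (\<Union>t. nth_visit (T + 2) t)"
      then obtain t where t: "\<omega> \<in> nth_visit (T + 2) t" by auto
      have "card {s \<in> {..<t}. walk X s \<omega> = 0} \<le> card {..<t}" by (intro card_mono) auto
      then have "t > T" using t by (simp add: nth_visit_def)
      then show "\<omega> \<in> {\<omega> \<in> space M. \<exists>j>T. walk X j \<omega> = 0}" using t by (auto simp: nth_visit_def)
    qed
    then show ?thesis unfolding late_return_def prob_nth_visit[symmetric]
      by (rule finite_measure_mono) measurable
  qed
  then have "q \<noteq> 0"
    using LIMSEQ_le_const[OF late_return_tendsto_0, of 1] by auto
  then show "0 < q" using \<open>q \<ge> 0\<close> by simp
qed

text \<open>The geometric weights add up to 1 because \<open>q > 0\<close>. This rules out the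
  default value 0 of \<open>visits\<close>, which stands for infinitely many visits.\<close>

lemma AE_visits_pos: "AE \<omega> in M. visits X \<omega> \<noteq> 0"
proof -
  have "(\<lambda>j. prob {\<omega> \<in> space M. visits X \<omega> = Suc j}) sums prob (\<Union>j. {\<omega> \<in> space M. visits X \<omega> = Suc j})"
    by (rule finite_measure_UNION) (auto simp: disjoint_family_on_def visits_event)
  moreover have "(\<lambda>j. q * (1 - q) ^ j) sums (q * (1 / (1 - (1 - q))))"
    using q_bounds by (intro sums_mult geometric_sums) auto
  ultimately have "prob (\<Union>j. {\<omega> \<in> space M. visits X \<omega> = Suc j}) = 1"
    using q_bounds by (simp add: prob_visits sums_unique2)
  then have "AE \<omega> in M. \<omega> \<in> (\<Union>j. {\<omega> \<in> space M. visits X \<omega> = Suc j})"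
    by (subst (asm) prob_eq_1) (auto simp: visits_event)
  then show ?thesis by (rule eventually_mono) auto
qed

lemma expectation_visits:
  assumes z: "0 < z" "z \<le> (1::real)"
  shows "(\<lambda>\<omega>. z ^ (visits X \<omega> - 1)) \<in> borel_measurable M"
    and "expectation (\<lambda>\<omega>. z ^ (visits X \<omega> - 1)) = geo_pgf z"
proof -
  define R where "R \<omega> = visits X \<omega> - 1" for \<omega>
  have ev0: "{\<omega> \<in> space M. visits X \<omega> = 0} \<in> events"
  proof -
    have "{\<omega> \<in> space M. visits X \<omega> = 0} = space M - (\<Union>j. {\<omega> \<in> space M. visits X \<omega> = Suc j})"
      by (auto simp: gr0_conv_Suc) (metis not0_implies_Suc)
    also have "\<dots> \<in> events" using visits_event by (intro sets.Diff sets.top sets.countable_UN) auto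
    finally show ?thesis .
  qed
  have "{\<omega> \<in> space M. visits X \<omega> = j} \<in> events" for j using ev0 visits_event by (cases j) auto
  then have vis [measurable]: "visits X \<in> M \<rightarrow>\<^sub>M count_space UNIV"
    by (subst measurable_count_space_eq2_countable) (auto simp: vimage_def Int_def conj_commute)
  have [measurable]: "R \<in> M \<rightarrow>\<^sub>M count_space UNIV" unfolding R_def by measurable
  have "distr M (count_space UNIV) R = measure_pmf (geometric_pmf q)"
  proof (rule measure_eqI_countable[of _ UNIV])
    fix j :: nat
    \<comment> \<open>By truncated subtraction \<open>R\<close> is 0 also where
      \<open>visits X\<close> is 0, so the two events agree only almost surely.\<close>
    have "prob (R -` {j} \<inter> space M) = prob {\<omega> \<in> space M. visits X \<omega> = Suc j}"
      using AE_visits_pos by (intro finite_measure_eq_AE) (auto simp: R_def visits_event elim!: eventually_mono)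
    then show "emeasure (distr M (count_space UNIV) R) {j} = emeasure (measure_pmf (geometric_pmf q)) {j}"
      using q_bounds by (simp add: emeasure_distr emeasure_eq_measure prob_visits emeasure_pmf_single mult.commute)
  qed auto
  then have "expectation (\<lambda>\<omega>. z ^ R \<omega>) = geo_pgf z"
    by (metis \<open>R \<in> M \<rightarrow>\<^sub>M count_space UNIV\<close> borel_measurable_count_space integral_distr)
  then show "expectation (\<lambda>\<omega>. z ^ (visits X \<omega> - 1)) = geo_pgf z"
    by (simp add: R_def)
  have "(\<lambda>\<omega>. z ^ R \<omega>) \<in> borel_measurable M" by measurable
  then show "(\<lambda>\<omega>. z ^ (visits X \<omega> - 1)) \<in> borel_measurable M" by (simp add: R_def)
qed

text \<open>With \<open>g = geo_pgf z\<close> the shifted law has generating function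
  \<open>z * g\<close>, and both sides agree by \<open>g * (1 - (1 - q) * z) = q\<close>. The left
  side is the contribution of a time to the average along the walk, the right side belongs to the
  exponent of the compound Poisson process.\<close>

lemma geometric_pgf:
  assumes z: "0 < z" "z \<le> (1::real)"
  shows "(1 - z) * geo_pgf z = q * (1 - (\<integral>k. z ^ k \<partial>measure_pmf (map_pmf Suc (geometric_pmf q))))"
proof -
  define g where "g = geo_pgf z"
  have S: "(\<integral>k. z ^ k \<partial>measure_pmf (map_pmf Suc (geometric_pmf q))) = z * g" by (simp add: g_def)
  have zq: "0 \<le> (1 - q) * z" "(1 - q) * z < 1"
    using q_bounds z mult_mono[of "1 - q" "1 - q" z 1] by auto
  have s: "(\<lambda>k. pmf (geometric_pmf q) k *\<^sub>R z ^ k) sums (q * (1 / (1 - (1 - q) * z)))"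
    using sums_mult[OF geometric_sums[of "(1 - q) * z"], of q] zq q_bounds
    by (simp add: power_mult_distrib mult_ac)
  moreover have "norm (pmf (geometric_pmf q) k *\<^sub>R z ^ k) = pmf (geometric_pmf q) k *\<^sub>R z ^ k" for k
    using z by (simp add: abs_mult)
  ultimately have "g = q * (1 / (1 - (1 - q) * z))"
    unfolding g_def using integral_pmf_nat[of "geometric_pmf q" "\<lambda>k. z ^ k"] sums_unique[OF s] sums_summable[OF s]
    by simp
  then have "g * (1 - (1 - q) * z) = q" using zq by simp
  then show ?thesis unfolding S g_def[symmetric] by (simp add: algebra_simps)
qed

end

section \<open>Time averages along the walk\<close>

text \<open>Term \<open>i\<close> is the product over the elements after \<open>i\<close> minus the
  product over those from \<open>i\<close> on. Keeping later rather than earlier elements makes the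
  term of a time a function of the future of the walk.\<close>

lemma one_minus_prod_telescope:
  fixes z :: "nat \<Rightarrow> real"
  assumes "finite A"
  shows "1 - (\<Prod>i\<in>A. z i) = (\<Sum>i\<in>A. (1 - z i) * (\<Prod>j\<in>{j \<in> A. i < j}. z j))"
  using assms
proof (induction A rule: finite_linorder_min_induct)
  case (insert b A)
  have 1: "{j \<in> insert b A. b < j} = A" using insert.hyps(2) by auto
  have 2: "{j \<in> insert b A. i < j} = {j \<in> A. i < j}" if "i \<in> A" for i
    using insert.hyps(2) that by auto
  have "b \<notin> A" using insert.hyps(2) by auto
  then have "(\<Sum>i\<in>insert b A. (1 - z i) * (\<Prod>j\<in>{j \<in> insert b A. i < j}. z j)) =
      (1 - z b) * (\<Prod>j\<in>A. z j) + (\<Sum>i\<in>A. (1 - z i) * (\<Prod>j\<in>{j \<in> A. i < j}. z j))"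
    using insert.hyps(1) 1 2 by simp
  also have "\<dots> = 1 - (\<Prod>i\<in>insert b A. z i)"
    using insert.hyps(1) \<open>b \<notin> A\<close> insert.IH[symmetric] by (simp add: algebra_simps)
  finally show ?case by simp
qed simp

definition cell :: "nat \<Rightarrow> nat \<Rightarrow> nat \<Rightarrow> nat" where
  "cell m n i = m * i div n"

lemma cell_le: "i \<le> n \<Longrightarrow> cell m n i \<le> m"
  unfolding cell_def by (metis div_le_mono div_mult_self_is_m bot_nat_0.not_eq_extremum div_by_0 le0 mult_le_mono2)

lemma cell_mono: "i \<le> j \<Longrightarrow> cell m n i \<le> cell m n j"
  unfolding cell_def by (intro div_le_mono mult_le_mono2)

lemma grid_point_eq_cell: "n > 0 \<Longrightarrow> grid_point m (real i / real n) = cell m n i"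
  unfolding grid_point_def cell_def
  using floor_divide_of_nat_eq[of "m * i" n, where ?'a = real] by simp

text \<open>The times in cell \<open>l\<close> are the integers of the half-open interval from
  \<open>l * n / m\<close> to \<open>(l + 1) * n / m\<close>, and their number differs from its
  length by at most 1.\<close>

lemma card_cell:
  assumes "n > 0" "l < m"
  shows "\<bar>real (card {i \<in> {..n}. cell m n i = l}) - real n / real m\<bar> \<le> 1"
proof -
  define y where "y k = real k * real n / real m" for k
  have "{i \<in> {..n}. cell m n i = l} = {nat \<lceil>y l\<rceil>..<nat \<lceil>y (Suc l)\<rceil>}"
  proof (intro set_eqI)
    fix i
    have m: "real m > 0" using assms by simp
    have ge: "real k * real n \<le> real m * real i \<longleftrightarrow> nat \<lceil>y k\<rceil> \<le> i" for k
      using m by (simp add: y_def pos_divide_le_eq nat_le_iff ceiling_le_iff mult.commute)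
    have "cell m n i = l \<longleftrightarrow> l * n \<le> m * i \<and> m * i < Suc l * n"
      using assms(1) unfolding cell_def by (metis div_nat_eqI dividend_less_div_times div_times_less_eq_dividend mult.commute mult_Suc_right add.commute mult_Suc)
    also have "\<dots> \<longleftrightarrow> real l * real n \<le> real m * real i \<and> \<not> real (Suc l) * real n \<le> real m * real i"
      by (metis not_le of_nat_le_iff of_nat_mult)
    finally have *: "cell m n i = l \<longleftrightarrow> nat \<lceil>y l\<rceil> \<le> i \<and> i < nat \<lceil>y (Suc l)\<rceil>"
      unfolding ge by (simp only: not_le)
    have "i \<le> n" if "i < nat \<lceil>y (Suc l)\<rceil>"
    proof -
      have "real (Suc l) * real n \<le> real m * real n"
        using assms(2) by (intro mult_right_mono) (simp_all only: of_nat_le_iff Suc_le_eq of_nat_0_le_iff)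
      then have "y (Suc l) \<le> real n" using m unfolding y_def by (simp only: pos_divide_le_eq mult.commute)
      then show ?thesis using that by linarith
    qed
    then show "i \<in> {i \<in> {..n}. cell m n i = l} \<longleftrightarrow> i \<in> {nat \<lceil>y l\<rceil>..<nat \<lceil>y (Suc l)\<rceil>}" using * by auto
  qed
  then have card: "card {i \<in> {..n}. cell m n i = l} = nat \<lceil>y (Suc l)\<rceil> - nat \<lceil>y l\<rceil>" by simp
  have y: "y (Suc l) = y l + real n / real m" "y l \<ge> 0" "real n / real m \<ge> 0"
    by (simp_all add: y_def add_divide_distrib distrib_right)
  then show ?thesis unfolding card by linarith
qed

text \<open>The limit retains only \<open>l < m\<close>: for \<open>n > 0\<close>, cell
  \<open>m\<close> contains at most the time \<open>n\<close>, which disappears after division by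
  \<open>n\<close>. This agrees with the range of the sum in
  \<open>pgf_grid_count_\<Psi>\<close>.\<close>

lemma cell_average_tendsto:
  fixes a :: "nat \<Rightarrow> real"
  assumes "m > 0"
  shows "(\<lambda>n. (\<Sum>i\<le>n. a (cell m n i)) / real n) \<longlonglongrightarrow> (\<Sum>l<m. a l) / real m"
proof -
  let ?N = "\<lambda>n l. real (card {i \<in> {..n}. cell m n i = l})"
  have N: "(\<lambda>n. ?N n l / real n) \<longlonglongrightarrow> 1 / real m" if "l < m" for l
  proof (rule LIM_zero_cancel, rule Lim_null_comparison)
    show "eventually (\<lambda>n. norm (?N n l / real n - 1 / real m) \<le> 1 / real n) sequentially"
      using eventually_gt_at_top[of 0]
    proof eventually_elim
      case (elim n)
      have "?N n l / real n - 1 / real m = (?N n l - real n / real m) / real n"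
        using elim assms by (simp add: field_simps)
      then show ?case using card_cell[OF elim that] elim by (simp add: divide_right_mono)
    qed
  qed (rule lim_1_over_n)
  have Nm: "(\<lambda>n. ?N n m / real n) \<longlonglongrightarrow> 0"
  proof (rule Lim_null_comparison)
    show "eventually (\<lambda>n. norm (?N n m / real n) \<le> 1 / real n) sequentially"
      using eventually_gt_at_top[of 0]
    proof eventually_elim
      case (elim n)
      have "{i \<in> {..n}. cell m n i = m} \<subseteq> {n}"
      proof safe
        fix i assume i: "i \<le> n" "cell m n i = m"
        then have "m * n \<le> m * i" unfolding cell_def by (metis div_times_less_eq_dividend)
        then show "i = n" using i assms by simp
      qed
      then have "card {i \<in> {..n}. cell m n i = m} \<le> 1" by (metis card_mono card.empty card_insert_disjoint empty_iff finite.emptyI finite_insert One_nat_def)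
      then show ?case by (simp add: divide_right_mono)
    qed
  qed (rule lim_1_over_n)
  have "(\<Sum>i\<le>n. a (cell m n i)) = (\<Sum>l\<le>m. ?N n l * a l)" for n
  proof -
    have "(\<Sum>i\<le>n. a (cell m n i)) = (\<Sum>l\<le>m. \<Sum>i\<in>{i \<in> {..n}. cell m n i = l}. a (cell m n i))"
      by (rule sum.group[symmetric]) (auto simp: cell_le)
    also have "\<dots> = (\<Sum>l\<le>m. ?N n l * a l)" by (intro sum.cong refl) simp
    finally show ?thesis .
  qed
  then have "(\<lambda>n. (\<Sum>i\<le>n. a (cell m n i)) / real n) = (\<lambda>n. (\<Sum>l<m. (?N n l / real n) * a l) + (?N n m / real n) * a m)"
    by (simp add: lessThan_Suc_atMost[symmetric] add_divide_distrib sum_divide_distrib)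
  moreover have "\<dots> \<longlonglongrightarrow> (\<Sum>l<m. 1 / real m * a l) + 0 * a m"
    by (intro tendsto_intros N Nm) simp
  ultimately show ?thesis by (simp add: sum_divide_distrib)
qed

text \<open>The window of \<open>T\<close> steps after such a time leaves the horizon or meets a
  cell boundary. As \<open>cell\<close> is monotone, comparing the two ends of the window
  suffices.\<close>

definition bad_times :: "nat \<Rightarrow> nat \<Rightarrow> nat \<Rightarrow> nat set" where
  "bad_times m n T = {i \<in> {..n}. n < i + T \<or> cell m n (i + T) \<noteq> cell m n i}"

text \<open>A bad time lies within \<open>T\<close> steps before the horizon or before one of the
  jumps \<open>D\<close> of the cell index, and a monotone index bounded by \<open>m\<close> has at
  most \<open>m\<close> jumps. The bound does not involve \<open>n\<close>, so bad times vanish in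
  the average.\<close>

lemma card_bad_times: "card (bad_times m n T) \<le> (m + 1) * T"
proof -
  define D where "D = {d \<in> {..<n}. cell m n d < cell m n (Suc d)}"
  have "inj_on (cell m n) D"
  proof (rule linorder_inj_onI')
    fix d d' assume "d \<in> D" "d' \<in> D" "d < d'"
    then have "cell m n d < cell m n (Suc d)" "cell m n (Suc d) \<le> cell m n d'"
      by (auto simp: D_def intro: cell_mono)
    then show "cell m n d \<noteq> cell m n d'" by simp
  qed
  moreover have "cell m n ` D \<subseteq> {..<m}"
  proof safe
    fix d assume "d \<in> D"
    then have "cell m n d < cell m n (Suc d)" "cell m n (Suc d) \<le> m"
      by (auto simp: D_def intro: cell_le)
    then show "cell m n d < m" by simp
  qed
  ultimately have D: "card D \<le> m" using card_inj_on_le[of "cell m n" D "{..<m}"] by simp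
  \<comment> \<open>\<open>{Suc d - T..d}\<close> collects the times \<open>i \<le> d\<close> with
    \<open>d < i + T\<close>; it has at most \<open>T\<close> elements also where the subtraction
    truncates.\<close>
  have "bad_times m n T \<subseteq> (\<Union>d\<in>insert n D. {Suc d - T..d})"
  proof
    fix i assume i: "i \<in> bad_times m n T"
    show "i \<in> (\<Union>d\<in>insert n D. {Suc d - T..d})"
    proof (cases "n < i + T")
      case True
      then show ?thesis using i by (auto simp: bad_times_def)
    next
      case False
      have "\<exists>d. i \<le> d \<and> d < i + T \<and> cell m n d < cell m n (Suc d)"
      proof (rule ccontr)
        assume *: "\<not> ?thesis"
        have "cell m n (i + k) = cell m n i" if "k \<le> T" for k
          using that
        proof (induction k)
          case (Suc k)
          have "i \<le> i + k" "i + k < i + T" using Suc.prems by auto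
          with * have "\<not> cell m n (i + k) < cell m n (Suc (i + k))" by blast
          moreover have "cell m n (i + k) \<le> cell m n (Suc (i + k))" by (rule cell_mono) simp
          ultimately show ?case using Suc by simp
        qed simp
        from this[of T] show False using i False by (simp add: bad_times_def)
      qed
      then obtain d where "i \<le> d" "d < i + T" "cell m n d < cell m n (Suc d)" by auto
      moreover from this False have "d \<in> D" by (auto simp: D_def)
      ultimately show ?thesis by (auto intro!: bexI[of _ d])
    qed
  qed
  moreover have fin: "finite (insert n D)" by (simp add: D_def)
  ultimately have "card (bad_times m n T) \<le> card (\<Union>d\<in>insert n D. {Suc d - T..d})"
    by (intro card_mono) auto
  also have "\<dots> \<le> (\<Sum>d\<in>insert n D. card {Suc d - T..d})" by (rule card_UN_le[OF fin])
  also have "\<dots> \<le> card (insert n D) * T" by (rule sum_bounded_above[where 'a=nat, simplified]) auto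
  also have "\<dots> \<le> (m + 1) * T" using D card_insert_le_m1[of "m + 1" D n] by (intro mult_le_mono1) auto
  finally show ?thesis .
qed

definition returns :: "nat \<Rightarrow> (nat \<Rightarrow> int) \<Rightarrow> nat" where
  "returns T w = card {j \<in> {1..T}. pos w j = 0}"

section \<open>Local approximation of the sum over sites\<close>

context biased_walk begin

lemma measurable_returns_PiM:
  "{1..T} \<subseteq> I \<Longrightarrow> returns T \<in> PiM I (\<lambda>_. count_space UNIV) \<rightarrow>\<^sub>M count_space UNIV"
  unfolding returns_def by (intro measurable_card_zeros measurable_pos_PiM) auto

lemma measurable_returns [measurable]: "returns T \<in> path_space \<rightarrow>\<^sub>M count_space UNIV"
  unfolding path_space_def by (rule measurable_returns_PiM) auto

text \<open>The first variable uses the increments \<open>i + 1\<close> to \<open>i + T\<close>, the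
  second those after \<open>j\<close>. Truncating at the earlier of the two times is enough for
  independence.\<close>

lemma indep_blocks:
  assumes "i + T \<le> j"
  shows "indep_var (PiM {1..T} (\<lambda>_. count_space UNIV)) (\<lambda>\<omega>. \<lambda>k\<in>{1..T}. X (i + k) \<omega>) path_space (future j)"
proof -
  have ind: "indep_var (PiM {i<..i+T} (\<lambda>_. count_space UNIV)) (\<lambda>\<omega>. restrict (\<lambda>k. X k \<omega>) {i<..i+T})
      (PiM {j<..} (\<lambda>_. count_space UNIV)) (\<lambda>\<omega>. restrict (\<lambda>k. X k \<omega>) {j<..})"
    by (rule indep_var_restrict[OF X_indep]) (use assms in auto)
  let ?s = "\<lambda>v :: nat \<Rightarrow> int. \<lambda>k\<in>{1..T}. v (i + k)" and ?t = "\<lambda>v :: nat \<Rightarrow> int. \<lambda>k\<in>{1..}. v (j + k)"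
  have "indep_var (PiM {1..T} (\<lambda>_. count_space UNIV)) (?s \<circ> (\<lambda>\<omega>. restrict (\<lambda>k. X k \<omega>) {i<..i+T}))
      path_space (?t \<circ> (\<lambda>\<omega>. restrict (\<lambda>k. X k \<omega>) {j<..}))"
    unfolding path_space_def
    by (rule indep_var_compose[OF ind]; intro measurable_restrict measurable_component_singleton) auto
  also have "?s \<circ> (\<lambda>\<omega>. restrict (\<lambda>k. X k \<omega>) {i<..i+T}) = (\<lambda>\<omega>. \<lambda>k\<in>{1..T}. X (i + k) \<omega>)"
    by (auto simp: fun_eq_iff)
  also have "?t \<circ> (\<lambda>\<omega>. restrict (\<lambda>k. X k \<omega>) {j<..}) = future j"
    by (auto simp: fun_eq_iff future_def)
  finally show ?thesis .
qed

lemma returns_block: "returns T (\<lambda>k\<in>{1..T}. X (i + k) \<omega>) = returns T (future i \<omega>)"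
proof -
  have "pos (\<lambda>k\<in>{1..T}. X (i + k) \<omega>) j = pos (future i \<omega>) j" if "j \<le> T" for j
    unfolding pos_def future_def using that by (intro sum.cong) auto
  then have "{j \<in> {1..T}. pos (\<lambda>k\<in>{1..T}. X (i + k) \<omega>) j = 0} = {j \<in> {1..T}. pos (future i \<omega>) j = 0}" by auto
  then show ?thesis by (simp add: returns_def)
qed

text \<open>Without a return after \<open>T\<close> the two exponents agree; otherwise the powers,
  both in the unit interval, differ by at most 1. Visits include time 0 and returns do not, which
  explains the exponent \<open>visits X \<omega> - 1\<close>.\<close>

lemma expectation_returns_limit:
  assumes z: "0 < z" "z \<le> (1::real)"
  shows "\<bar>expectation (\<lambda>\<omega>. z ^ returns T (future i \<omega>)) - geo_pgf z\<bar> \<le> late_return T"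
proof -
  let ?L = "{\<omega> \<in> space M. \<exists>j>T. walk X j \<omega> = 0}"
  have pw: "0 \<le> z ^ k" "z ^ k \<le> 1" for k using z by (auto simp: power_le_one)
  note [measurable] = expectation_visits(1)[OF z] expectation_visits(1)[OF z, simplified]
  have int: "integrable M (\<lambda>\<omega>. z ^ returns T (future 0 \<omega>))" "integrable M (\<lambda>\<omega>. z ^ (visits X \<omega> - 1))"
    by (rule integrable_const_bound[of _ 1]; use pw in auto)+
  have L: "?L \<in> events" by measurable
  have "expectation (\<lambda>\<omega>. z ^ returns T (future i \<omega>)) = expectation (\<lambda>\<omega>. z ^ returns T (future 0 \<omega>))"
    by (rule expectation_future) measurable
  then have "\<bar>expectation (\<lambda>\<omega>. z ^ returns T (future i \<omega>)) - geo_pgf z\<bar> =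
      \<bar>expectation (\<lambda>\<omega>. z ^ returns T (future 0 \<omega>) - z ^ (visits X \<omega> - 1))\<bar>"
    using int by (simp add: expectation_visits(2)[OF z] expectation_visits(2)[OF z, simplified])
  also have "\<dots> \<le> expectation (\<lambda>\<omega>. \<bar>z ^ returns T (future 0 \<omega>) - z ^ (visits X \<omega> - 1)\<bar>)"
    by (rule integral_abs_bound)
  also have "\<dots> \<le> expectation (indicator ?L)"
  proof (rule integral_mono)
    fix \<omega> assume \<omega>: "\<omega> \<in> space M"
    show "\<bar>z ^ returns T (future 0 \<omega>) - z ^ (visits X \<omega> - 1)\<bar> \<le> indicator ?L \<omega>"
    proof (cases "\<omega> \<in> ?L")
      case True
      then show ?thesis using pw[of "returns T (future 0 \<omega>)"] pw[of "visits X \<omega> - 1"] by (simp add: abs_le_iff)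
    next
      case False
      then have no: "walk X j \<omega> \<noteq> 0" if "j > T" for j using \<omega> that by auto
      have "{i. walk X i \<omega> = 0} = insert 0 {j \<in> {1..T}. pos (future 0 \<omega>) j = 0}"
        using no by (auto simp: walk_eq_pos[symmetric] not_less Suc_le_eq) (auto simp: walk_def intro: leI)
      then have "visits X \<omega> - 1 = returns T (future 0 \<omega>)" by (simp add: visits_def returns_def)
      then show ?thesis by simp
    qed
  qed (use int L in \<open>auto intro!: integrable_real_indicator simp: emeasure_eq_measure\<close>)
  also have "\<dots> = late_return T" using L by (simp add: late_return_def)
  finally show ?thesis .
qed

context
  fixes m :: nat and z :: "nat \<Rightarrow> real"
  assumes m: "m > 0" and z: "\<And>l. 0 < z l \<and> z l \<le> 1"
begin

text \<open>The contribution of time \<open>i\<close> to the sum over sites, by \<open>one_minus_prod_telescope\<close>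
  applied to the set of visits to the site \<open>walk X i\<close>.\<close>

definition site_term :: "nat \<Rightarrow> nat \<Rightarrow> 'a \<Rightarrow> real" where
  "site_term n i \<omega> = (1 - z (cell m n i)) *
     (\<Prod>j\<in>{j \<in> {..n}. i < j \<and> walk X j \<omega> = walk X i \<omega>}. z (cell m n j))"

text \<open>The approximation of finite range: only returns within \<open>T\<close> steps count, and
  each contributes the value of \<open>z\<close> at the cell of \<open>i\<close> itself. Hence it is
  a function of the increments \<open>i + 1\<close> to \<open>i + T\<close>.\<close>

definition local_term :: "nat \<Rightarrow> nat \<Rightarrow> nat \<Rightarrow> 'a \<Rightarrow> real" where
  "local_term T n i \<omega> = (1 - z (cell m n i)) * z (cell m n i) ^ returns T (future i \<omega>)"

lemma site_term_range: "0 \<le> site_term n i \<omega>" "site_term n i \<omega> \<le> 1"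
proof -
  have "0 \<le> 1 - z (cell m n i)" "1 - z (cell m n i) \<le> 1" using z[of "cell m n i"] by simp_all
  moreover have "0 \<le> (\<Prod>j\<in>S. z (cell m n j))" "(\<Prod>j\<in>S. z (cell m n j)) \<le> 1" for S
    using z by (auto intro!: prod_nonneg prod_le_1 simp: less_imp_le)
  ultimately show "0 \<le> site_term n i \<omega>" "site_term n i \<omega> \<le> 1"
    unfolding site_term_def by (auto intro: mult_le_one)
qed

lemma local_term_range: "0 \<le> local_term T n i \<omega>" "local_term T n i \<omega> \<le> 1"
  unfolding local_term_def using z[of "cell m n i"]
  by (auto intro!: mult_le_one mult_nonneg_nonneg power_le_one)

lemma measurable_site_term [measurable]: "site_term n i \<in> borel_measurable M"
proof -
  have eq: "(\<Prod>j\<in>{j \<in> {..n}. i < j \<and> walk X j \<omega> = walk X i \<omega>}. z (cell m n j)) =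
      (\<Prod>j\<le>n. if i < j \<and> walk X j \<omega> = walk X i \<omega> then z (cell m n j) else 1)" for \<omega>
    by (rule prod.inter_filter) simp
  show ?thesis unfolding site_term_def eq by measurable
qed

lemma measurable_local_term [measurable]: "local_term T n i \<in> borel_measurable M"
  unfolding local_term_def by measurable

text \<open>In the absence of late returns all later visits fall into the window of length
  \<open>T\<close>, and after a time that is not bad the cell index is constant on this
  window.\<close>

lemma site_term_eq_local_term:
  assumes "i \<le> n" "i \<notin> bad_times m n T" "\<not> (\<exists>s>i+T. walk X s \<omega> = walk X i \<omega>)"
  shows "site_term n i \<omega> = local_term T n i \<omega>"
proof -
  have good: "i + T \<le> n" "cell m n (i + T) = cell m n i"
    using assms(1,2) by (auto simp: bad_times_def)
  let ?S = "{j \<in> {1..T}. pos (future i \<omega>) j = 0}"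
  have S: "{j \<in> {..n}. i < j \<and> walk X j \<omega> = walk X i \<omega>} = (\<lambda>k. i + k) ` ?S"
  proof (intro equalityI subsetI)
    fix j assume j: "j \<in> {j \<in> {..n}. i < j \<and> walk X j \<omega> = walk X i \<omega>}"
    then have "j \<le> i + T" using assms(3) by (auto simp: not_less[symmetric])
    then have "j - i \<in> ?S" "j = i + (j - i)" using j by (auto simp: pos_future)
    then show "j \<in> (\<lambda>k. i + k) ` ?S" by blast
  qed (use good(1) in \<open>auto simp: pos_future\<close>)
  have "(\<Prod>j\<in>{j \<in> {..n}. i < j \<and> walk X j \<omega> = walk X i \<omega>}. z (cell m n j)) = (\<Prod>k\<in>?S. z (cell m n (i + k)))"
    unfolding S by (subst prod.reindex) auto
  also have "\<dots> = (\<Prod>k\<in>?S. z (cell m n i))"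
  proof (rule prod.cong[OF refl])
    fix k assume "k \<in> ?S"
    then have "cell m n i \<le> cell m n (i + k)" "cell m n (i + k) \<le> cell m n (i + T)"
      by (auto intro!: cell_mono)
    then show "z (cell m n (i + k)) = z (cell m n i)" using good(2) by simp
  qed
  finally show ?thesis unfolding site_term_def local_term_def returns_def by simp
qed

lemma expectation_site_local:
  assumes "i \<le> n"
  shows "expectation (\<lambda>\<omega>. \<bar>site_term n i \<omega> - local_term T n i \<omega>\<bar>) \<le> of_bool (i \<in> bad_times m n T) + late_return T"
proof -
  let ?L = "{\<omega> \<in> space M. \<exists>s>i+T. walk X s \<omega> = walk X i \<omega>}"
  have L: "?L \<in> events" by measurable
  have "expectation (\<lambda>\<omega>. \<bar>site_term n i \<omega> - local_term T n i \<omega>\<bar>) \<le> expectation (\<lambda>\<omega>. of_bool (i \<in> bad_times m n T) + indicator ?L \<omega>)"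
  proof (rule integral_mono)
    have le1: "\<bar>site_term n i \<omega> - local_term T n i \<omega>\<bar> \<le> 1" for \<omega>
      using site_term_range[of n i \<omega>] local_term_range[of T n i \<omega>] by (simp add: abs_le_iff)
    show "integrable M (\<lambda>\<omega>. \<bar>site_term n i \<omega> - local_term T n i \<omega>\<bar>)"
      using le1 by (intro integrable_const_bound[of _ 1]) auto
    fix \<omega> assume \<omega>: "\<omega> \<in> space M"
    show "\<bar>site_term n i \<omega> - local_term T n i \<omega>\<bar> \<le> of_bool (i \<in> bad_times m n T) + indicator ?L \<omega>"
    proof (cases "i \<in> bad_times m n T \<or> \<omega> \<in> ?L")
      case True
      then show ?thesis using le1[of \<omega>] by (auto simp: indicator_def)
    next
      case False
      then show ?thesis using site_term_eq_local_term[OF assms, of T \<omega>] \<omega> by auto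
    qed
  qed (use L in \<open>auto intro!: integrable_real_indicator simp: emeasure_eq_measure\<close>)
  also have "\<dots> = of_bool (i \<in> bad_times m n T) + late_return T"
    using L prob_future_late_return[of i T]
    by (subst Bochner_Integration.integral_add) (auto intro!: integrable_real_indicator simp: emeasure_eq_measure prob_space)
  finally show ?thesis .
qed

text \<open>Terms at distance at least \<open>T\<close> are independent and centered, so for each
  \<open>i\<close> at most \<open>2 * T\<close> mixed moments are nonzero and the second moment
  grows linearly in \<open>n\<close>. After division by \<open>n\<close> the fluctuation is of order
  \<open>1 / sqrt n\<close>.\<close>

lemma expectation_centered_sum:
  defines "C \<equiv> \<lambda>T n i \<omega>. local_term T n i \<omega> - expectation (local_term T n i)"
  shows "expectation (\<lambda>\<omega>. \<bar>\<Sum>i\<le>n. C T n i \<omega>\<bar>) \<le> sqrt (2 * real T * (real n + 1))"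
proof -
  have int_local: "integrable M (local_term T n i)" for i
    using local_term_range by (intro integrable_const_bound[of _ 1]) auto
  have E: "0 \<le> expectation (local_term T n i)" "expectation (local_term T n i) \<le> 1" for i
    using local_term_range integral_mono[OF int_local, of "\<lambda>_. 1" i]
    by (auto intro!: Bochner_Integration.integral_nonneg simp: prob_space)
  have C_bound: "\<bar>C T n i \<omega>\<bar> \<le> 1" for i \<omega>
    unfolding C_def using E[of i] local_term_range[of T n i \<omega>] by (simp add: abs_le_iff)
  have C_meas [measurable]: "C T n i \<in> borel_measurable M" for i unfolding C_def by measurable
  have CC_bound: "\<bar>C T n i \<omega> * C T n j \<omega>\<bar> \<le> 1" for i j \<omega>
    using C_bound by (simp add: abs_mult mult_le_one)
  have int: "integrable M (C T n i)" "integrable M (\<lambda>\<omega>. C T n i \<omega> * C T n j \<omega>)" for i j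
    using C_bound CC_bound by (auto intro!: integrable_const_bound[of _ 1])
  have C0: "expectation (C T n i) = 0" for i
    unfolding C_def using int_local by (simp add: prob_space)
  have indep: "expectation (\<lambda>\<omega>. C T n i \<omega> * C T n j \<omega>) = 0" if "i + T \<le> j" for i j
  proof -
    let ?f = "\<lambda>i w. (1 - z (cell m n i)) * z (cell m n i) ^ returns T w - expectation (local_term T n i)"
    let ?V = "\<lambda>\<omega>. \<lambda>k\<in>{1..T}. X (i + k) \<omega>"
    have [measurable]: "returns T \<in> PiM {1..T} (\<lambda>_. count_space UNIV) \<rightarrow>\<^sub>M count_space UNIV"
      by (rule measurable_returns_PiM) simp
    have "indep_var borel (?f i \<circ> ?V) borel (?f j \<circ> future j)"
      by (rule indep_var_compose[OF indep_blocks[OF that]]) measurable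
    moreover have "?f i \<circ> ?V = C T n i" "?f j \<circ> future j = C T n j"
      by (simp_all add: fun_eq_iff C_def local_term_def returns_block returns_block[simplified])
    ultimately have "indep_var borel (C T n i) borel (C T n j)" by simp
    from indep_var_lebesgue_integral[OF this int(1) int(1)] show ?thesis by (simp add: C0)
  qed
  have le: "expectation (\<lambda>\<omega>. C T n i \<omega> * C T n j \<omega>) \<le> of_bool (j < i + T \<and> i < j + T)" for i j
  proof (cases "j < i + T \<and> i < j + T")
    case True
    have "expectation (\<lambda>\<omega>. C T n i \<omega> * C T n j \<omega>) \<le> expectation (\<lambda>_. 1)"
      using CC_bound by (intro integral_mono int) (auto simp: abs_le_iff)
    then show ?thesis using True by (simp add: prob_space)
  next
    case False
    then have "expectation (\<lambda>\<omega>. C T n i \<omega> * C T n j \<omega>) = 0"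
      using indep[of i j] indep[of j i] by (auto simp: not_less mult.commute)
    then show ?thesis by simp
  qed
  define S where "S \<omega> = (\<Sum>i\<le>n. C T n i \<omega>)" for \<omega>
  have S2: "(S \<omega>)\<^sup>2 = (\<Sum>i\<le>n. \<Sum>j\<le>n. C T n i \<omega> * C T n j \<omega>)" for \<omega>
    unfolding S_def power2_eq_square by (rule sum_product)
  have int_S: "integrable M S" "integrable M (\<lambda>\<omega>. (S \<omega>)\<^sup>2)"
    unfolding S2 unfolding S_def by (intro Bochner_Integration.integrable_sum int)+
  have "expectation (\<lambda>\<omega>. (S \<omega>)\<^sup>2) = (\<Sum>i\<le>n. \<Sum>j\<le>n. expectation (\<lambda>\<omega>. C T n i \<omega> * C T n j \<omega>))"
    unfolding S2 using int by simp
  also have "\<dots> \<le> (\<Sum>i\<le>n. \<Sum>j\<le>n. of_bool (j < i + T \<and> i < j + T))" by (intro sum_mono le)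
  also have "\<dots> \<le> (\<Sum>i\<le>n. 2 * real T)"
  proof (rule sum_mono)
    fix i
    have "(\<Sum>j\<le>n. of_bool (j < i + T \<and> i < j + T)) = real (card {j \<in> {..n}. j < i + T \<and> i < j + T})"
      by (simp add: Collect_conj_eq[symmetric] Int_def)
    also have "{j \<in> {..n}. j < i + T \<and> i < j + T} \<subseteq> {Suc i - T..<i + T}" by auto
    then have "card {j \<in> {..n}. j < i + T \<and> i < j + T} \<le> card {Suc i - T..<i + T}" by (intro card_mono) auto
    then have "real (card {j \<in> {..n}. j < i + T \<and> i < j + T}) \<le> 2 * real T" by simp
    finally show "(\<Sum>j\<le>n. of_bool (j < i + T \<and> i < j + T)) \<le> 2 * real T" .
  qed
  also have "\<dots> = 2 * real T * (real n + 1)" by simp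
  finally have ES: "expectation (\<lambda>\<omega>. (S \<omega>)\<^sup>2) \<le> 2 * real T * (real n + 1)" .
  \<comment> \<open>Jensen's inequality for the square, in the form of a nonnegative variance of
    \<open>\<bar>S\<bar>\<close>.\<close>
  have "0 \<le> variance (\<lambda>\<omega>. \<bar>S \<omega>\<bar>)" by (rule variance_positive)
  also have "\<dots> = expectation (\<lambda>\<omega>. (S \<omega>)\<^sup>2) - (expectation (\<lambda>\<omega>. \<bar>S \<omega>\<bar>))\<^sup>2"
    using int_S by (subst variance_eq) auto
  finally have "(expectation (\<lambda>\<omega>. \<bar>S \<omega>\<bar>))\<^sup>2 \<le> 2 * real T * (real n + 1)" using ES by simp
  then show ?thesis unfolding S_def by (rule real_le_rsqrt)
qed

text \<open>By \<open>geometric_pgf\<close> this is \<open>q\<close> times the mean over the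
  \<open>m\<close> cells of \<open>1 - G (z l)\<close>, where \<open>G\<close> is the generating
  function of the cluster sizes.\<close>

definition limit_rate :: real where
  "limit_rate = (\<Sum>l<m. (1 - z l) * geo_pgf (z l)) / real m"

text \<open>The errors in order: late returns, once for replacing \<open>site_term\<close> by
  \<open>local_term\<close> and once for replacing the mean of the latter by its limit; bad times;
  the fluctuation of the local terms; the discrepancy between the average over times and the average
  over cells.\<close>

lemma expectation_site_average_le:
  assumes n: "n > 0"
  defines "a \<equiv> (\<Sum>i\<le>n. (1 - z (cell m n i)) * geo_pgf (z (cell m n i))) / real n"
  shows "expectation (\<lambda>\<omega>. \<bar>(\<Sum>i\<le>n. site_term n i \<omega>) / real n - limit_rate\<bar>) \<le>
    2 * late_return T * ((real n + 1) / real n) + real ((m + 1) * T) / real n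
      + sqrt (2 * real T * (real n + 1)) / real n + \<bar>a - limit_rate\<bar>"
proof -
  let ?E = "\<lambda>i. expectation (local_term T n i)"
  let ?g = "\<lambda>i. (1 - z (cell m n i)) * geo_pgf (z (cell m n i))"
  define D1 where "D1 \<omega> = (\<Sum>i\<le>n. \<bar>site_term n i \<omega> - local_term T n i \<omega>\<bar>)" for \<omega>
  define D2 where "D2 \<omega> = \<bar>\<Sum>i\<le>n. local_term T n i \<omega> - ?E i\<bar>" for \<omega>
  have int_local: "integrable M (local_term T n i)" for i
    using local_term_range by (intro integrable_const_bound[of _ 1]) auto
  have int_site: "integrable M (site_term n i)" for i
    using site_term_range by (intro integrable_const_bound[of _ 1]) auto
  have int1: "integrable M D1" and int2: "integrable M D2"
    unfolding D1_def D2_def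
    by (intro Bochner_Integration.integrable_sum integrable_abs Bochner_Integration.integrable_diff int_local int_site integrable_const)+
  have "\<bar>?E i - ?g i\<bar> \<le> late_return T" for i
  proof -
    have "?E i = (1 - z (cell m n i)) * expectation (\<lambda>\<omega>. z (cell m n i) ^ returns T (future i \<omega>))"
      unfolding local_term_def by simp
    then have "\<bar>?E i - ?g i\<bar> = (1 - z (cell m n i)) * \<bar>expectation (\<lambda>\<omega>. z (cell m n i) ^ returns T (future i \<omega>)) - geo_pgf (z (cell m n i))\<bar>"
      using z[of "cell m n i"] by (simp add: right_diff_distrib[symmetric] abs_mult)
    also have "\<dots> \<le> 1 * late_return T"
      using z[of "cell m n i"] by (intro mult_mono expectation_returns_limit) auto
    finally show ?thesis by simp
  qed
  then have "\<bar>\<Sum>i\<le>n. ?E i - ?g i\<bar> \<le> (\<Sum>i\<le>n. late_return T)"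
    by (intro order_trans[OF sum_abs] sum_mono)
  then have E: "\<bar>(\<Sum>i\<le>n. ?E i) - real n * a\<bar> \<le> (real n + 1) * late_return T"
    using n by (simp add: a_def sum_subtractf add.commute)
  have pt: "\<bar>(\<Sum>i\<le>n. site_term n i \<omega>) / real n - limit_rate\<bar> \<le>
      (D1 \<omega> + D2 \<omega> + (real n + 1) * late_return T) / real n + \<bar>a - limit_rate\<bar>" for \<omega>
  proof -
    have "\<bar>(\<Sum>i\<le>n. site_term n i \<omega>) - (\<Sum>i\<le>n. local_term T n i \<omega>)\<bar> \<le> D1 \<omega>"
      unfolding D1_def sum_subtractf[symmetric] by (rule sum_abs)
    moreover have "\<bar>(\<Sum>i\<le>n. local_term T n i \<omega>) - (\<Sum>i\<le>n. ?E i)\<bar> = D2 \<omega>"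
      unfolding D2_def sum_subtractf by simp
    ultimately have "\<bar>(\<Sum>i\<le>n. site_term n i \<omega>) - real n * a\<bar> \<le> D1 \<omega> + D2 \<omega> + (real n + 1) * late_return T"
      using E by linarith
    then have "\<bar>(\<Sum>i\<le>n. site_term n i \<omega>) - real n * a\<bar> / real n \<le> (D1 \<omega> + D2 \<omega> + (real n + 1) * late_return T) / real n"
      by (rule divide_right_mono) simp
    moreover have "\<bar>(\<Sum>i\<le>n. site_term n i \<omega>) - real n * a\<bar> / real n = \<bar>(\<Sum>i\<le>n. site_term n i \<omega>) / real n - a\<bar>"
    proof -
      have "(\<Sum>i\<le>n. site_term n i \<omega>) / real n - a = ((\<Sum>i\<le>n. site_term n i \<omega>) - real n * a) / real n"
        using n by (simp add: diff_divide_distrib)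
      then show ?thesis by (simp add: abs_divide)
    qed
    ultimately have le: "\<bar>(\<Sum>i\<le>n. site_term n i \<omega>) / real n - a\<bar> \<le> (D1 \<omega> + D2 \<omega> + (real n + 1) * late_return T) / real n"
      by (simp only:)
    have "\<bar>t - limit_rate\<bar> \<le> \<bar>t - a\<bar> + \<bar>a - limit_rate\<bar>" for t by linarith
    from order_trans[OF this add_right_mono[OF le]] show ?thesis .
  qed
  have E1: "expectation D1 \<le> real ((m + 1) * T) + (real n + 1) * late_return T"
  proof -
    have "expectation D1 = (\<Sum>i\<le>n. expectation (\<lambda>\<omega>. \<bar>site_term n i \<omega> - local_term T n i \<omega>\<bar>))"
      unfolding D1_def using int_site int_local by (intro Bochner_Integration.integral_sum) auto
    also have "\<dots> \<le> (\<Sum>i\<le>n. of_bool (i \<in> bad_times m n T) + late_return T)"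
      by (intro sum_mono expectation_site_local) auto
    also have "\<dots> = real (card ({..n} \<inter> bad_times m n T)) + (real n + 1) * late_return T"
      by (simp add: sum.distrib Int_def)
    also have "{..n} \<inter> bad_times m n T = bad_times m n T" by (auto simp: bad_times_def)
    also have "real (card (bad_times m n T)) \<le> real ((m + 1) * T)" using card_bad_times of_nat_le_iff by blast
    finally show ?thesis by simp
  qed
  have E2: "expectation D2 \<le> sqrt (2 * real T * (real n + 1))"
    unfolding D2_def by (rule expectation_centered_sum)
  have "expectation (\<lambda>\<omega>. \<bar>(\<Sum>i\<le>n. site_term n i \<omega>) / real n - limit_rate\<bar>) \<le>
      expectation (\<lambda>\<omega>. (D1 \<omega> + D2 \<omega> + (real n + 1) * late_return T) / real n + \<bar>a - limit_rate\<bar>)"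
    using pt int1 int2 int_site by (intro integral_mono) auto
  also have "\<dots> = (expectation D1 + expectation D2 + (real n + 1) * late_return T) / real n + \<bar>a - limit_rate\<bar>"
    using int1 int2 by (simp add: prob_space)
  also have "\<dots> \<le> ((real ((m + 1) * T) + (real n + 1) * late_return T) + sqrt (2 * real T * (real n + 1)) + (real n + 1) * late_return T) / real n + \<bar>a - limit_rate\<bar>"
    using E1 E2 by (intro add_mono divide_right_mono order_refl) auto
  also have "\<dots> = 2 * late_return T * ((real n + 1) / real n) + real ((m + 1) * T) / real n
      + sqrt (2 * real T * (real n + 1)) / real n + \<bar>a - limit_rate\<bar>"
    by (simp add: add_divide_distrib algebra_simps)
  finally show ?thesis .
qed

text \<open>The order of limits matters: \<open>n\<close> tends to infinity at fixed
  \<open>T\<close>, which leaves \<open>2 * late_return T\<close>, and this is small for a suitable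
  \<open>T\<close>.\<close>

lemma site_average_tendsto:
  "(\<lambda>n. expectation (\<lambda>\<omega>. \<bar>(\<Sum>i\<le>n. site_term n i \<omega>) / real n - limit_rate\<bar>)) \<longlonglongrightarrow> 0"
proof -
  define a where "a n = (\<Sum>i\<le>n. (1 - z (cell m n i)) * geo_pgf (z (cell m n i))) / real n" for n
  have "a \<longlonglongrightarrow> limit_rate"
    unfolding a_def[abs_def] limit_rate_def
    by (rule cell_average_tendsto[OF m, of "\<lambda>l. (1 - z l) * geo_pgf (z l)"])
  then have a: "(\<lambda>n. \<bar>a n - limit_rate\<bar>) \<longlonglongrightarrow> 0"
    by (intro tendsto_rabs_zero LIM_zero)
  define b where "b T n = 2 * late_return T * ((real n + 1) / real n) + real ((m + 1) * T) / real n
      + sqrt (2 * real T * (real n + 1)) / real n + \<bar>a n - limit_rate\<bar>" for T n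
  have b: "b T \<longlonglongrightarrow> 2 * late_return T * 1 + 0 + 0 + 0" for T
  proof -
    have "(\<lambda>n. (real n + 1) / real n) \<longlonglongrightarrow> 1" by real_asymp
    moreover have "(\<lambda>n. real ((m + 1) * T) / real n) \<longlonglongrightarrow> 0" by real_asymp
    moreover have "(\<lambda>n. sqrt (2 * real T * (real n + 1)) / real n) \<longlonglongrightarrow> 0"
    proof -
      have "(\<lambda>n. sqrt (2 * real T) * (sqrt (real n + 1) / real n)) \<longlonglongrightarrow> sqrt (2 * real T) * 0"
        by (intro tendsto_mult tendsto_const) real_asymp
      then show ?thesis by (simp add: real_sqrt_mult)
    qed
    ultimately show ?thesis unfolding b_def[abs_def] by (intro tendsto_intros a)
  qed
  show ?thesis
  proof (rule LIMSEQ_I)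
    fix e :: real assume "e > 0"
    then obtain T where T: "late_return T < e / 2"
      using order_tendstoD(2)[OF late_return_tendsto_0, of "e / 2"] eventually_happens'[OF sequentially_bot] by force
    then have "2 * late_return T * 1 + 0 + 0 + 0 < e" by simp
    from order_tendstoD(2)[OF b this] eventually_gt_at_top[of 0]
    have "eventually (\<lambda>n. norm (expectation (\<lambda>\<omega>. \<bar>(\<Sum>i\<le>n. site_term n i \<omega>) / real n - limit_rate\<bar>) - 0) < e) sequentially"
    proof eventually_elim
      case (elim n)
      have "0 \<le> expectation (\<lambda>\<omega>. \<bar>(\<Sum>i\<le>n. site_term n i \<omega>) / real n - limit_rate\<bar>)" by simp
      moreover have "expectation (\<lambda>\<omega>. \<bar>(\<Sum>i\<le>n. site_term n i \<omega>) / real n - limit_rate\<bar>) \<le> b T n"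
        unfolding b_def a_def by (rule expectation_site_average_le[OF elim(2)])
      ultimately show ?case using elim(1) by simp
    qed
    then show "\<exists>no. \<forall>n\<ge>no. norm (expectation (\<lambda>\<omega>. \<bar>(\<Sum>i\<le>n. site_term n i \<omega>) / real n - limit_rate\<bar>) - 0) < e"
      by (simp add: eventually_sequentially)
  qed
qed

end

end

section \<open>Exceedances along the walk\<close>

text \<open>Walk and scenery take values in different spaces, as \<open>indep_rv\<close> permits.
  Mapping both into one space makes the product rule for expectations applicable.\<close>

lemma (in prob_space) indep_var_of_indep_rv:
  assumes "indep_rv M A U B V" and f: "f \<in> A \<rightarrow>\<^sub>M N" and g: "g \<in> B \<rightarrow>\<^sub>M N"
  shows "indep_var N (\<lambda>\<omega>. f (U \<omega>)) N (\<lambda>\<omega>. g (V \<omega>))"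
proof -
  have U: "U \<in> M \<rightarrow>\<^sub>M A" and V: "V \<in> M \<rightarrow>\<^sub>M B"
    and ind: "indep_set {U -` a \<inter> space M | a. a \<in> sets A} {V -` b \<inter> space M | b. b \<in> sets B}"
    using assms(1) by (auto simp: indep_rv_def)
  have pre: "\<exists>a. (\<lambda>\<omega>. h (W \<omega>)) -` S \<inter> space M = W -` a \<inter> space M \<and> a \<in> sets C"
    if "W \<in> M \<rightarrow>\<^sub>M C" "h \<in> C \<rightarrow>\<^sub>M N" "S \<in> sets N" for W C h S
    using measurable_sets[OF that(2,3)] measurable_space[OF that(1)]
    by (intro exI[of _ "h -` S \<inter> space C"]) auto
  show ?thesis
    unfolding indep_var_def indep_vars_def2
  proof (intro conjI ballI)
    show "case_bool (\<lambda>\<omega>. f (U \<omega>)) (\<lambda>\<omega>. g (V \<omega>)) i \<in> M \<rightarrow>\<^sub>M case_bool N N i" for i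
      using measurable_compose[OF U f] measurable_compose[OF V g] by (cases i) auto
    show "indep_sets (\<lambda>i. {case_bool (\<lambda>\<omega>. f (U \<omega>)) (\<lambda>\<omega>. g (V \<omega>)) i -` S \<inter> space M | S. S \<in> sets (case_bool N N i)}) UNIV"
    proof (rule indep_sets_mono_sets[OF ind[unfolded indep_set_def]])
      fix i :: bool
      show "{case_bool (\<lambda>\<omega>. f (U \<omega>)) (\<lambda>\<omega>. g (V \<omega>)) i -` S \<inter> space M | S. S \<in> sets (case_bool N N i)}
         \<subseteq> case_bool {U -` a \<inter> space M | a. a \<in> sets A} {V -` b \<inter> space M | b. b \<in> sets B} i"
        using pre[OF U f] pre[OF V g] by (cases i) auto
    qed
  qed
qed

section \<open>Exponential estimates\<close>

lemma abs_exp_minus_diff_le: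
  fixes a b :: real
  assumes "a \<ge> 0" "b \<ge> 0"
  shows "\<bar>exp (- a) - exp (- b)\<bar> \<le> \<bar>a - b\<bar>"
proof -
  have *: "exp (- x) - exp (- y) \<le> y - x" if "0 \<le> x" "x \<le> y" for x y :: real
  proof -
    have "1 - exp (- (y - x)) \<le> y - x" using exp_ge_add_one_self[of "- (y - x)"] by linarith
    moreover have "exp (- x) - exp (- y) = exp (- x) * (1 - exp (- (y - x)))"
      by (simp add: right_diff_distrib exp_add[symmetric])
    moreover have "exp (- x) * (1 - exp (- (y - x))) \<le> 1 * (1 - exp (- (y - x)))"
      using that by (intro mult_right_mono) auto
    ultimately show ?thesis by (simp only: mult_1)
  qed
  show ?thesis
  proof (cases "a \<le> b")
    case True
    then have "exp (- b) \<le> exp (- a)" by simp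
    then show ?thesis using *[OF assms(1) True] True by simp
  next
    case False
    then have "exp (- a) \<le> exp (- b)" by simp
    then show ?thesis using *[OF assms(2), of a] False by simp
  qed
qed

lemma abs_one_minus_exp_le:
  fixes x :: real
  assumes "0 \<le> x"
  shows "\<bar>(1 - x) - exp (- x)\<bar> \<le> x\<^sup>2"
proof -
  have "1 - x \<le> exp (- x)" using exp_ge_add_one_self[of "- x"] by simp
  moreover have "exp (- x) \<le> 1 - x + x\<^sup>2"
  proof -
    \<comment> \<open>The right-hand side equals \<open>1 + x ^ 3\<close>.\<close>
    have "1 \<le> (1 - x + x\<^sup>2) * (1 + x)" using assms by (simp add: algebra_simps power2_eq_square)
    also have "\<dots> \<le> (1 - x + x\<^sup>2) * exp x"
    proof (rule mult_left_mono)
      have "(1 - x / 2)\<^sup>2 + 3 / 4 * x\<^sup>2 = 1 - x + x\<^sup>2" by (simp add: power2_eq_square algebra_simps)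
      then show "0 \<le> 1 - x + x\<^sup>2" by (metis add_nonneg_nonneg mult_nonneg_nonneg zero_le_power2 zero_le_divide_iff zero_le_numeral)
    qed (rule exp_ge_add_one_self_aux, use assms in simp)
    finally show ?thesis by (simp add: exp_minus field_simps)
  qed
  ultimately show ?thesis by (simp add: abs_le_iff)
qed

text \<open>For factors in the unit interval a difference of products is at most the sum of the
  differences, and each of these is of second order in \<open>r\<close>. With at most
  \<open>n + 1\<close> sites and \<open>r\<close> of order \<open>1 / n\<close> the error
  vanishes.\<close>

lemma prod_one_minus_exp:
  fixes b :: "'s \<Rightarrow> real"
  assumes "finite W" "\<And>s. s \<in> W \<Longrightarrow> 0 \<le> b s \<and> b s \<le> 1" "0 \<le> r" "r \<le> 1"
  shows "\<bar>(\<Prod>s\<in>W. 1 - r * b s) - exp (- (r * (\<Sum>s\<in>W. b s)))\<bar> \<le> real (card W) * r\<^sup>2"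
proof -
  have rb: "0 \<le> r * b s" "r * b s \<le> 1" "r * b s \<le> r" if "s \<in> W" for s
    using assms(2)[OF that] assms(3,4) mult_mono[of r 1 "b s" 1] mult_left_mono[of "b s" 1 r] by auto
  have "exp (- (r * (\<Sum>s\<in>W. b s))) = (\<Prod>s\<in>W. exp (- (r * b s)))"
    using assms(1) by (simp add: sum_distrib_left sum_negf[symmetric] exp_sum)
  then have "\<bar>(\<Prod>s\<in>W. 1 - r * b s) - exp (- (r * (\<Sum>s\<in>W. b s)))\<bar> \<le> (\<Sum>s\<in>W. \<bar>(1 - r * b s) - exp (- (r * b s))\<bar>)"
    using norm_prod_diff[of W "\<lambda>s. 1 - r * b s" "\<lambda>s. exp (- (r * b s))"] rb by simp
  also have "\<dots> \<le> (\<Sum>s\<in>W. r\<^sup>2)"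
  proof (rule sum_mono)
    fix s assume s: "s \<in> W"
    have "\<bar>(1 - r * b s) - exp (- (r * b s))\<bar> \<le> (r * b s)\<^sup>2" by (rule abs_one_minus_exp_le[OF rb(1)[OF s]])
    also have "\<dots> \<le> r\<^sup>2" using rb[OF s] by (intro power_mono) auto
    finally show "\<bar>(1 - r * b s) - exp (- (r * b s))\<bar> \<le> r\<^sup>2" .
  qed
  finally show ?thesis by simp
qed

lemma walk_restrict_eq_pos:
  "i \<le> n \<Longrightarrow> walk X i \<omega> = pos (\<lambda>k\<in>{1..n}. X k \<omega>) i"
  unfolding walk_def pos_def by (intro sum.cong) auto

section \<open>Integrating out the scenery\<close>

locale walk_in_scenery = biased_walk M X p for M :: "'a measure" and X p +
  fixes \<xi> :: "int \<Rightarrow> 'a \<Rightarrow> real" and u :: "nat \<Rightarrow> real" and \<tau> :: real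
  assumes xi_indep: "indep_vars (\<lambda>_. borel) \<xi> UNIV"
    and xi_ident: "\<And>s. distr M borel (\<xi> s) = distr M borel (\<xi> 0)"
    and xi_X_indep: "indep_rv M
          (\<Pi>\<^sub>M s\<in>UNIV. borel) (\<lambda>\<omega> s. \<xi> s \<omega>)
          (\<Pi>\<^sub>M i\<in>{1..}. count_space UNIV) (\<lambda>\<omega>. \<lambda>i\<in>{1..}. X i \<omega>)"
    and tau: "\<tau> > 0"
    and thresholds: "(\<lambda>n. real n * \<P>(\<omega> in M. \<xi> 0 \<omega> > u n)) \<longlonglongrightarrow> \<tau>"
begin

lemma measurable_xi [measurable]: "\<xi> s \<in> borel_measurable M"
  using xi_indep by (simp add: indep_vars_def2)

definition rate :: "nat \<Rightarrow> real" where "rate n = prob {\<omega> \<in> space M. \<xi> 0 \<omega> > u n}"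

lemma rate_range: "0 \<le> rate n" "rate n \<le> 1" by (simp_all add: rate_def)

lemma prob_xi_gt: "prob {\<omega> \<in> space M. \<xi> s \<omega> > u n} = rate n"
proof -
  have "prob {\<omega> \<in> space M. \<xi> s \<omega> > u n} = measure (distr M borel (\<xi> s)) {u n<..}" for s
    by (subst measure_distr) (auto intro!: arg_cong[where f = prob])
  then show ?thesis unfolding rate_def by (simp only: xi_ident[of s])
qed

text \<open>The path \<open>v\<close> is a separate argument, so that the scenery can be integrated
  out while the walk is frozen.\<close>

definition exceed_prod :: "nat \<Rightarrow> (nat \<Rightarrow> real) \<Rightarrow> (nat \<Rightarrow> int) \<Rightarrow> 'a \<Rightarrow> real" where
  "exceed_prod n y v \<omega> = (\<Prod>i\<le>n. if \<xi> (v i) \<omega> > u n then y i else 1)"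

definition site_prod :: "nat \<Rightarrow> (nat \<Rightarrow> real) \<Rightarrow> (nat \<Rightarrow> int) \<Rightarrow> real" where
  "site_prod n y v = (\<Prod>s\<in>v ` {..n}. 1 - rate n * (1 - (\<Prod>i\<in>{i \<in> {..n}. v i = s}. y i)))"

text \<open>All visits to a site see the same value of the scenery, so the product is grouped by
  sites, and different sites are independent. A site contributes \<open>1 - b s\<close> with
  probability \<open>rate n\<close> and 1 otherwise.\<close>

lemma expectation_fixed_path:
  assumes y: "\<And>i. 0 \<le> y i \<and> y i \<le> 1"
  shows "expectation (exceed_prod n y v) = site_prod n y v"
proof -
  define b where "b s = 1 - (\<Prod>i\<in>{i \<in> {..n}. v i = s}. y i)" for s
  define h where "h s t = (if t > u n then 1 - b s else 1)" for s and t :: real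
  have [measurable]: "h s \<in> borel_measurable borel" for s unfolding h_def by measurable
  have b: "0 \<le> 1 - b s" "1 - b s \<le> 1" for s
    unfolding b_def using y by (auto intro!: prod_nonneg prod_le_1)
  have "exceed_prod n y v \<omega> = (\<Prod>s\<in>v ` {..n}. h s (\<xi> s \<omega>))" for \<omega>
  proof -
    have "exceed_prod n y v \<omega> = (\<Prod>s\<in>v ` {..n}. \<Prod>i\<in>{i \<in> {..n}. v i = s}. if \<xi> (v i) \<omega> > u n then y i else 1)"
      unfolding exceed_prod_def by (rule prod.image_gen) simp
    also have "\<dots> = (\<Prod>s\<in>v ` {..n}. h s (\<xi> s \<omega>))"
    proof (rule prod.cong[OF refl])
      fix s
      have "(\<Prod>i\<in>{i \<in> {..n}. v i = s}. if \<xi> (v i) \<omega> > u n then y i else 1) = (\<Prod>i\<in>{i \<in> {..n}. v i = s}. if \<xi> s \<omega> > u n then y i else 1)"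
        by (intro prod.cong) auto
      then show "(\<Prod>i\<in>{i \<in> {..n}. v i = s}. if \<xi> (v i) \<omega> > u n then y i else 1) = h s (\<xi> s \<omega>)"
        by (simp add: h_def b_def)
    qed
    finally show ?thesis .
  qed
  then have "expectation (exceed_prod n y v) = expectation (\<lambda>\<omega>. \<Prod>s\<in>v ` {..n}. h s (\<xi> s \<omega>))"
    by (intro Bochner_Integration.integral_cong refl)
  also have "\<dots> = (\<Prod>s\<in>v ` {..n}. expectation (\<lambda>\<omega>. h s (\<xi> s \<omega>)))"
  proof (rule indep_vars_lebesgue_integral)
    show "indep_vars (\<lambda>_. borel) (\<lambda>s \<omega>. h s (\<xi> s \<omega>)) (v ` {..n})"
      by (rule indep_vars_compose2[OF indep_vars_subset[OF xi_indep]]) auto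
    show "integrable M (\<lambda>\<omega>. h s (\<xi> s \<omega>))" for s
      using b[of s] by (intro integrable_const_bound[of _ 1]) (auto simp: h_def)
  qed simp
  also have "\<dots> = (\<Prod>s\<in>v ` {..n}. 1 - rate n * b s)"
  proof (rule prod.cong[OF refl])
    fix s
    let ?E = "{\<omega> \<in> space M. \<xi> s \<omega> > u n}"
    have E: "?E \<in> events" by measurable
    have "expectation (\<lambda>\<omega>. h s (\<xi> s \<omega>)) = expectation (\<lambda>\<omega>. 1 - b s * indicator ?E \<omega>)"
      by (intro Bochner_Integration.integral_cong) (auto simp: h_def)
    also have "\<dots> = 1 - b s * prob ?E"
      using E by (subst Bochner_Integration.integral_diff)
        (auto intro!: integrable_mult_right integrable_real_indicator simp: emeasure_eq_measure prob_space)
    finally show "expectation (\<lambda>\<omega>. h s (\<xi> s \<omega>)) = 1 - rate n * b s" by (simp add: prob_xi_gt mult.commute)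
  qed
  finally show ?thesis by (simp add: site_prod_def b_def)
qed

text \<open>Only finitely many paths of length \<open>n\<close> have positive probability, so the walk
  can be fixed by summing over them.\<close>

lemma expectation_exceed_prod:
  assumes y: "\<And>i. 0 \<le> y i \<and> y i \<le> 1"
  shows "expectation (\<lambda>\<omega>. exceed_prod n y (\<lambda>i. walk X i \<omega>) \<omega>) = expectation (\<lambda>\<omega>. site_prod n y (\<lambda>i. walk X i \<omega>))"
    and "(\<lambda>\<omega>. site_prod n y (\<lambda>i. walk X i \<omega>)) \<in> borel_measurable M"
proof -
  define paths :: "(nat \<Rightarrow> int) set" where "paths = PiE {1..n} (\<lambda>_. {1, -1})"
  have fin: "finite paths" unfolding paths_def by (intro finite_PiE) auto
  define R where "R \<omega> = (\<lambda>k\<in>{1..n}. X k \<omega>)" for \<omega>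
  define E where "E w = {\<omega> \<in> space M. R \<omega> = w}" for w
  have E_eq: "E w = {\<omega> \<in> space M. \<forall>k\<in>{1..n}. X k \<omega> = w k}" if "w \<in> paths" for w
    using that unfolding E_def R_def paths_def by (auto simp: fun_eq_iff PiE_def extensional_def)
  have E [measurable]: "E w \<in> events" if "w \<in> paths" for w
    unfolding E_eq[OF that]
  proof (rule sets.sets_Collect_finite_All)
    fix k assume "k \<in> {1..n}"
    then have [measurable]: "X k \<in> M \<rightarrow>\<^sub>M count_space UNIV" by (intro measurable_X) auto
    show "{\<omega> \<in> space M. X k \<omega> = w k} \<in> events" by measurable
  qed simp
  have AE_R: "AE \<omega> in M. R \<omega> \<in> paths"
    using AE_step by eventually_elim (auto simp: R_def paths_def)
  have walk_R: "walk X i \<omega> = pos (R \<omega>) i" if "i \<le> n" for i \<omega>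
    unfolding R_def by (rule walk_restrict_eq_pos[OF that])
  let ?G = "exceed_prod n y" and ?V = "site_prod n y"
  have G_meas [measurable]: "?G v \<in> borel_measurable M" for v unfolding exceed_prod_def by measurable
  have G1: "\<bar>?G v \<omega>\<bar> \<le> 1" for v \<omega>
    unfolding exceed_prod_def using y by (intro abs_prod_le_one) auto
  have decomp: "AE \<omega> in M. f (R \<omega>) \<omega> = (\<Sum>w\<in>paths. indicator (E w) \<omega> * f w \<omega>)" for f :: "_ \<Rightarrow> _ \<Rightarrow> real"
    using AE_R AE_space
  proof eventually_elim
    case (elim \<omega>)
    have "(\<Sum>w\<in>paths. indicator (E w) \<omega> * f w \<omega>) = (\<Sum>w\<in>{R \<omega>}. indicator (E w) \<omega> * f w \<omega>)"
      using elim fin by (intro sum.mono_neutral_right) (auto simp: E_def)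
    then show ?case using elim by (simp add: E_def)
  qed
  have GR: "?G (\<lambda>i. walk X i \<omega>) \<omega> = ?G (pos (R \<omega>)) \<omega>" for \<omega>
    unfolding exceed_prod_def by (intro prod.cong refl) (simp add: walk_R)
  have VR: "?V (\<lambda>i. walk X i \<omega>) = ?V (pos (R \<omega>))" for \<omega>
  proof -
    have "(\<lambda>i. walk X i \<omega>) ` {..n} = pos (R \<omega>) ` {..n}" using walk_R by (intro image_cong) auto
    moreover have "{i \<in> {..n}. walk X i \<omega> = s} = {i \<in> {..n}. pos (R \<omega>) i = s}" for s using walk_R by auto
    ultimately show ?thesis unfolding site_prod_def by simp
  qed
  \<comment> \<open>\<open>site_prod\<close> involves the image of the path as an index set. The
    path restricted to \<open>{..n}\<close> has a countable range, so any function of it is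
    measurable.\<close>
  have walk_n: "(\<lambda>\<omega>. \<lambda>i\<in>{..n}. walk X i \<omega>) \<in> M \<rightarrow>\<^sub>M count_space UNIV"
  proof -
    have "countable (PiE {..n} (\<lambda>_. UNIV :: int set))" by (rule countable_PiE) auto
    then have "(\<lambda>\<omega>. \<lambda>i\<in>{..n}. walk X i \<omega>) \<in> M \<rightarrow>\<^sub>M count_space (PiE {..n} (\<lambda>_. UNIV))"
    proof (subst measurable_count_space_eq_countable, safe)
      fix w :: "nat \<Rightarrow> int" assume w: "w \<in> PiE {..n} (\<lambda>_. UNIV)"
      have "(\<lambda>\<omega>. \<lambda>i\<in>{..n}. walk X i \<omega>) -` {w} \<inter> space M = {\<omega> \<in> space M. \<forall>i\<in>{..n}. walk X i \<omega> = w i}"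
        using w by (auto simp: fun_eq_iff PiE_def extensional_def split: if_splits)
      also have "\<dots> \<in> events" by measurable
      finally show "(\<lambda>\<omega>. \<lambda>i\<in>{..n}. walk X i \<omega>) -` {w} \<inter> space M \<in> events" .
    qed (auto split: if_splits)
    then show ?thesis by (rule measurable_compose) simp
  qed
  show V_meas: "(\<lambda>\<omega>. ?V (\<lambda>i. walk X i \<omega>)) \<in> borel_measurable M"
  proof -
    have "?V (\<lambda>i. walk X i \<omega>) = ?V (\<lambda>i\<in>{..n}. walk X i \<omega>)" for \<omega>
    proof -
      have "(\<lambda>i\<in>{..n}. walk X i \<omega>) ` {..n} = (\<lambda>i. walk X i \<omega>) ` {..n}" by (intro image_cong) auto
      moreover have "{i \<in> {..n}. (\<lambda>i\<in>{..n}. walk X i \<omega>) i = s} = {i \<in> {..n}. walk X i \<omega> = s}" for s by auto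
      ultimately show ?thesis unfolding site_prod_def by simp
    qed
    then show ?thesis using measurable_compose[OF walk_n, of ?V borel] by simp
  qed
  have G_walk: "(\<lambda>\<omega>. ?G (\<lambda>i. walk X i \<omega>) \<omega>) \<in> borel_measurable M"
    unfolding exceed_prod_def
  proof (intro borel_measurable_prod)
    fix i
    have [measurable]: "(\<lambda>\<omega>. \<xi> (walk X i \<omega>) \<omega>) \<in> borel_measurable M"
      by (rule measurable_compose_countable[OF measurable_xi measurable_walk])
    show "(\<lambda>\<omega>. if \<xi> (walk X i \<omega>) \<omega> > u n then y i else 1) \<in> borel_measurable M" by measurable
  qed
  have split: "expectation (\<lambda>\<omega>. indicator (E w) \<omega> * ?G (pos w) \<omega>) = prob (E w) * ?V (pos w)" if w: "w \<in> paths" for w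
  proof -
    let ?P = "PiM {1..} (\<lambda>_. count_space (UNIV :: int set))"
    let ?f = "\<lambda>x :: int \<Rightarrow> real. \<Prod>i\<le>n. if x (pos w i) > u n then y i else 1"
    \<comment> \<open>The event \<open>E w\<close> is written as a function of the whole sequence of
      increments because \<open>xi_X_indep\<close> speaks about that sequence.\<close>
    let ?g = "\<lambda>v :: nat \<Rightarrow> int. indicator {v \<in> space ?P. \<forall>k\<in>{1..n}. v k = w k} v :: real"
    have g_set: "{v \<in> space ?P. \<forall>k\<in>{1..n}. v k = w k} \<in> sets ?P"
    proof (rule sets.sets_Collect_finite_All)
      fix k assume "k \<in> {1..n}"
      then have [measurable]: "(\<lambda>v. v k) \<in> ?P \<rightarrow>\<^sub>M count_space UNIV" by (intro measurable_component_singleton) auto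
      show "{v \<in> space ?P. v k = w k} \<in> sets ?P" by measurable
    qed simp
    have "indep_var borel (\<lambda>\<omega>. ?f (\<lambda>s. \<xi> s \<omega>)) borel (\<lambda>\<omega>. ?g (\<lambda>i\<in>{1..}. X i \<omega>))"
      by (rule indep_var_of_indep_rv[OF xi_X_indep]) (use g_set in measurable)
    then have ind: "indep_var borel (?G (pos w)) borel (\<lambda>\<omega>. ?g (\<lambda>i\<in>{1..}. X i \<omega>))"
      by (simp add: exceed_prod_def[abs_def])
    have gE: "?g (\<lambda>i\<in>{1..}. X i \<omega>) = indicator (E w) \<omega>" if "\<omega> \<in> space M" for \<omega>
      using that by (auto simp: E_eq[OF w] indicator_def space_PiM)
    have "integrable M (?G (pos w))" using G1 by (intro integrable_const_bound[of _ 1]) auto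
    moreover have "integrable M (\<lambda>\<omega>. ?g (\<lambda>i\<in>{1..}. X i \<omega>))"
      using indep_var_rv2[OF ind] by (intro integrable_const_bound[of _ 1]) (auto simp: indicator_def)
    ultimately have "expectation (\<lambda>\<omega>. ?G (pos w) \<omega> * ?g (\<lambda>i\<in>{1..}. X i \<omega>)) = expectation (?G (pos w)) * expectation (\<lambda>\<omega>. ?g (\<lambda>i\<in>{1..}. X i \<omega>))"
      by (intro indep_var_lebesgue_integral[OF ind])
    moreover have "expectation (\<lambda>\<omega>. ?G (pos w) \<omega> * ?g (\<lambda>i\<in>{1..}. X i \<omega>)) = expectation (\<lambda>\<omega>. indicator (E w) \<omega> * ?G (pos w) \<omega>)"
      by (intro Bochner_Integration.integral_cong refl) (simp only: gE mult.commute)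
    moreover have "expectation (\<lambda>\<omega>. ?g (\<lambda>i\<in>{1..}. X i \<omega>)) = expectation (indicator (E w))"
      by (intro Bochner_Integration.integral_cong refl) (simp only: gE)
    moreover have "expectation (?G (pos w)) = ?V (pos w)"
      by (rule expectation_fixed_path[OF y])
    ultimately show ?thesis using E[OF w] by (simp add: mult.commute)
  qed
  have int_E: "integrable M (indicator (E w) :: _ \<Rightarrow> real)" if "w \<in> paths" for w
    using E[OF that] by (simp add: integrable_real_indicator emeasure_eq_measure)
  have "expectation (\<lambda>\<omega>. ?G (\<lambda>i. walk X i \<omega>) \<omega>) = expectation (\<lambda>\<omega>. \<Sum>w\<in>paths. indicator (E w) \<omega> * ?G (pos w) \<omega>)"
  proof (rule integral_cong_AE)
    show "(\<lambda>\<omega>. ?G (\<lambda>i. walk X i \<omega>) \<omega>) \<in> borel_measurable M" by (rule G_walk)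
    show "(\<lambda>\<omega>. \<Sum>w\<in>paths. indicator (E w) \<omega> * ?G (pos w) \<omega>) \<in> borel_measurable M" by measurable
    show "AE \<omega> in M. ?G (\<lambda>i. walk X i \<omega>) \<omega> = (\<Sum>w\<in>paths. indicator (E w) \<omega> * ?G (pos w) \<omega>)"
      unfolding GR using decomp[of "\<lambda>w. ?G (pos w)"] .
  qed
  also have "\<dots> = (\<Sum>w\<in>paths. prob (E w) * ?V (pos w))"
  proof (subst Bochner_Integration.integral_sum)
    fix w assume "w \<in> paths"
    then show "integrable M (\<lambda>\<omega>. indicator (E w) \<omega> * ?G (pos w) \<omega>)"
      using G1 E by (intro integrable_const_bound[of _ 1]) (auto simp: indicator_def)
  qed (simp add: split)
  also have "\<dots> = expectation (\<lambda>\<omega>. \<Sum>w\<in>paths. indicator (E w) \<omega> * ?V (pos w))"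
    using int_E E by (subst Bochner_Integration.integral_sum) auto
  also have "\<dots> = expectation (\<lambda>\<omega>. ?V (\<lambda>i. walk X i \<omega>))"
  proof (rule integral_cong_AE)
    show "AE \<omega> in M. (\<Sum>w\<in>paths. indicator (E w) \<omega> * ?V (pos w)) = ?V (\<lambda>i. walk X i \<omega>)"
      unfolding VR using decomp[of "\<lambda>w _. ?V (pos w)"] by (auto elim: eventually_mono)
    show "(\<lambda>\<omega>. \<Sum>w\<in>paths. indicator (E w) \<omega> * ?V (pos w)) \<in> borel_measurable M" by measurable
  qed (rule V_meas)
  finally show "expectation (\<lambda>\<omega>. ?G (\<lambda>i. walk X i \<omega>) \<omega>) = expectation (\<lambda>\<omega>. ?V (\<lambda>i. walk X i \<omega>))" .
qed

lemma grid_count_exceedances: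
  assumes "n > 0"
  shows "grid_count m (exceedances X \<xi> u n \<omega>) l = (\<Sum>i\<le>n. of_bool (\<xi> (walk X i \<omega>) \<omega> > u n \<and> cell m n i = l))"
proof -
  have "grid_count m (exceedances X \<xi> u n \<omega>) l = card {i \<in> {i \<in> {0..n}. \<xi> (walk X i \<omega>) \<omega> > u n}. cell m n i = l}"
    unfolding grid_count_def exceedances_def
    by (simp add: filter_mset_image_mset grid_point_eq_cell[OF assms] filter_mset_mset_set size_mset_set)
  also have "\<dots> = card {i \<in> {..n}. \<xi> (walk X i \<omega>) \<omega> > u n \<and> cell m n i = l}"
    by (intro arg_cong[where f = card]) auto
  also have "\<dots> = (\<Sum>i\<le>n. of_bool (\<xi> (walk X i \<omega>) \<omega> > u n \<and> cell m n i = l))"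
    by (simp add: Int_def)
  finally show ?thesis .
qed

text \<open>The set of exceedance times takes finitely many values, so every \<open>g\<close> with
  values in \<open>space N\<close> is admissible. This serves the vague sigma-algebra and the cell
  counts at once.\<close>

lemma exceedances_measurable:
  assumes g: "\<And>S. g (image_mset (\<lambda>i. real i / real n) (mset_set S)) \<in> space N"
  shows "(\<lambda>\<omega>. g (exceedances X \<xi> u n \<omega>)) \<in> M \<rightarrow>\<^sub>M N"
proof -
  define S where "S \<omega> = {i \<in> {0..n}. \<xi> (walk X i \<omega>) \<omega> > u n}" for \<omega>
  have "S \<in> M \<rightarrow>\<^sub>M count_space (Pow {0..n})"
  proof (subst measurable_count_space_eq_countable, safe)
    fix A :: "nat set" assume A: "A \<subseteq> {0..n}"
    have "S -` {A} \<inter> space M = {\<omega> \<in> space M. \<forall>i\<in>{0..n}. \<xi> (walk X i \<omega>) \<omega> > u n \<longleftrightarrow> i \<in> A}"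
      using A unfolding S_def by (auto simp: set_eq_iff subset_iff)
    also have "\<dots> \<in> events"
    proof (rule sets.sets_Collect_finite_All)
      fix i
      have [measurable]: "(\<lambda>\<omega>. \<xi> (walk X i \<omega>) \<omega>) \<in> borel_measurable M"
        by (rule measurable_compose_countable[OF measurable_xi measurable_walk])
      show "{\<omega> \<in> space M. \<xi> (walk X i \<omega>) \<omega> > u n \<longleftrightarrow> i \<in> A} \<in> events" by measurable
    qed simp
    finally show "S -` {A} \<inter> space M \<in> events" .
  qed (auto simp: S_def countable_finite)
  then have "(\<lambda>\<omega>. g (image_mset (\<lambda>i. real i / real n) (mset_set (S \<omega>)))) \<in> M \<rightarrow>\<^sub>M N"
    by (rule measurable_compose) (use g in auto)
  then show ?thesis by (simp add: exceedances_def S_def)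
qed

lemma point_process_exceedances: "point_process M (exceedances X \<xi> u n)"
proof -
  have "exceedances X \<xi> u n \<in> M \<rightarrow>\<^sub>M vague_borel"
  proof -
    \<comment> \<open>\<open>exceedances_measurable\<close> asks for a valid value on every set
      \<open>S\<close> of times, so configurations that leave the unit interval are redirected to
      the empty one.\<close>
    define g where "g c = (if set_mset c \<subseteq> {0..1} then c else {#})" for c :: "real multiset"
    have "(\<lambda>\<omega>. g (exceedances X \<xi> u n \<omega>)) \<in> M \<rightarrow>\<^sub>M vague_borel"
      by (rule exceedances_measurable) (auto simp: g_def configs_def)
    \<comment> \<open>For \<open>n = 0\<close> the only time is 0 and \<open>0 / 0 = 0\<close>, so
      the interval is not left in this case either.\<close>
    moreover have "set_mset (exceedances X \<xi> u n \<omega>) \<subseteq> {0..1}" for \<omega>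
      unfolding exceedances_def by (auto simp: divide_le_eq_1)
    ultimately show ?thesis by (simp add: g_def)
  qed
  then show ?thesis by (simp add: point_process_def prob_space_axioms)
qed

text \<open>Three errors occur: from the product over sites to an exponential, from
  \<open>real n * rate n\<close> to \<open>\<tau>\<close>, and from the average
  \<open>B n \<omega> / real n\<close> to its limit. The first two are bounded uniformly in
  \<open>\<omega>\<close>; for the third convergence in mean suffices, as \<open>exp\<close> is
  Lipschitz on the negative half-line.\<close>

lemma pgf_exceedances_tendsto:
  assumes m: "m > 0" and z: "\<And>l. 0 < z l \<and> z l \<le> (1::real)"
  shows "(\<lambda>n. expectation (\<lambda>\<omega>. \<Prod>l\<le>m. z l ^ grid_count m (exceedances X \<xi> u n \<omega>) l)) \<longlonglongrightarrow> exp (- (\<tau> * limit_rate m z))"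
proof -
  define c where "c = limit_rate m z"
  have g_le: "0 \<le> geo_pgf (z l)" for l using z[of l] by simp
  have c: "c \<ge> 0"
    unfolding c_def limit_rate_def[OF m z]
    using z g_le by (intro divide_nonneg_nonneg sum_nonneg mult_nonneg_nonneg) auto
  define B where "B n \<omega> = (\<Sum>i\<le>n. site_term m z n i \<omega>)" for n \<omega>
  have B0: "0 \<le> B n \<omega>" "B n \<omega> \<le> real n + 1" for n \<omega>
  proof -
    show "0 \<le> B n \<omega>" unfolding B_def by (intro sum_nonneg site_term_range(1)[OF m z])
    have "B n \<omega> \<le> (\<Sum>i\<le>n. 1)" unfolding B_def by (intro sum_mono site_term_range(2)[OF m z])
    then show "B n \<omega> \<le> real n + 1" by simp
  qed
  define e where "e n = expectation (\<lambda>\<omega>. \<bar>B n \<omega> / real n - c\<bar>)" for n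
  have e0: "e \<longlonglongrightarrow> 0" unfolding e_def[abs_def] B_def c_def by (rule site_average_tendsto[OF m z])
  let ?L = "\<lambda>n. expectation (\<lambda>\<omega>. \<Prod>l\<le>m. z l ^ grid_count m (exceedances X \<xi> u n \<omega>) l)"
  have bound: "\<bar>?L n - exp (- (\<tau> * c))\<bar> \<le> (real n + 1) * (rate n)\<^sup>2 + \<bar>real n * rate n - \<tau>\<bar> * ((real n + 1) / real n) + \<tau> * e n"
    if n: "n > 0" for n
  proof -
    define y where "y i = z (cell m n i)" for i
    have y: "0 \<le> y i \<and> y i \<le> 1" for i using z[of "cell m n i"] by (simp add: y_def)
    define b where "b v s = 1 - (\<Prod>i\<in>{i \<in> {..n}. v i = s}. y i)" for v :: "nat \<Rightarrow> int" and s
    let ?V = "site_prod n y"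
    have V_def: "?V v = (\<Prod>s\<in>v ` {..n}. 1 - rate n * b v s)" for v
      by (simp add: site_prod_def b_def)
    have b: "0 \<le> b v s \<and> b v s \<le> 1" for v s
      unfolding b_def using y by (auto intro!: prod_nonneg prod_le_1)
    have prod_eq: "(\<Prod>l\<le>m. z l ^ grid_count m (exceedances X \<xi> u n \<omega>) l) = exceed_prod n y (\<lambda>i. walk X i \<omega>) \<omega>" for \<omega>
    proof -
      have "(\<Prod>l\<le>m. z l ^ grid_count m (exceedances X \<xi> u n \<omega>) l) = (\<Prod>i\<le>n. \<Prod>l\<le>m. z l ^ of_bool (\<xi> (walk X i \<omega>) \<omega> > u n \<and> cell m n i = l))"
        unfolding grid_count_exceedances[OF n] power_sum by (rule prod.swap)
      also have "\<dots> = exceed_prod n y (\<lambda>i. walk X i \<omega>) \<omega>"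
        unfolding exceed_prod_def
      proof (rule prod.cong[OF refl])
        fix i assume "i \<in> {..n}"
        then have "cell m n i \<in> {..m}" using cell_le by simp
        then show "(\<Prod>l\<le>m. z l ^ of_bool (\<xi> (walk X i \<omega>) \<omega> > u n \<and> cell m n i = l)) = (if \<xi> (walk X i \<omega>) \<omega> > u n then y i else 1)"
          by (subst prod.remove[of _ "cell m n i"]) (auto intro!: prod.neutral simp: y_def)
      qed
      finally show ?thesis .
    qed
    have L: "?L n = expectation (\<lambda>\<omega>. ?V (\<lambda>i. walk X i \<omega>))"
      unfolding prod_eq by (rule expectation_exceed_prod(1)[OF y])
    have [measurable]: "(\<lambda>\<omega>. ?V (\<lambda>i. walk X i \<omega>)) \<in> borel_measurable M"
      by (rule expectation_exceed_prod(2)[OF y])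
    have [measurable]: "B n \<in> borel_measurable M"
      unfolding B_def using measurable_site_term[OF m z] by measurable
    \<comment> \<open>Applied to the set of visits to each site,
      \<open>one_minus_prod_telescope\<close> turns the sum over the random set of sites into a sum
      over the fixed times \<open>0\<close> to \<open>n\<close>.\<close>
    have B_eq: "(\<Sum>s\<in>(\<lambda>i. walk X i \<omega>) ` {..n}. b (\<lambda>i. walk X i \<omega>) s) = B n \<omega>" for \<omega>
    proof -
      have "b (\<lambda>i. walk X i \<omega>) s = (\<Sum>i\<in>{i \<in> {..n}. walk X i \<omega> = s}. site_term m z n i \<omega>)" for s
        unfolding b_def
      proof (subst one_minus_prod_telescope, simp, rule sum.cong[OF refl])
        fix i assume i: "i \<in> {i \<in> {..n}. walk X i \<omega> = s}"
        then have "{j \<in> {i \<in> {..n}. walk X i \<omega> = s}. i < j} = {j \<in> {..n}. i < j \<and> walk X j \<omega> = walk X i \<omega>}" by auto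
        then show "(1 - y i) * (\<Prod>j\<in>{j \<in> {i \<in> {..n}. walk X i \<omega> = s}. i < j}. y j) = site_term m z n i \<omega>"
          by (simp only: site_term_def[OF m z] y_def)
      qed
      then show ?thesis unfolding B_def by (simp only: sum.image_gen[of "{..n}" _ "\<lambda>i. walk X i \<omega>"] finite_atMost)
    qed
    have pt: "\<bar>?V (\<lambda>i. walk X i \<omega>) - exp (- (\<tau> * c))\<bar> \<le>
        (real n + 1) * (rate n)\<^sup>2 + \<bar>real n * rate n - \<tau>\<bar> * ((real n + 1) / real n) + \<tau> * \<bar>B n \<omega> / real n - c\<bar>" for \<omega>
    proof -
      let ?W = "(\<lambda>i. walk X i \<omega>) ` {..n}"
      have "\<bar>?V (\<lambda>i. walk X i \<omega>) - exp (- (rate n * B n \<omega>))\<bar> \<le> real (card ?W) * (rate n)\<^sup>2"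
        unfolding V_def B_eq[symmetric] using b rate_range by (intro prod_one_minus_exp) auto
      also have "\<dots> \<le> (real n + 1) * (rate n)\<^sup>2"
        using card_image_le[of "{..n}" "\<lambda>i. walk X i \<omega>"] by (intro mult_right_mono) auto
      finally have 1: "\<bar>?V (\<lambda>i. walk X i \<omega>) - exp (- (rate n * B n \<omega>))\<bar> \<le> (real n + 1) * (rate n)\<^sup>2" .
      have 2: "\<bar>exp (- (rate n * B n \<omega>)) - exp (- (\<tau> * c))\<bar> \<le> \<bar>rate n * B n \<omega> - \<tau> * c\<bar>"
        using rate_range B0 tau c by (intro abs_exp_minus_diff_le) auto
      \<comment> \<open>This separates the error of the rate, weighted by the bounded average, from
        the error of the average.\<close>
      have "rate n * B n \<omega> - \<tau> * c = (real n * rate n - \<tau>) * (B n \<omega> / real n) + \<tau> * (B n \<omega> / real n - c)"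
        using n by (simp add: field_simps)
      then have "\<bar>rate n * B n \<omega> - \<tau> * c\<bar> \<le> \<bar>real n * rate n - \<tau>\<bar> * (B n \<omega> / real n) + \<tau> * \<bar>B n \<omega> / real n - c\<bar>"
        using abs_triangle_ineq[of "(real n * rate n - \<tau>) * (B n \<omega> / real n)" "\<tau> * (B n \<omega> / real n - c)"] B0[of n \<omega>] tau
        by (simp add: abs_mult)
      moreover have "\<bar>real n * rate n - \<tau>\<bar> * (B n \<omega> / real n) \<le> \<bar>real n * rate n - \<tau>\<bar> * ((real n + 1) / real n)"
        using B0(2)[of n \<omega>] by (intro mult_left_mono divide_right_mono) auto
      ultimately show ?thesis using 1 2 by linarith
    qed
    have V1: "\<bar>?V v\<bar> \<le> 1" for v
      unfolding V_def
    proof (rule abs_prod_le_one)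
      fix s
      have "0 \<le> rate n * b v s" "rate n * b v s \<le> 1" using b[of v s] rate_range[of n] by (auto intro: mult_le_one)
      then show "\<bar>1 - rate n * b v s\<bar> \<le> 1" by simp
    qed
    have int_V: "integrable M (\<lambda>\<omega>. ?V (\<lambda>i. walk X i \<omega>))"
      using V1 by (intro integrable_const_bound[of _ 1]) auto
    have int_B: "integrable M (B n)"
      using B0[of n] by (intro integrable_const_bound[of _ "real n + 1"]) auto
    have "\<bar>?L n - exp (- (\<tau> * c))\<bar> = \<bar>expectation (\<lambda>\<omega>. ?V (\<lambda>i. walk X i \<omega>) - exp (- (\<tau> * c)))\<bar>"
      unfolding L using int_V by (simp add: prob_space)
    also have "\<dots> \<le> expectation (\<lambda>\<omega>. \<bar>?V (\<lambda>i. walk X i \<omega>) - exp (- (\<tau> * c))\<bar>)"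
      by (rule integral_abs_bound)
    also have "\<dots> \<le> expectation (\<lambda>\<omega>. (real n + 1) * (rate n)\<^sup>2 + \<bar>real n * rate n - \<tau>\<bar> * ((real n + 1) / real n) + \<tau> * \<bar>B n \<omega> / real n - c\<bar>)"
      using pt int_V int_B by (intro integral_mono) auto
    also have "\<dots> = (real n + 1) * (rate n)\<^sup>2 + \<bar>real n * rate n - \<tau>\<bar> * ((real n + 1) / real n) + \<tau> * e n"
      using int_B by (simp add: prob_space e_def)
    finally show ?thesis .
  qed
  have rn: "(\<lambda>n. real n * rate n) \<longlonglongrightarrow> \<tau>" using thresholds by (simp add: rate_def)
  have n1: "(\<lambda>n. (real n + 1) / real n) \<longlonglongrightarrow> 1" by real_asymp
  \<comment> \<open>The factorization of \<open>(real n + 1) * (rate n)\<^sup>2\<close> into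
    convergent factors, of which \<open>1 / real n\<close> tends to 0.\<close>
  have "(\<lambda>n. ((real n + 1) / real n) * (real n * rate n) * (real n * rate n) * (1 / real n)) \<longlonglongrightarrow> 1 * \<tau> * \<tau> * 0"
    by (intro tendsto_mult n1 rn lim_1_over_n)
  moreover have "eventually (\<lambda>n. ((real n + 1) / real n) * (real n * rate n) * (real n * rate n) * (1 / real n) = (real n + 1) * (rate n)\<^sup>2) sequentially"
    using eventually_gt_at_top[of 0] by eventually_elim (simp add: power2_eq_square field_simps)
  ultimately have t1: "(\<lambda>n. (real n + 1) * (rate n)\<^sup>2) \<longlonglongrightarrow> 0"
    using tendsto_cong by force
  have t2: "(\<lambda>n. \<bar>real n * rate n - \<tau>\<bar> * ((real n + 1) / real n)) \<longlonglongrightarrow> 0 * 1"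
    by (intro tendsto_mult n1 tendsto_rabs_zero LIM_zero rn)
  have lim: "(\<lambda>n. (real n + 1) * (rate n)\<^sup>2 + \<bar>real n * rate n - \<tau>\<bar> * ((real n + 1) / real n) + \<tau> * e n) \<longlonglongrightarrow> 0 + 0 * 1 + \<tau> * 0"
    by (rule tendsto_add[OF tendsto_add[OF t1 t2] tendsto_mult[OF tendsto_const e0]])
  have "(\<lambda>n. ?L n - exp (- (\<tau> * c))) \<longlonglongrightarrow> 0"
  proof (rule Lim_null_comparison)
    show "eventually (\<lambda>n. norm (?L n - exp (- (\<tau> * c))) \<le> (real n + 1) * (rate n)\<^sup>2 + \<bar>real n * rate n - \<tau>\<bar> * ((real n + 1) / real n) + \<tau> * e n) sequentially"
      using eventually_gt_at_top[of 0] by eventually_elim (simp only: real_norm_def bound)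
  qed (use lim in simp)
  then show ?thesis unfolding c_def by (rule LIM_zero_cancel)
qed

text \<open>\<open>geometric_pmf\<close> starts at 0 and is the law of the number of returns; a
  cluster also contains its first visit, hence the shift by \<open>Suc\<close>.\<close>

lemma exceedances_converge:
  defines "\<pi> \<equiv> map_pmf Suc (geometric_pmf q)"
  shows "\<exists>(Q :: (nat \<times> (nat \<Rightarrow> real) \<times> (nat \<Rightarrow> nat)) measure) \<Psi>.
    compound_poisson_process Q (q * \<tau>) \<pi> \<Psi> \<and> converges_in_distribution M (exceedances X \<xi> u) Q \<Psi>"
proof -
  interpret CP: compound_poisson_construction "q * \<tau>" \<pi>
    using q_bounds tau by unfold_locales simp
  have "converges_in_distribution M (exceedances X \<xi> u) CP.Q CP.\<Psi>"
  proof (rule converges_in_distribution_of_grid_counts)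
    show cnt: "(\<lambda>\<omega>. grid_count m (exceedances X \<xi> u n \<omega>) l) \<in> M \<rightarrow>\<^sub>M count_space UNIV" for n m l
      by (rule exceedances_measurable) simp
    fix m :: nat and \<kappa> assume m: "m > 0"
    show "(\<lambda>n. \<P>(\<omega> in M. grid_counts_eq m \<kappa> (exceedances X \<xi> u n \<omega>))) \<longlonglongrightarrow> \<P>(\<omega> in CP.Q. grid_counts_eq m \<kappa> (CP.\<Psi> \<omega>))"
      unfolding grid_counts_eq_def
    proof (rule pgf_continuity[OF _ prob_space_axioms CP.Q.prob_space_axioms cnt CP.measurable_grid_count_\<Psi>])
      fix z :: "nat \<Rightarrow> real" assume z: "\<And>i. 0 < z i \<and> z i \<le> 1"
      \<comment> \<open>\<open>geometric_pgf\<close>, applied in every cell, identifies the exponent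
        obtained from the walk with that of the compound Poisson process.\<close>
      have "\<tau> * limit_rate m z = q * \<tau> * (\<Sum>i<m. 1 - (\<integral>k. z i ^ k \<partial>measure_pmf \<pi>)) / real m"
        unfolding limit_rate_def[OF m z] \<pi>_def using z by (simp add: geometric_pgf sum_distrib_left[symmetric])
      then show "(\<lambda>n. \<integral>\<omega>. (\<Prod>i\<in>{..m}. z i ^ grid_count m (exceedances X \<xi> u n \<omega>) i) \<partial>M) \<longlonglongrightarrow>
          (\<integral>\<omega>. (\<Prod>i\<in>{..m}. z i ^ grid_count m (CP.\<Psi> \<omega>) i) \<partial>CP.Q)"
        using pgf_exceedances_tendsto[of m z, OF m z] CP.pgf_grid_count_\<Psi>[of m z, OF m z] by simp
    qed simp
  qed (auto intro: point_process_exceedances CP.point_process_\<Psi> CP.measurable_grid_count_\<Psi>)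
  with CP.compound_poisson_process show ?thesis by blast
qed

end

theorem proposition4:
  fixes M :: "'a measure" and X :: "nat \<Rightarrow> 'a \<Rightarrow> int" and \<xi> :: "int \<Rightarrow> 'a \<Rightarrow> real"
    and p :: real and u :: "real \<Rightarrow> nat \<Rightarrow> real"
  assumes "prob_space M"
    and "0 < p" "p < 1" "p \<noteq> 1 / 2"
    and X_indep: "prob_space.indep_vars M (\<lambda>_. count_space UNIV) X {1..}"
    and X_up: "\<And>i. i \<ge> 1 \<Longrightarrow> \<P>(\<omega> in M. X i \<omega> = 1) = p"
    and X_down: "\<And>i. i \<ge> 1 \<Longrightarrow> \<P>(\<omega> in M. X i \<omega> = -1) = 1 - p"
    and xi_indep: "prob_space.indep_vars M (\<lambda>_. borel) \<xi> UNIV"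
    and xi_ident: "\<And>s. distr M borel (\<xi> s) = distr M borel (\<xi> 0)"
    and xi_X_indep: "indep_rv M
          (\<Pi>\<^sub>M s\<in>UNIV. borel) (\<lambda>\<omega> s. \<xi> s \<omega>)
          (\<Pi>\<^sub>M i\<in>{1..}. count_space UNIV) (\<lambda>\<omega>. \<lambda>i\<in>{1..}. X i \<omega>)"
    and thresholds: "\<And>\<tau>. \<tau> > 0 \<Longrightarrow>
          (\<lambda>n. real n * \<P>(\<omega> in M. \<xi> 0 \<omega> > u \<tau> n)) \<longlonglongrightarrow> \<tau>"
  shows "\<forall>\<tau>>0. \<exists>\<pi> :: nat pmf.
      set_pmf \<pi> \<subseteq> {1..} \<and>
      (\<forall>j\<ge>1. pmf \<pi> j =
           (\<P>(\<omega> in M. visits X \<omega> = j) - \<P>(\<omega> in M. visits X \<omega> = j + 1)) / escape_prob M X \<and>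
         pmf \<pi> j = escape_prob M X * (1 - escape_prob M X) ^ (j - 1)) \<and>
      (\<exists>(Q :: (nat \<times> (nat \<Rightarrow> real) \<times> (nat \<Rightarrow> nat)) measure) \<Psi>.
         compound_poisson_process Q (escape_prob M X * \<tau>) \<pi> \<Psi> \<and>
         converges_in_distribution M (exceedances X \<xi> (u \<tau>)) Q \<Psi>)"
proof (intro allI impI)
  fix \<tau> :: real assume "\<tau> > 0"
  interpret biased_walk M X p
    using assms by (intro biased_walk.intro biased_walk_axioms.intro)
  interpret walk_in_scenery M X p \<xi> "u \<tau>" \<tau>
    using xi_indep xi_ident xi_X_indep thresholds[OF \<open>\<tau> > 0\<close>] \<open>\<tau> > 0\<close> by unfold_locales
  let ?\<pi> = "map_pmf Suc (geometric_pmf q)"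
  have pmf: "pmf ?\<pi> (Suc k) = q * (1 - q) ^ k" for k
    using q_bounds by (simp add: pmf_map_inj' mult.commute)
  have "pmf ?\<pi> j = (prob {\<omega> \<in> space M. visits X \<omega> = j} - prob {\<omega> \<in> space M. visits X \<omega> = j + 1}) / q \<and>
      pmf ?\<pi> j = q * (1 - q) ^ (j - 1)" if j1: "j \<ge> 1" for j
  proof -
    obtain k where j: "j = Suc k" using j1 not0_implies_Suc[of j] by auto
    \<comment> \<open>The difference of consecutive visit probabilities is \<open>q\<close> times
      the geometric weight, so dividing by \<open>q\<close> leaves that weight.\<close>
    have "q * (1 - q) ^ k - q * (1 - q) ^ Suc k = q * (q * (1 - q) ^ k)" by (simp add: algebra_simps)
    then show ?thesis using q_bounds prob_visits[of k] prob_visits[of "Suc k"] by (simp add: j pmf)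
  qed
  moreover have "set_pmf ?\<pi> \<subseteq> {1..}" by auto
  ultimately show "\<exists>\<pi> :: nat pmf.
      set_pmf \<pi> \<subseteq> {1..} \<and>
      (\<forall>j\<ge>1. pmf \<pi> j = (prob {\<omega> \<in> space M. visits X \<omega> = j} - prob {\<omega> \<in> space M. visits X \<omega> = j + 1}) / q \<and>
         pmf \<pi> j = q * (1 - q) ^ (j - 1)) \<and>
      (\<exists>(Q :: (nat \<times> (nat \<Rightarrow> real) \<times> (nat \<Rightarrow> nat)) measure) \<Psi>.
         compound_poisson_process Q (q * \<tau>) \<pi> \<Psi> \<and>
         converges_in_distribution M (exceedances X \<xi> (u \<tau>)) Q \<Psi>)"
    using exceedances_converge by blast
qed

end
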